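(* Let $p\ge2$ be an integer, $r\in\mathbb{Z}$, $1\le s\le p-1$, $\lambda\in\mathbb{C}$, and $\varepsilon\in\mathbb{C}$ written as $\varepsilon=(\varepsilon_0+ik)/\sqrt{2p}$ with $k\in\mathbb{Z}$, $\varepsilon_0=u_0+iv_0$, $u_0,v_0\in\mathbb{R}$, $-1/2<v_0\le1/2$. (i) If $\operatorname{Re}(\varepsilon)<0$, or ($\operatorname{Re}(\varepsilon)>0$ and $|v_0|>|u_0|$), or ($\operatorname{Re}(\varepsilon)>0$, $p\mid k$, $|u_0|<1-|v_0|$, and $v_0\ne1/2$), or ($u_0=0$ and $v_0\neq0$), then $$\operatorname{qdim}[M^\varepsilon_{r,s}]=e^{\pi\varepsilon\sqrt{2p}(1-r)}\frac{\sinh\left(\frac{\sqrt2\pi s\varepsilon}{\sqrt p}\right)}{\sinh\left(\frac{\sqrt2\pi\varepsilon}{\sqrt p}\right)},\qquad \operatorname{qdim}[F^\varepsilon_\lambda]=e^{2\pi\varepsilon\left(\lambda-\sqrt{\frac p2}+\sqrt{\frac1{2p}}\right)}\frac{\sinh\left(\sqrt{2p}\pi\varepsilon\right)}{\sinh\left(\frac{\sqrt2\pi\varepsilon}{\sqrt p}\right)}.$$ (ii) If $\operatorname{Re}(\varepsilon)>0$, $p\nmid k$, $|v_0|\le|u_0|$, and $v_0\ne1/2$, then $\operatorname{qdim}[M^\varepsilon_{r,s}]=(-1)^{k(r+1)}\frac{\sin(\pi ks/p)}{\sin(\pi k/p)}$ and $\operatorname{qdim}[F^\varepsilon_\lambda]=0$.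 (iii) If $\operatorname{Re}(\varepsilon)>0$, $p\mid k$, $1-|u_0|\le|v_0|\le|u_0|$, and $v_0\ne1/2$, then $\operatorname{qdim}[M^\varepsilon_{r,s}]=(-1)^{(r+1)(k+1)+\frac{k(s+1)}{p}}\frac{\sin(\pi s/p)}{\sin(\pi/p)}$ and $\operatorname{qdim}[F^\varepsilon_\lambda]=0$. (iv) If $\operatorname{Re}(\varepsilon)>0$, $v_0=1/2$, and $|u_0|\ge1/2$, then $\operatorname{qdim}[F^\varepsilon_\lambda]=0$, and $\operatorname{qdim}[M^\varepsilon_{r,s}]$ exists if and only if $$\tan\left(\frac{\pi s}{2p}+\frac{\pi r}2\right)\tan\left(\frac{\pi}{2p}\right)=\tan\left(\frac{\pi(2k+1)s}{2p}+\frac{\pi r}2\right)\tan\left(\frac{\pi(2k+1)}{2p}\right);$$ if this condition holds, then $$\operatorname{qdim}[M^\varepsilon_{r,s}]=\frac{(-1)^{(r+1)k+1}\sin\left(\frac{\pi s}{2p}+\frac{\pi r}2\right)\cos\left(\frac{\pi}{2p}(2k+1)s+\frac{\pi r}2\right)}{\cos\left(\frac\pi{2p}\right)\sin\left(\frac{\pi}{2p}(2k+1)\right)}.$$ (v) If $\varepsilon_0=0$ and $p\nmid ks$, then $\operatorname{qdim}[M^\varepsilon_{r,s}]=(-1)^{k(r+1)}\frac{\sin(\pi ks/p)}{\sin(\pi k/p)}$ and $\operatorname{qdim}[F^\varepsilon_\lambda]=0$. (vi) If $\varepsilon_0=0$ and $p\mid ks$, then: (a) if $k\notin p\mathbb{Z}$,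 $\operatorname{qdim}[M^\varepsilon_{r,s}]=0$ and $\operatorname{qdim}[F^\varepsilon_\lambda]=0$; (b) if $k\in p(2\mathbb{Z})$, $\operatorname{qdim}[M^\varepsilon_{r,s}]=s$ and $\operatorname{qdim}[F^\varepsilon_\lambda]=e^{\frac{2\pi ik\lambda}{\sqrt{2p}}}p$; (c) if $k\in p(2\mathbb{Z}+1)$, $\operatorname{qdim}[M^\varepsilon_{r,s}]=(-1)^{(s+1)+p(r+1)}s$ and $\operatorname{qdim}[F^\varepsilon_\lambda]=e^{\frac{2\pi ik\lambda}{\sqrt{2p}}}p$.
   Context: Let $q=e^{2\pi i\tau}$ for $\tau$ in the upper half-plane, $q^x:=e^{2\pi i x\tau}$, and $\eta(\tau):=q^{1/24}\prod_{n\ge1}(1-q^n)$. For $\varepsilon\in\mathbb{C}$, $r\in\mathbb{Z}$, $1\le s\le p-1$, the regularized atypical characters of the $(1,p)$-singlet algebra are $$\operatorname{ch}[M^\varepsilon_{r,s}](\tau)=\frac1{\eta(\tau)}\sum_{n\ge0}\left(e^{\frac{2\pi\varepsilon}{\sqrt{2p}}(2pn-s-pr+2p)}q^{\frac1{4p}(2pn-s-pr+2p)^2}-e^{\frac{2\pi\varepsilon}{\sqrt{2p}}(2pn+s-pr+2p)}q^{\frac1{4p}(2pn+s-pr+2p)^2}\right),$$ and for $\lambda\in\mathbb{C}$, with $\alpha_0:=\sqrt{2p}-\sqrt{2/p}$, the regularized typical characters are $\operatorname{ch}[F^\varepsilon_\lambda](\tau)=e^{2\pi\varepsilon(\lambda-\frac{\alpha_0}2)}q^{\frac12(\lambda-\frac{\alpha_0}{2})^2}/\eta(\tau)$.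 The regularized quantum dimensions are $\operatorname{qdim}[M^\varepsilon_{r,s}]:=\lim_{t\to0^+}\frac{\operatorname{ch}[M^\varepsilon_{r,s}](it)}{\operatorname{ch}[M^\varepsilon_{1,1}](it)}$ and $\operatorname{qdim}[F^\varepsilon_\lambda]:=\lim_{t\to0^+}\frac{\operatorname{ch}[F^\varepsilon_\lambda](it)}{\operatorname{ch}[M^\varepsilon_{1,1}](it)}$.
   Formalization: In (iii) v_0≠0 is added, since for v_0=0 the character of M_{1,1} oscillates through zero and qdim[F] does not exist; in (iv) p∤2k+1 is added, since otherwise tan(π(2k+1)/(2p)) is a pole and qdim[F]=0 fails for the same reason. *)

theory Defs
  imports "HOL-Analysis.Analysis"
begin

text \<open>
  \<open>qpow x \<tau>\<close> is $q^x = e^{2\pi i x\tau}$; it is a function of \<open>x\<close> and \<open>\<tau>\<close>, not a power of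
  the number $q$, so no branch of the logarithm is chosen.
\<close>

definition qpow :: "complex \<Rightarrow> complex \<Rightarrow> complex" where
  "qpow x \<tau> = exp (2 * of_real pi * \<i> * x * \<tau>)"

definition dedekind_eta :: "complex \<Rightarrow> complex" where
  "dedekind_eta \<tau> = qpow (1/24) \<tau> * (\<Prod>n. 1 - qpow (of_nat (Suc n)) \<tau>)"

definition theta_term :: "nat \<Rightarrow> complex \<Rightarrow> int \<Rightarrow> complex \<Rightarrow> complex" where
  "theta_term p \<epsilon> m \<tau> =
     exp (2 * of_real pi * \<epsilon> / of_real (sqrt (2 * real p)) * of_int m)
       * qpow ((of_int m)\<^sup>2 / (4 * of_nat p)) \<tau>"

definition ch_M :: "nat \<Rightarrow> complex \<Rightarrow> int \<Rightarrow> nat \<Rightarrow> complex \<Rightarrow> complex" where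
  "ch_M p \<epsilon> r s \<tau> =
     1 / dedekind_eta \<tau> *
       (\<Sum>n. theta_term p \<epsilon> (2 * int p * int n - int s - int p * r + 2 * int p) \<tau>
            - theta_term p \<epsilon> (2 * int p * int n + int s - int p * r + 2 * int p) \<tau>)"

definition alpha0 :: "nat \<Rightarrow> real" where
  "alpha0 p = sqrt (2 * real p) - sqrt (2 / real p)"

definition ch_F :: "nat \<Rightarrow> complex \<Rightarrow> complex \<Rightarrow> complex \<Rightarrow> complex" where
  "ch_F p \<epsilon> \<mu> \<tau> =
     exp (2 * of_real pi * \<epsilon> * (\<mu> - of_real (alpha0 p / 2)))
       * qpow ((\<mu> - of_real (alpha0 p / 2))\<^sup>2 / 2) \<tau> / dedekind_eta \<tau>"

text \<open>
  \<open>has_qdim p \<epsilon> ch L\<close>: the regularized quantum dimension of the module with character \<open>ch\<close>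
  exists and equals \<open>L\<close>.
\<close>

definition has_qdim :: "nat \<Rightarrow> complex \<Rightarrow> (complex \<Rightarrow> complex) \<Rightarrow> complex \<Rightarrow> bool" where
  "has_qdim p \<epsilon> ch L \<longleftrightarrow>
     ((\<lambda>t::real. ch (\<i> * of_real t) / ch_M p \<epsilon> 1 1 (\<i> * of_real t)) \<longlongrightarrow> L) (at_right 0)"

end

theory Submission
  imports Defs
begin

text \<open>
  At \<open>\<tau> = it\<close> put \<open>c = 2\<pi>pt\<close> and \<open>z = \<epsilon>sqrt(2p)\<close>. The eta factors cancel in every quotient, and the numerator
  of a character is a difference of two half-line sums \<open>\<Sum>n\<ge>0. e^(2\<pi>z(n+a) - c(n+a)^2)\<close>.
  For \<open>Re z \<le> 0\<close> such a sum tends to its Abel value \<open>e^(2\<pi>za) / (1 - e^(2\<pi>z))\<close>.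
  For \<open>Re z > 0\<close> it is a full theta series minus the half-line sum of \<open>-z\<close>; Poisson summation turns the
  theta series into \<open>C(c) \<Sum>m. e^(2\<pi>ima) e^(\<pi>^2(z-im)^2/c)\<close>, and everything depends on which terms with
  non-zero coefficient \<open>-2i(-1)^(mr) sin(\<pi>ms/p)\<close> maximise \<open>(Re z)^2 - (Im z - m)^2\<close> and on the sign of that
  maximum. Two equally large terms occur exactly for \<open>v\<^sub>0 = 1/2\<close>, where the quotient oscillates unless the
  two coefficient vectors are proportional. Poisson summation, needed only up to the factor \<open>C(c)\<close>, is
  obtained from Polya's argument: sum \<open>(2 cosh(s/2))^(2m)\<close> over shifts by roots of unity, and let \<open>m\<close>
  tend to infinity with the central binomial coefficients becoming Gaussian.
\<close>

section \<open>Poisson summation for Gaussian series\<close>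

text \<open>Two obstacles shape the proof. As \<open>c\<close> tends to 0, the terms of a half-line
  sum tend to powers of \<open>exp (2 pi z)\<close>. For imaginary \<open>z\<close> these have
  modulus 1, so no summable majorant exists. Only second differences of the Gaussian decay like
  \<open>1 / n^2\<close> uniformly in \<open>c\<close>, and the half-line limits are rewritten in
  terms of them. The prefactor of the dual series is classically \<open>sqrt (pi / c)\<close>, but
  quotients of characters only need that it diverges and grows at most like \<open>1 / c\<close>.
  Comparing a parameter \<open>w\<close> with the parameter 0 thus replaces the Gaussian integral
  and Stirling's formula. A quotient is controlled only if the leading part of its denominator stays
  away from 0. It does not when two equally near frequencies carry coefficients of equal modulus. In
  the third clause of the theorem this would happen for \<open>v\<^sub>0 = 0\<close>, where
  \<open>k - 1\<close> and \<open>k + 1\<close> tie; in the fourth, when \<open>p\<close> divides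
  \<open>2 * k + 1\<close>. Hence the conditions \<open>v\<^sub>0 \<noteq> 0\<close> and
  \<open>\<not> int p dvd 2 * k + 1\<close> there.\<close>

lemma summable_on_intI:
  fixes f :: "int \<Rightarrow> 'a :: banach"
  assumes "(\<lambda>n. f (int n)) summable_on UNIV" "(\<lambda>n. f (- int n)) summable_on UNIV"
  shows "f summable_on UNIV"
proof -
  have 1: "f summable_on range int"
    using assms(1) by (subst summable_on_reindex) (auto simp: o_def inj_on_def)
  have "f summable_on range (\<lambda>n. - int n)"
    using assms(2) by (subst summable_on_reindex) (auto simp: o_def inj_on_def)
  hence 2: "f summable_on (range (\<lambda>n. - int n) - range int)"
    by (rule summable_on_subset_banach) auto
  have "f summable_on (range int \<union> (range (\<lambda>n. - int n) - range int))"
    by (rule summable_on_Un_disjoint[OF 1 2]) auto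
  moreover have "range int \<union> (range (\<lambda>n. - int n) - range int) = UNIV"
  proof -
    have "x \<in> range int \<or> x \<in> range (\<lambda>n. - int n)" for x
      by (cases x rule: int_cases2) auto
    thus ?thesis by blast
  qed
  ultimately show ?thesis by simp
qed

lemma summable_exp_gauss_nat:
  fixes A c :: real
  assumes "c > 0"
  shows "summable (\<lambda>n. exp (A * real n - c * (real n)\<^sup>2))"
proof (rule summable_comparison_test_ev)
  show "summable (\<lambda>n. exp (-1::real) ^ n)"
    by (intro summable_geometric) simp
  show "\<forall>\<^sub>F n in sequentially. norm (exp (A * real n - c * (real n)\<^sup>2)) \<le> exp (-1) ^ n"
    using eventually_ge_at_top[of "nat \<lceil>(A + 1) / c\<rceil>"]
  proof eventually_elim
    case (elim n)
    have "(A + 1) / c \<le> real n" using elim by linarith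
    hence "A + 1 \<le> c * real n" using assms by (simp add: field_simps)
    hence "(A + 1) * real n \<le> c * real n * real n" by (intro mult_right_mono) auto
    hence "A * real n - c * (real n)\<^sup>2 \<le> real n * (- 1)"
      by (simp add: power2_eq_square algebra_simps)
    thus ?case by (simp add: exp_of_nat_mult[symmetric] del: mult_minus_right)
  qed
qed

lemma summable_on_exp_gauss_int:
  fixes A c :: real
  assumes "c > 0"
  shows "(\<lambda>n::int. exp (A * \<bar>of_int n\<bar> - c * (of_int n)\<^sup>2)) summable_on UNIV"
  by (rule summable_on_intI; simp; intro norm_summable_imp_summable_on)
     (use summable_exp_gauss_nat[OF assms] in simp_all)

text \<open>Dominated convergence for unconditional sums over the integers.
  \<open>int_decode\<close> enumerates them, and norm summability, which the majorant supplies both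
  along the filter and for the limit, identifies \<open>infsum\<close> with the
  \<open>suminf\<close> of the enumeration.\<close>

lemma tannery_int:
  fixes f :: "int \<Rightarrow> 'b \<Rightarrow> complex"
  assumes lim: "\<And>j. ((\<lambda>n. f j n) \<longlongrightarrow> g j) F"
    and bound: "\<forall>\<^sub>F n in F. \<forall>j. norm (f j n) \<le> M j"
    and M: "M summable_on UNIV" and F: "F \<noteq> bot"
  shows "((\<lambda>n. \<Sum>\<^sub>\<infinity>j. f j n) \<longlongrightarrow> (\<Sum>\<^sub>\<infinity>j. g j)) F"
proof -
  have bij: "bij_betw int_decode UNIV UNIV" by (rule bij_int_decode)
  have nn: "M j \<ge> 0" for j
    using eventually_happens'[OF F bound] norm_ge_zero order_trans by blast
  have "(M \<circ> int_decode) summable_on UNIV"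
    using M summable_on_reindex_bij_betw[OF bij, of M] by (simp add: o_def)
  hence sM: "summable (M \<circ> int_decode)"
    by (intro summable_on_imp_summable)
  have "\<forall>\<^sub>F (k, n) in at_top \<times>\<^sub>F F. norm (f (int_decode k) n) \<le> (M \<circ> int_decode) k"
    unfolding eventually_prod_filter
    by (rule exI[of _ "\<lambda>_. True"], intro conjI exI[of _ "\<lambda>n. \<forall>j. norm (f j n) \<le> M j"] bound) auto
  note T = tannerys_theorem[OF lim this sM F]
  have *: "\<forall>\<^sub>F n in F. summable (\<lambda>k. norm (f (int_decode k) n))"
       and **: "summable (\<lambda>k. norm (g (int_decode k)))"
       and ***: "((\<lambda>n. suminf (\<lambda>k. f (int_decode k) n)) \<longlongrightarrow> suminf (\<lambda>k. g (int_decode k))) F"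
    using T by blast+
  have eq: "(\<Sum>\<^sub>\<infinity>j. h j) = suminf (\<lambda>k. h (int_decode k))"
    if "summable (\<lambda>k. norm (h (int_decode k)))" for h :: "int \<Rightarrow> complex"
  proof -
    have "((\<lambda>k. h (int_decode k)) has_sum suminf (\<lambda>k. h (int_decode k))) UNIV"
      by (rule norm_summable_imp_has_sum[OF that summable_sums[OF summable_norm_cancel[OF that]]])
    thus ?thesis
      using infsum_reindex_bij_betw[OF bij, of h] infsumI by metis
  qed
  have "((\<lambda>n. \<Sum>\<^sub>\<infinity>j. f j n) \<longlongrightarrow> suminf (\<lambda>k. g (int_decode k))) F"
    by (rule Lim_transform_eventually[OF ***], use * in eventually_elim) (simp add: eq)
  thus ?thesis using eq[OF **] by simp
qed

section \<open>Central binomial coefficients against Gaussians\<close>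

lemma central_binomial_ratio_Suc:
  assumes "k < m"
  shows "real ((2*m) choose (m + Suc k)) = real ((2*m) choose (m + k)) * (real (m - k) / real (m + k + 1))"
proof -
  have "Suc (m+k) * ((2*m) choose (Suc (m+k))) = (2*m - (m+k)) * ((2*m) choose (m+k))"
    using binomial_absorb_comp[of "2*m" "m+k"] binomial_absorption[of "m+k" "2*m"]
    by (metis binomial_absorption)
  moreover have "2*m - (m+k) = m - k" by simp
  ultimately have "real (Suc (m+k)) * real ((2*m) choose (Suc (m+k))) = real (m - k) * real ((2*m) choose (m+k))"
    by (metis of_nat_mult)
  thus ?thesis by (simp add: field_simps)
qed

text \<open>The quotient of consecutive coefficients is \<open>1 - (2k+1)/(m+k+1)\<close>, with
  reciprocal \<open>1 + (2k+1)/(m-k)\<close>; applying \<open>1 + x \<le> exp x\<close> to both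
  bounds it from either side. Freezing the denominators at their extreme values for
  \<open>k < K\<close> lets the odd numbers \<open>2k+1\<close> add up to a square, so that a single
  Gaussian remains.\<close>

lemma central_binomial_ratio_bounds:
  assumes "k \<le> K" "K \<le> m"
  shows "real ((2*m) choose (m + k)) \<le> real ((2*m) choose m) * exp (- (real k)\<^sup>2 / real (m + K)) \<and>
         real ((2*m) choose (m + k)) \<ge> real ((2*m) choose m) * exp (- (real k)\<^sup>2 / real (m - K + 1))"
  using assms(1)
proof (induction k)
  case 0
  show ?case by simp
next
  case (Suc k)
  have k: "k < m" "k < K" "m - K + 1 \<le> m - k" using Suc.prems assms by auto
  define x where "x = real (m - k) / real (m + k + 1)"
  have mk': "real (m - k) = real m - real k" using k by (simp add: of_nat_diff)
  have "real (m + k + 1) \<noteq> 0" by linarith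
  hence x1: "x = 1 + (- (2 * real k + 1) / real (m + k + 1))"
    unfolding x_def mk' by (subst add_divide_eq_iff) auto
  have x0: "x > 0" using k by (simp add: x_def)
  have up: "real ((2*m) choose (m + Suc k)) \<le> real ((2*m) choose m) * exp (- (real (Suc k))\<^sup>2 / real (m + K))"
  proof -
    have "x \<le> exp (- (2 * real k + 1) / real (m + k + 1))"
      unfolding x1 by (rule exp_ge_add_one_self)
    also have "\<dots> \<le> exp (- (2 * real k + 1) / real (m + K))"
    proof -
      have "real (m + k + 1) \<le> real (m + K)" using k by linarith
      hence "(2 * real k + 1) / real (m + K) \<le> (2 * real k + 1) / real (m + k + 1)"
        by (intro divide_left_mono) auto
      thus ?thesis by (simp only: exp_le_cancel_iff minus_divide_left[symmetric] neg_le_iff_le)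
    qed
    finally have x: "x \<le> exp (- (2 * real k + 1) / real (m + K))" .
    have "real ((2*m) choose (m + Suc k)) = real ((2*m) choose (m + k)) * x"
      unfolding x_def by (rule central_binomial_ratio_Suc) (use k in auto)
    also have "\<dots> \<le> (real ((2*m) choose m) * exp (- (real k)\<^sup>2 / real (m + K))) * exp (- (2 * real k + 1) / real (m + K))"
      using Suc.IH k x x0 by (intro mult_mono) auto
    also have "\<dots> = real ((2*m) choose m) * exp (- (real k)\<^sup>2 / real (m + K) + - (2 * real k + 1) / real (m + K))"
      by (simp only: exp_add mult.assoc)
    also have "- (real k)\<^sup>2 / real (m + K) + - (2 * real k + 1) / real (m + K) = - (real (Suc k))\<^sup>2 / real (m + K)"
      by (simp only: add_divide_distrib[symmetric]) (simp add: power2_eq_square algebra_simps)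
    finally show ?thesis .
  qed
  have low: "real ((2*m) choose (m + Suc k)) \<ge> real ((2*m) choose m) * exp (- (real (Suc k))\<^sup>2 / real (m - K + 1))"
  proof -
    have mk: "real (m - k) > 0" using k by simp
    have "1 / x = 1 + (2 * real k + 1) / real (m - k)"
      using mk mk' by (simp add: x_def add_divide_eq_iff)
    also have "\<dots> \<le> exp ((2 * real k + 1) / real (m - k))" by (rule exp_ge_add_one_self)
    also have "\<dots> \<le> exp ((2 * real k + 1) / real (m - K + 1))"
    proof -
      have "real (m - K + 1) \<le> real (m - k)" using k by linarith
      thus ?thesis unfolding exp_le_cancel_iff by (intro divide_left_mono) auto
    qed
    finally have "1 / x \<le> exp ((2 * real k + 1) / real (m - K + 1))" .
    hence "inverse (exp ((2 * real k + 1) / real (m - K + 1))) \<le> inverse (1 / x)"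
      using x0 by (intro le_imp_inverse_le) auto
    hence x: "exp (- (2 * real k + 1) / real (m - K + 1)) \<le> x"
      by (simp add: exp_minus[symmetric] minus_divide_left)
    have "- (real (Suc k))\<^sup>2 / real (m - K + 1) = - (real k)\<^sup>2 / real (m - K + 1) + - (2 * real k + 1) / real (m - K + 1)"
      by (simp only: add_divide_distrib[symmetric]) (simp add: power2_eq_square algebra_simps)
    hence "real ((2*m) choose m) * exp (- (real (Suc k))\<^sup>2 / real (m - K + 1)) =
      (real ((2*m) choose m) * exp (- (real k)\<^sup>2 / real (m - K + 1))) * exp (- (2 * real k + 1) / real (m - K + 1))"
      by (simp only: exp_add mult.assoc)
    also have "\<dots> \<le> real ((2*m) choose (m + k)) * x"
      using Suc.IH k x x0 by (intro mult_mono) auto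
    also have "\<dots> = real ((2*m) choose (m + Suc k))"
      unfolding x_def by (rule central_binomial_ratio_Suc[symmetric]) (use k in auto)
    finally show ?thesis .
  qed
  from up low show ?case ..
qed

section \<open>Size and limits of powers of cosh\<close>

lemma abs_sin_ge:
  fixes b :: real
  assumes "\<bar>b\<bar> \<le> 2"
  shows "\<bar>sin b\<bar> \<ge> \<bar>b\<bar> / 3"
proof -
  have "\<bar>sin b - (\<Sum>m<3. sin_coeff m * b ^ m)\<bar> \<le> inverse (fact 3) * \<bar>b\<bar> ^ 3"
    by (rule Maclaurin_sin_bound)
  hence "\<bar>sin b - b\<bar> \<le> \<bar>b\<bar>^3 / 6"
    by (simp add: sin_coeff_def eval_nat_numeral field_simps)
  \<comment> \<open>On this range the cubic error is at most two thirds of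
    \<open>\<bar>b\<bar>\<close>, which leaves the third that is claimed.\<close>
  moreover have "\<bar>b\<bar>^3 \<le> 4 * \<bar>b\<bar>"
  proof -
    have "\<bar>b\<bar>^2 \<le> 2^2" using assms by (intro power_mono) auto
    hence "\<bar>b\<bar>^2 * \<bar>b\<bar> \<le> 4 * \<bar>b\<bar>" by (intro mult_right_mono) auto
    thus ?thesis by (simp add: eval_nat_numeral)
  qed
  ultimately show ?thesis by linarith
qed

text \<open>Separates the growth in the real direction from the decay in the imaginary direction;
  the majorant of the dual series needs them individually.\<close>

lemma norm_cosh_sq: "norm (cosh y)^2 = 1 + (sinh (Re y))^2 - (sin (Im y))^2"
proof -
  have "norm (cosh y)^2 = (cosh (Re y) * cos (Im y))^2 + (sinh (Re y) * sin (Im y))^2"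
    unfolding cmod_power2
    by (simp add: cosh_def sinh_def Re_exp Im_exp algebra_simps field_simps)
  also have "\<dots> = 1 + (sinh (Re y))^2 - (sin (Im y))^2"
    by (simp add: power_mult_distrib cosh_square_eq cos_squared_eq algebra_simps)
  finally show ?thesis .
qed

text \<open>With \<open>u = 2 * (sinh (x/2))^2\<close> one has \<open>cosh x = 1 + u\<close>, and
  the quotient factors into \<open>Ln (1 + u) / u\<close> and half the square of
  \<open>sinh (x/2) / (x/2)\<close>. Both limits are derivatives at 0.\<close>

lemma tendsto_Ln_cosh: "((\<lambda>x::complex. Ln (cosh x) / x\<^sup>2) \<longlongrightarrow> 1/2) (at 0)"
proof -
  have s: "((\<lambda>y::complex. sinh y / y) \<longlongrightarrow> 1) (at 0)"
  proof -
    have "(sinh has_field_derivative cosh 0) (at (0::complex))"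
      by (auto intro!: derivative_eq_intros)
    thus ?thesis by (simp add: has_field_derivative_iff)
  qed
  have h: "filterlim (\<lambda>x::complex. x/2) (at 0) (at 0)"
    by (auto simp: filterlim_at eventually_at intro!: tendsto_eq_intros exI[of _ 1])
  have s2: "((\<lambda>x::complex. sinh (x/2) / (x/2)) \<longlongrightarrow> 1) (at 0)"
    by (rule filterlim_compose[OF s h])
  have l: "((\<lambda>u::complex. Ln (1 + u) / u) \<longlongrightarrow> 1) (at 0)"
  proof -
    have "((\<lambda>u. Ln (1 + u)) has_field_derivative 1) (at (0::complex))"
      by (auto intro!: derivative_eq_intros)
    thus ?thesis by (simp add: has_field_derivative_iff)
  qed
  have ne: "\<forall>\<^sub>F x::complex in at 0. sinh (x/2) \<noteq> 0"
  proof -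
    have "\<forall>\<^sub>F x::complex in at 0. sinh (x/2) / (x/2) \<noteq> 0"
      by (rule tendsto_imp_eventually_ne[OF s2]) simp
    thus ?thesis by eventually_elim auto
  qed
  have u: "filterlim (\<lambda>x::complex. 2 * (sinh (x/2))^2) (at 0) (at 0)"
    unfolding filterlim_at using ne
    by (auto elim: eventually_mono intro!: tendsto_eq_intros)
  have L: "((\<lambda>x::complex. Ln (1 + 2 * (sinh (x/2))^2) / (2 * (sinh (x/2))^2) * ((sinh (x/2) / (x/2))^2 / 2)) \<longlongrightarrow> 1 * (1^2/2)) (at 0)"
    by (intro tendsto_intros filterlim_compose[OF l u] s2) auto
  have E: "\<forall>\<^sub>F x::complex in at 0. Ln (1 + 2 * (sinh (x/2))^2) / (2 * (sinh (x/2))^2) * ((sinh (x/2) / (x/2))^2 / 2) = Ln (cosh x) / x\<^sup>2"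
    using ne
  proof eventually_elim
    case (elim x)
    have "cosh x = 1 + 2 * (sinh (x/2))^2"
      using cosh_double[of "x/2"] by (simp add: cosh_square_eq)
    thus ?case using elim by (simp add: field_simps power2_eq_square)
  qed
  show ?thesis using Lim_transform_eventually[OF L E] by simp
qed

text \<open>The principal logarithm causes no branch trouble, because only
  \<open>exp (n * Ln y) = y ^ n\<close> is used. The exponent
  \<open>2 * m * Ln (cosh (Y / N))\<close> behaves like \<open>m * Y^2 / N^2\<close>.\<close>

lemma tendsto_cosh_power:
  fixes Y :: complex and L :: real and N :: "nat \<Rightarrow> real" and m :: "nat \<Rightarrow> nat"
  assumes N: "filterlim N at_top sequentially"
    and m: "(\<lambda>n. real (m n) / (N n)\<^sup>2) \<longlonglongrightarrow> L"
  shows "(\<lambda>n. cosh (Y / of_real (N n)) ^ (2 * m n)) \<longlonglongrightarrow> exp (of_real L * Y\<^sup>2)"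
proof (cases "Y = 0")
  case False
  have N0: "\<forall>\<^sub>F n in sequentially. N n > 0"
    using N by (simp add: filterlim_at_top_dense)
  have "(\<lambda>n. Y * of_real (inverse (N n))) \<longlonglongrightarrow> Y * of_real 0"
    by (intro tendsto_intros tendsto_inverse_0_at_top N)
  hence x0: "(\<lambda>n. Y / of_real (N n)) \<longlonglongrightarrow> 0"
    by (simp add: divide_inverse)
  have x: "filterlim (\<lambda>n. Y / of_real (N n)) (at 0) sequentially"
    unfolding filterlim_at using x0 N0 False by (auto elim: eventually_mono)
  have "(\<lambda>n. 2 * (of_real (real (m n) / (N n)\<^sup>2) * Y\<^sup>2) * (Ln (cosh (Y / of_real (N n))) / (Y / of_real (N n))\<^sup>2)) \<longlonglongrightarrow> 2 * (of_real L * Y\<^sup>2) * (1/2)"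
    by (intro tendsto_intros m filterlim_compose[OF tendsto_Ln_cosh x])
  hence L: "(\<lambda>n. exp (2 * (of_real (real (m n) / (N n)\<^sup>2) * Y\<^sup>2) * (Ln (cosh (Y / of_real (N n))) / (Y / of_real (N n))\<^sup>2))) \<longlonglongrightarrow> exp (2 * (of_real L * Y\<^sup>2) * (1/2))"
    by (rule tendsto_exp)
  have E: "\<forall>\<^sub>F n in sequentially. exp (2 * (of_real (real (m n) / (N n)\<^sup>2) * Y\<^sup>2) * (Ln (cosh (Y / of_real (N n))) / (Y / of_real (N n))\<^sup>2)) = cosh (Y / of_real (N n)) ^ (2 * m n)"
  proof -
    have "(\<lambda>n. cosh (Y / of_real (N n))) \<longlonglongrightarrow> cosh 0"
      by (intro tendsto_intros x0)
    hence "\<forall>\<^sub>F n in sequentially. cosh (Y / of_real (N n)) \<noteq> 0"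
      by (rule tendsto_imp_eventually_ne) simp
    thus ?thesis using N0
    proof eventually_elim
      case (elim n)
      have "2 * (of_real (real (m n) / (N n)\<^sup>2) * Y\<^sup>2) * (Ln (cosh (Y / of_real (N n))) / (Y / of_real (N n))\<^sup>2)
        = of_nat (2 * m n) * Ln (cosh (Y / of_real (N n)))"
        using elim False by (simp add: field_simps power2_eq_square)
      thus ?case by (simp only: exp_of_nat_mult exp_Ln[OF elim(1)])
    qed
  qed
  show ?thesis using Lim_transform_eventually[OF L E] by simp
qed auto

section \<open>Polya's identity over roots of unity\<close>

lemma sum_cis_symmetric:
  fixes M :: nat and k :: int
  defines "N \<equiv> 2 * M + 1"
  shows "(\<Sum>l=-int M..int M. exp (2 * of_real pi * \<i> * of_int l * of_int k / of_nat N)) =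
           (if int N dvd k then of_nat N else (0::complex))"
proof -
  define \<omega> :: complex where "\<omega> = exp (2 * of_real pi * \<i> * of_int k / of_nat N)"
  have N: "N > 0" by (simp add: N_def)
  have "(\<Sum>l=-int M..int M. exp (2 * of_real pi * \<i> * of_int l * of_int k / of_nat N))
     = (\<Sum>n<N. exp (2 * of_real pi * \<i> * of_int (int n - int M) * of_int k / of_nat N))"
    by (rule sum.reindex_bij_witness[of _ "\<lambda>n. int n - int M" "\<lambda>l. nat (l + int M)"])
       (auto simp: N_def)
  also have "\<dots> = (\<Sum>n<N. exp (- 2 * of_real pi * \<i> * of_nat M * of_int k / of_nat N) * \<omega> ^ n)"
    unfolding \<omega>_def exp_of_nat_mult[symmetric] exp_add[symmetric]
    by (intro sum.cong arg_cong[where f = exp]) (simp_all add: algebra_simps diff_divide_distrib add_divide_distrib)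
  also have "\<dots> = exp (- 2 * of_real pi * \<i> * of_nat M * of_int k / of_nat N) * (\<Sum>n<N. \<omega> ^ n)"
    by (simp add: sum_distrib_left)
  finally have eq: "(\<Sum>l=-int M..int M. exp (2 * of_real pi * \<i> * of_int l * of_int k / of_nat N)) = \<dots>" .
  show ?thesis
  proof (cases "int N dvd k")
    case True
    then obtain j where j: "k = int N * j" by auto
    have "exp (2 * of_real pi * \<i> * of_int l * of_int k / of_nat N) = (1::complex)" for l
    proof -
      have "2 * of_real pi * \<i> * of_int l * of_int k / of_nat N = \<i> * (of_int (l * j) * (of_real pi * 2))"
        using N by (simp add: j)
      thus ?thesis by (simp only: exp_2pi_1_int)
    qed
    thus ?thesis using True by (simp add: N_def)
  next
    case False
    have "\<omega> \<noteq> 1"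
    proof
      assume "\<omega> = 1"
      then obtain n where "Im (2 * of_real pi * \<i> * of_int k / of_nat N) = of_int (2 * n) * pi"
        unfolding \<omega>_def exp_eq_1 by blast
      moreover have "Im (2 * of_real pi * \<i> * of_int k / of_nat N) = 2 * pi * real_of_int k / real N"
        by simp
      ultimately have "2 * pi * real_of_int k / real N = 2 * pi * real_of_int n" by simp
      hence "2 * pi * real_of_int k = 2 * pi * (real_of_int n * real N)" using N by (simp add: divide_eq_eq)
      hence "real_of_int k = real_of_int n * real N" by simp
      hence "real_of_int k = real_of_int (int N * n)" by simp
      hence "k = int N * n" by (simp only: of_int_eq_iff)
      thus False using False by simp
    qed
    moreover have "\<omega> ^ N = 1"
    proof -
      have "of_nat N * (2 * of_real pi * \<i> * of_int k / of_nat N) = \<i> * (of_int k * (of_real pi * 2))"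
        using N by simp
      thus ?thesis unfolding \<omega>_def exp_of_nat_mult[symmetric] by (simp only: exp_2pi_1_int)
    qed
    ultimately have "(\<Sum>n<N. \<omega> ^ n) = 0" by (simp add: geometric_sum)
    thus ?thesis using eq False by simp
  qed
qed

lemma two_cosh_power:
  "(2 * cosh (s / 2)) ^ (2 * m) = (\<Sum>i\<le>2*m. of_nat ((2*m) choose i) * exp (s * (of_int (int i - int m)) :: complex))"
proof -
  have "2 * cosh (s / 2) = exp (s/2) + exp (- (s/2))"
    by (simp add: cosh_def scaleR_conv_of_real)
  hence "(2 * cosh (s / 2)) ^ (2 * m) = (\<Sum>i\<le>2*m. of_nat ((2*m) choose i) * exp (s/2) ^ i * exp (- (s/2)) ^ (2*m - i))"
    by (simp only: binomial_ring)
  also have "\<dots> = (\<Sum>i\<le>2*m. of_nat ((2*m) choose i) * exp (s * of_int (int i - int m)))"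
  proof (rule sum.cong, goal_cases)
    case (2 i)
    hence "of_nat (2 * m - i) = (2 * of_nat m - of_nat i :: complex)" by (simp add: of_nat_diff)
    hence "of_nat i * (s/2) + of_nat (2*m - i) * (- (s/2)) = s * of_int (int i - int m)"
      by (simp only:) (simp add: field_simps)
    thus ?case by (simp only: exp_of_nat_mult[symmetric] mult.assoc exp_add[symmetric])
  qed auto
  finally show ?thesis .
qed

text \<open>A finite Poisson summation. Expanding the powers gives exponents \<open>i - m\<close>,
  of which the sum over \<open>l\<close> retains the multiples \<open>N * j\<close>; the scale
  \<open>2 * of_nat N\<close> in the argument turns these into \<open>exp (w * of_int j)\<close>.
  The odd \<open>N\<close> allows residues represented symmetrically about 0, so each
  \<open>l\<close> keeps its meaning as \<open>M\<close> grows and the left side can converge to a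
  series over all integers.\<close>

lemma binomial_roots_of_unity:
  fixes M m :: nat and w :: complex
  defines "N \<equiv> 2 * M + 1"
  shows "(\<Sum>l=-int M..int M. (2 * cosh ((w + 2 * of_real pi * \<i> * of_int l) / (2 * of_nat N))) ^ (2*m)) =
     of_nat N * (\<Sum>\<^sub>\<infinity>j::int. of_nat ((2*m) choose (m + N * nat \<bar>j\<bar>)) * exp (w * of_int j))"
proof -
  define I where "I = {i\<in>{..2*m}. int N dvd int i - int m}"
  define J where "J = {j::int. N * nat \<bar>j\<bar> \<le> m}"
  have N: "N > 0" by (simp add: N_def)
  have "(\<Sum>l=-int M..int M. (2 * cosh ((w + 2 * of_real pi * \<i> * of_int l) / (2 * of_nat N))) ^ (2*m))
    = (\<Sum>l=-int M..int M. \<Sum>i\<le>2*m. of_nat ((2*m) choose i) * (exp (w / of_nat N * of_int (int i - int m)) *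
         exp (2 * of_real pi * \<i> * of_int l * of_int (int i - int m) / of_nat N)))"
  proof (rule sum.cong, goal_cases)
    case (2 l)
    have e: "(w + 2 * of_real pi * \<i> * of_int l) / (2 * of_nat N) = ((w + 2 * of_real pi * \<i> * of_int l) / of_nat N) / 2"
      by simp
    show ?case unfolding e two_cosh_power exp_add[symmetric]
      by (intro sum.cong arg_cong2[where f = "(*)"] arg_cong[where f = exp]) (auto simp: add_divide_distrib diff_divide_distrib ring_distribs)
  qed auto
  also have "\<dots> = (\<Sum>i\<le>2*m. of_nat ((2*m) choose i) * exp (w / of_nat N * of_int (int i - int m)) *
       (\<Sum>l=-int M..int M. exp (2 * of_real pi * \<i> * of_int l * of_int (int i - int m) / of_nat N)))"
    by (subst sum.swap) (simp only: sum_distrib_left mult.assoc)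
  also have "\<dots> = (\<Sum>i\<le>2*m. if int N dvd int i - int m then of_nat N * (of_nat ((2*m) choose i) * exp (w / of_nat N * of_int (int i - int m))) else 0)"
    unfolding N_def sum_cis_symmetric by (intro sum.cong) auto
  also have "\<dots> = of_nat N * (\<Sum>i\<in>I. of_nat ((2*m) choose i) * exp (w / of_nat N * of_int (int i - int m)))"
    by (simp add: I_def sum.inter_filter[symmetric] sum_distrib_left)
  finally have 1: "(\<Sum>l=-int M..int M. (2 * cosh ((w + 2 * of_real pi * \<i> * of_int l) / (2 * of_nat N))) ^ (2*m)) = \<dots>" .
  have 2: "(\<Sum>i\<in>I. of_nat ((2*m) choose i) * exp (w / of_nat N * of_int (int i - int m)))
    = (\<Sum>j\<in>J. of_nat ((2*m) choose (m + N * nat \<bar>j\<bar>)) * exp (w * of_int j))"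
  proof (rule sum.reindex_bij_witness[of _ "\<lambda>j. nat (int m + int N * j)" "\<lambda>i. (int i - int m) div int N"], goal_cases)
    case (1 i)
    then obtain j where "int i - int m = int N * j" by (auto simp: I_def)
    thus ?case using N by simp
  next
    case (2 i)
    then obtain j where j: "int i - int m = int N * j" "i \<le> 2 * m" by (auto simp: I_def)
    have "int (N * nat \<bar>j\<bar>) = \<bar>int N * j\<bar>" by (simp add: abs_mult)
    also have "\<dots> \<le> int m" using j by (simp add: j(1)[symmetric])
    finally have "N * nat \<bar>j\<bar> \<le> m" by (simp only: of_nat_le_iff)
    thus ?case using N j by (simp add: J_def)
  next
    case (3 j)
    hence "int (N * nat \<bar>j\<bar>) \<le> int m" by (simp only: J_def mem_Collect_eq of_nat_le_iff)
    hence "\<bar>int N * j\<bar> \<le> int m" by (simp add: abs_mult)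
    thus ?case using N by (simp add: abs_le_iff)
  next
    case (4 j)
    hence "int (N * nat \<bar>j\<bar>) \<le> int m" by (simp only: J_def mem_Collect_eq of_nat_le_iff)
    hence "\<bar>int N * j\<bar> \<le> int m" by (simp add: abs_mult)
    thus ?case by (auto simp: I_def abs_le_iff)
  next
    case (5 i)
    then obtain j where j: "int i - int m = int N * j" "i \<le> 2 * m" by (auto simp: I_def)
    have jN: "(int i - int m) div int N = j" using j N by simp
    have nn: "int (N * nat \<bar>j\<bar>) = \<bar>int i - int m\<bar>" by (simp add: abs_mult j)
    \<comment> \<open>For negative \<open>j\<close> the symmetry of the binomial coefficients
      reflects \<open>i\<close> to \<open>2 * m - i\<close>.\<close>
    have "(2*m) choose (m + N * nat \<bar>j\<bar>) = (2*m) choose i"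
    proof (cases "i \<ge> m")
      case True
      hence "m + N * nat \<bar>j\<bar> = i" using nn by linarith
      thus ?thesis by simp
    next
      case False
      hence "m + N * nat \<bar>j\<bar> = 2 * m - i" using nn j(2) by linarith
      thus ?thesis using binomial_symmetric[OF j(2)] by simp
    qed
    moreover have "w * of_int j = w / of_nat N * of_int (int i - int m)"
      using N unfolding j(1) by simp
    ultimately show ?case unfolding jN by simp
  qed
  have 3: "(\<Sum>j\<in>J. of_nat ((2*m) choose (m + N * nat \<bar>j\<bar>)) * exp (w * of_int j)) = (\<Sum>\<^sub>\<infinity>j\<in>J. of_nat ((2*m) choose (m + N * nat \<bar>j\<bar>)) * exp (w * of_int j))"
  proof -
    have "J \<subseteq> {-int m..int m}"
    proof
      fix j assume "j \<in> J"
      hence "N * nat \<bar>j\<bar> \<le> m" by (simp add: J_def)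
      moreover have "1 * nat \<bar>j\<bar> \<le> N * nat \<bar>j\<bar>" using N by (intro mult_le_mono1) auto
      ultimately have "nat \<bar>j\<bar> \<le> m" by linarith
      thus "j \<in> {-int m..int m}" by auto
    qed
    hence "finite J" by (rule finite_subset) auto
    thus ?thesis by (simp add: infsum_finite)
  qed
  \<comment> \<open>Binomial coefficients out of range are 0, so the finite sum is already a series
    over all integers, the form in which dominated convergence can be applied.\<close>
  have 4: "(\<Sum>\<^sub>\<infinity>j\<in>J. of_nat ((2*m) choose (m + N * nat \<bar>j\<bar>)) * exp (w * of_int j)) =
     (\<Sum>\<^sub>\<infinity>j::int. of_nat ((2*m) choose (m + N * nat \<bar>j\<bar>)) * exp (w * of_int j))"
  proof (rule infsum_cong_neutral)
    fix j assume "j \<in> UNIV - J"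
    hence "(2*m) choose (m + N * nat \<bar>j\<bar>) = 0" by (intro binomial_eq_0) (simp add: J_def)
    thus "of_nat ((2*m) choose (m + N * nat \<bar>j\<bar>)) * exp (w * of_int j) = 0" by simp
  qed (blast, rule refl)
  show ?thesis unfolding 1 2 3 4 by (rule refl)
qed

section \<open>The limit of the finite identity\<close>

lemma tendsto_floor_square_ratio:
  fixes c :: real
  assumes "c > 0"
  shows "(\<lambda>M. real (nat \<lfloor>(real (2*M+1))\<^sup>2 / c\<rfloor>) / (real (2*M+1))\<^sup>2) \<longlonglongrightarrow> 1 / c"
proof (rule tendsto_sandwich)
  let ?f = "\<lambda>M. real (nat \<lfloor>(real (2*M+1))\<^sup>2 / c\<rfloor>) / (real (2*M+1))\<^sup>2"
  have N: "filterlim (\<lambda>M. real (2*M+1)) at_top sequentially"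
    by (rule filterlim_at_top_mono[OF filterlim_real_sequentially]) auto
  have "(\<lambda>M. 1 / c - (inverse (real (2*M+1)))\<^sup>2) \<longlonglongrightarrow> 1 / c - 0\<^sup>2"
    by (intro tendsto_intros tendsto_inverse_0_at_top N)
  thus "(\<lambda>M. 1 / c - (inverse (real (2*M+1)))\<^sup>2) \<longlonglongrightarrow> 1 / c" by simp
  show "(\<lambda>M. 1 / c) \<longlonglongrightarrow> 1 / c" by simp
  have *: "real (nat \<lfloor>(real (2*M+1))\<^sup>2 / c\<rfloor>) = of_int \<lfloor>(real (2*M+1))\<^sup>2 / c\<rfloor>" for M
    using assms by simp
  have N0: "(real (2*M+1))\<^sup>2 > 0" for M by (simp add: add_nonneg_eq_0_iff)
  show "\<forall>\<^sub>F M in sequentially. 1 / c - (inverse (real (2*M+1)))\<^sup>2 \<le> ?f M"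
  proof (rule always_eventually, rule allI)
    fix M
    have "1 / c - (inverse (real (2*M+1)))\<^sup>2 = ((real (2*M+1))\<^sup>2 / c - 1) / (real (2*M+1))\<^sup>2"
      using N0[of M] assms by (simp add: diff_divide_distrib power_inverse[symmetric] inverse_eq_divide power_one_over del: of_nat_add of_nat_mult)
    also have "\<dots> \<le> ?f M"
      unfolding * by (intro divide_right_mono) (linarith, simp)
    finally show "1 / c - (inverse (real (2*M+1)))\<^sup>2 \<le> ?f M" .
  qed
  show "\<forall>\<^sub>F M in sequentially. ?f M \<le> 1 / c"
  proof (rule always_eventually, rule allI)
    fix M
    have "?f M \<le> ((real (2*M+1))\<^sup>2 / c) / (real (2*M+1))\<^sup>2"
      unfolding * by (intro divide_right_mono) (linarith, simp)
    also have "\<dots> = 1 / c" using N0[of M] by (simp del: of_nat_add of_nat_mult)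
    finally show "?f M \<le> 1 / c" .
  qed
qed

lemma tendsto_central_binomial_ratio:
  fixes c :: real and N m :: "nat \<Rightarrow> nat" and j :: nat
  assumes c: "c > 0" and N: "filterlim (\<lambda>n. real (N n)) at_top sequentially"
    and m: "(\<lambda>n. real (m n) / (real (N n))\<^sup>2) \<longlonglongrightarrow> 1 / c"
  shows "(\<lambda>n. real ((2 * m n) choose (m n + N n * j)) / real ((2 * m n) choose m n)) \<longlonglongrightarrow> exp (- c * (real j)\<^sup>2)"
proof -
  \<comment> \<open>\<open>?q (- real j) 1\<close> and \<open>?q (real j) 0\<close> are
    \<open>m - N * j + 1\<close> and \<open>m + N * j\<close> divided by \<open>N^2\<close>. These
    are the denominators of the two binomial bounds at \<open>k = K = N * j\<close>, and both tend
    to \<open>1 / c\<close>.\<close>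
  let ?q = "\<lambda>a b n. real (m n) / (real (N n))\<^sup>2 + a * inverse (real (N n)) + b * (inverse (real (N n)))\<^sup>2"
  let ?B = "\<lambda>n. real ((2 * m n) choose (m n + N n * j)) / real ((2 * m n) choose m n)"
  have N0: "\<forall>\<^sub>F n in sequentially. real (N n) > 0"
    using N unfolding filterlim_at_top_dense by blast
  have iN: "(\<lambda>n. inverse (real (N n))) \<longlonglongrightarrow> 0"
    by (intro tendsto_inverse_0_at_top N)
  have lim: "(\<lambda>n. ?q a b n) \<longlonglongrightarrow> 1 / c" for a b
  proof -
    have "(\<lambda>n. ?q a b n) \<longlonglongrightarrow> 1 / c + a * 0 + b * 0\<^sup>2"
      by (intro tendsto_intros m iN)
    thus ?thesis by simp
  qed
  have lim': "(\<lambda>n. exp (- (real j)\<^sup>2 / (?q a b n)))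
     \<longlonglongrightarrow> exp (- c * (real j)\<^sup>2)" for a b
  proof -
    have "(\<lambda>n. exp (- (real j)\<^sup>2 / (?q a b n)))
     \<longlonglongrightarrow> exp (- (real j)\<^sup>2 / (1 / c))"
      using c by (intro tendsto_intros lim) auto
    thus ?thesis by (simp add: mult.commute)
  qed
  have le: "\<forall>\<^sub>F n in sequentially. N n * j \<le> m n"
  proof -
    have "\<forall>\<^sub>F n in sequentially. ?q (- real j) 0 n > 0"
      by (rule order_tendstoD(1)[OF lim]) (use c in simp)
    thus ?thesis using N0
    proof eventually_elim
      case (elim n)
      have "real j * inverse (real (N n)) < real (m n) / (real (N n))\<^sup>2" using elim by simp
      hence "real j * inverse (real (N n)) * (real (N n))\<^sup>2 < real (m n) / (real (N n))\<^sup>2 * (real (N n))\<^sup>2"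
        using elim by (intro mult_strict_right_mono) auto
      moreover have "real j * inverse (real (N n)) * (real (N n))\<^sup>2 = real (N n * j)"
        using elim by (simp add: power2_eq_square field_simps)
      ultimately have "real (N n * j) < real (m n)" using elim by simp
      thus ?case by linarith
    qed
  qed
  show ?thesis
  proof (rule tendsto_sandwich[OF _ _ lim'[of "- real j" 1] lim'[of "real j" 0]])
    show "\<forall>\<^sub>F n in sequentially. exp (- (real j)\<^sup>2 / (?q (- real j) 1 n))
        \<le> ?B n"
      using le N0
    proof eventually_elim
      case (elim n)
      have pos: "real ((2 * m n) choose m n) > 0" by simp
      have "(real (m n - N n * j + 1)) / (real (N n))\<^sup>2 = ?q (- real j) 1 n"
        using elim by (simp add: field_simps power2_eq_square of_nat_diff)
      moreover have "(real (N n * j))\<^sup>2 / real (m n - N n * j + 1) = (real j)\<^sup>2 / (real (m n - N n * j + 1) / (real (N n))\<^sup>2)"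
        using elim by (simp add: power_mult_distrib)
      ultimately have e: "- (real (N n * j))\<^sup>2 / real (m n - N n * j + 1) = - (real j)\<^sup>2 / (?q (- real j) 1 n)"
        by simp
      show ?case
        using conjunct2[OF central_binomial_ratio_bounds[of "N n * j" "N n * j" "m n"]] elim pos
        unfolding e by (simp add: pos_le_divide_eq mult.commute)
    qed
    show "\<forall>\<^sub>F n in sequentially. ?B n
       \<le> exp (- (real j)\<^sup>2 / (?q (real j) 0 n))"
      using le N0
    proof eventually_elim
      case (elim n)
      have pos: "real ((2 * m n) choose m n) > 0" by simp
      have "(real (m n + N n * j)) / (real (N n))\<^sup>2 = ?q (real j) 0 n"
        using elim by (simp add: field_simps power2_eq_square)
      moreover have "(real (N n * j))\<^sup>2 / real (m n + N n * j) = (real j)\<^sup>2 / (real (m n + N n * j) / (real (N n))\<^sup>2)"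
        using elim by (simp add: power_mult_distrib)
      ultimately have e: "- (real (N n * j))\<^sup>2 / real (m n + N n * j) = - (real j)\<^sup>2 / (?q (real j) 0 n)"
        by simp
      show ?case
        using conjunct1[OF central_binomial_ratio_bounds[of "N n * j" "N n * j" "m n"]] elim pos
        unfolding e by (simp add: pos_divide_le_eq mult.commute)
    qed
  qed
qed

text \<open>The majorant on the theta side. Halving the exponent is the price for replacing
  \<open>m + N * j\<close> by \<open>2 * m\<close>; once \<open>N * j\<close> exceeds
  \<open>m\<close> the coefficient is 0.\<close>

lemma central_binomial_ratio_le_gauss:
  fixes c :: real
  assumes c: "c > 0" and m: "real m \<le> (real N)\<^sup>2 / c" and N: "N > 0"
  shows "real ((2 * m) choose (m + N * j)) / real ((2 * m) choose m) \<le> exp (- (c / 2) * (real j)\<^sup>2)"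
proof (cases "N * j \<le> m \<and> m > 0")
  case True
  have "real ((2 * m) choose (m + N * j)) / real ((2 * m) choose m) \<le> exp (- (real (N * j))\<^sup>2 / real (m + N * j))"
    using conjunct1[OF central_binomial_ratio_bounds[of "N * j" "N * j" "m"]] True
    by (simp add: pos_divide_le_eq mult.commute)
  also have "\<dots> \<le> exp (- (c / 2) * (real j)\<^sup>2)"
  proof -
    have "c / 2 * (real j)\<^sup>2 * real (m + N * j) \<le> c / 2 * (real j)\<^sup>2 * (2 * real m)"
      using True c by (intro mult_left_mono) (auto simp del: of_nat_add of_nat_mult simp: of_nat_mult[symmetric])
    also have "\<dots> = (real j)\<^sup>2 * (c * real m)" by simp
    also have "\<dots> \<le> (real j)\<^sup>2 * (real N)\<^sup>2"
      using m c by (intro mult_left_mono) (auto simp: field_simps)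
    finally have "c / 2 * (real j)\<^sup>2 \<le> (real (N * j))\<^sup>2 / real (m + N * j)"
      using True by (simp add: pos_le_divide_eq power_mult_distrib mult_ac del: of_nat_add)
    thus ?thesis by simp
  qed
  finally show ?thesis .
next
  case False
  show ?thesis
  proof (cases "N * j \<le> m")
    case True
    hence "m = 0" "N * j = 0" using False by auto
    thus ?thesis using N by simp
  qed (simp add: binomial_eq_0)
qed

text \<open>The majorant on the dual side. For \<open>\<bar>l\<bar> \<le> int M\<close> and
  \<open>N \<ge> 5 * norm w\<close> the imaginary part of the argument is at most
  \<open>pi/2 + 1/10\<close> in modulus. This may pass the first zero of the cosine but stays below
  2, where \<open>\<bar>sin b\<bar> \<ge> \<bar>b\<bar> / 3\<close> still holds. The constant 72 is
  2 from the lower bound on \<open>m\<close>, times 4 from the halved argument, times 9 from the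
  squared third.\<close>

lemma norm_cosh_power_le:
  fixes w :: complex and c :: real and l :: int
  assumes c: "c > 0" and l: "\<bar>l\<bar> \<le> int M" and N: "N = 2 * M + 1"
    and m1: "real m \<le> (real N)\<^sup>2 / c" and m2: "real m \<ge> (real N)\<^sup>2 / (2 * c)"
    and big: "real N \<ge> 5 * norm w"
  shows "norm (cosh ((w + 2 * of_real pi * \<i> * of_int l) / 2 / of_nat N) ^ (2 * m))
           \<le> exp ((Re w)\<^sup>2 / c - (Im w + 2 * pi * of_int l)\<^sup>2 / (72 * c))"
proof -
  define y where "y = (w + 2 * of_real pi * \<i> * of_int l) / 2 / of_nat N"
  have N0: "real N > 0" using N by simp
  have Rey: "Re y = Re w / (2 * real N)" and Imy: "Im y = (Im w + 2 * pi * of_int l) / (2 * real N)"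
    by (simp_all add: y_def Re_divide_of_nat Im_divide_of_nat)
  have a: "\<bar>Re y\<bar> \<le> 1"
  proof -
    have "\<bar>Re w\<bar> \<le> norm w" by (rule abs_Re_le_cmod)
    also have "\<dots> \<le> 2 * real N" using big norm_ge_zero[of w] by linarith
    finally show ?thesis unfolding Rey using N0 by (simp add: abs_divide)
  qed
  have b: "\<bar>Im y\<bar> \<le> 2"
  proof -
    have "\<bar>Im w + 2 * pi * of_int l\<bar> \<le> \<bar>Im w\<bar> + 2 * pi * \<bar>of_int l\<bar>"
      by (rule order_trans[OF abs_triangle_ineq]) (simp add: abs_mult)
    also have "\<dots> \<le> real N / 5 + 2 * pi * (real N / 2)"
    proof (intro add_mono mult_left_mono)
      show "\<bar>Im w\<bar> \<le> real N / 5" using abs_Im_le_cmod[of w] big by linarith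
      show "\<bar>of_int l\<bar> \<le> real N / 2" using l N by linarith
    qed auto
    also have "\<dots> = (1/5 + pi) * real N" by (simp add: algebra_simps)
    also have "\<dots> \<le> 4 * real N"
      using pi_approx by (intro mult_right_mono) auto
    finally show ?thesis unfolding Imy using N0 by (simp add: abs_divide divide_le_eq)
  qed
  have sh: "(sinh (Re y))\<^sup>2 \<le> 4 * (Re y)\<^sup>2"
  proof -
    have *: "\<bar>sinh x\<bar> \<le> 2 * \<bar>x\<bar>" if "\<bar>x\<bar> \<le> 1" for x :: real
    proof -
      have pos: "sinh z \<le> 2 * z" if "0 \<le> z" "z \<le> 1" for z :: real
      proof -
        have "exp z \<le> 1 + z + z\<^sup>2" using that by (intro exp_bound) auto
        moreover have "exp (- z) \<ge> 1 + (- z)" by (rule exp_ge_add_one_self)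
        moreover have "z\<^sup>2 \<le> z" using that by (simp add: power2_eq_square mult_left_le)
        ultimately show ?thesis by (simp add: sinh_def) (use that in linarith)
      qed
      show ?thesis
        using pos[of "\<bar>x\<bar>"] that by (cases "x \<ge> 0") (auto simp: abs_if)
    qed
    have "\<bar>sinh (Re y)\<bar>\<^sup>2 \<le> (2 * \<bar>Re y\<bar>)\<^sup>2" using *[OF a] by (intro power_mono) auto
    thus ?thesis by (simp add: power_mult_distrib)
  qed
  have sn: "(sin (Im y))\<^sup>2 \<ge> (Im y)\<^sup>2 / 9"
  proof -
    have "(\<bar>Im y\<bar> / 3)\<^sup>2 \<le> \<bar>sin (Im y)\<bar>\<^sup>2" using abs_sin_ge[OF b] by (intro power_mono) auto
    thus ?thesis by (simp add: power_divide)
  qed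
  have "norm (cosh y ^ (2 * m)) = ((norm (cosh y))\<^sup>2) ^ m"
    by (simp add: norm_power power_mult)
  also have "\<dots> \<le> exp (4 * (Re y)\<^sup>2 - (Im y)\<^sup>2 / 9) ^ m"
  proof (intro power_mono)
    have "(norm (cosh y))\<^sup>2 \<le> 1 + (4 * (Re y)\<^sup>2 - (Im y)\<^sup>2 / 9)"
      unfolding norm_cosh_sq using sh sn by linarith
    also have "\<dots> \<le> exp (4 * (Re y)\<^sup>2 - (Im y)\<^sup>2 / 9)" by (rule exp_ge_add_one_self)
    finally show "(norm (cosh y))\<^sup>2 \<le> exp (4 * (Re y)\<^sup>2 - (Im y)\<^sup>2 / 9)" .
  qed auto
  also have "\<dots> = exp (real m * (4 * (Re y)\<^sup>2) - real m * ((Im y)\<^sup>2 / 9))"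
    by (simp add: exp_of_nat_mult[symmetric] right_diff_distrib)
  also have "\<dots> \<le> exp ((Re w)\<^sup>2 / c - (Im w + 2 * pi * of_int l)\<^sup>2 / (72 * c))"
  proof -
    have "real m * (4 * (Re y)\<^sup>2) \<le> (real N)\<^sup>2 / c * (4 * (Re y)\<^sup>2)"
      using m1 by (intro mult_right_mono) auto
    also have "\<dots> = (Re w)\<^sup>2 / c" using N0 by (simp add: Rey power_divide power_mult_distrib)
    finally have 1: "real m * (4 * (Re y)\<^sup>2) \<le> (Re w)\<^sup>2 / c" .
    have "(Im w + 2 * pi * of_int l)\<^sup>2 / (72 * c) = (real N)\<^sup>2 / (2 * c) * ((Im y)\<^sup>2 / 9)"
      using N0 by (simp add: Imy power_divide power_mult_distrib)
    also have "\<dots> \<le> real m * ((Im y)\<^sup>2 / 9)"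
      using m2 by (intro mult_right_mono) auto
    finally show ?thesis using 1 by simp
  qed
  finally show ?thesis unfolding y_def .
qed

definition gauss_sum :: "complex \<Rightarrow> real \<Rightarrow> complex" where
  "gauss_sum w c = (\<Sum>\<^sub>\<infinity>n::int. exp (w * of_int n - of_real c * (of_int n)\<^sup>2))"

text \<open>The Poisson dual of \<open>gauss_sum w c\<close> without its prefactor, whose classical
  value is \<open>sqrt (pi / c)\<close>.\<close>

definition dual_gauss_sum :: "complex \<Rightarrow> real \<Rightarrow> complex" where
  "dual_gauss_sum w c = (\<Sum>\<^sub>\<infinity>j::int. exp ((w + 2 * of_real pi * \<i> * of_int j)\<^sup>2 / (4 * of_real c)))"

lemma summable_on_shifted_gauss:
  fixes c \<alpha> :: real
  assumes "c > 0"
  shows "(\<lambda>l::int. exp (- c * (\<alpha> + 2 * pi * of_int l)\<^sup>2)) summable_on UNIV"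
proof -
  have "(\<lambda>l::int. exp (- c * \<alpha>\<^sup>2) * exp ((4 * pi * c * \<bar>\<alpha>\<bar>) * \<bar>of_int l\<bar> - (4 * pi\<^sup>2 * c) * (of_int l)\<^sup>2)) summable_on UNIV"
    by (intro summable_on_cmult_right summable_on_exp_gauss_int) (use assms in simp)
  thus ?thesis
  proof (rule summable_on_comparison_test)
    fix l :: int
    have "- c * (\<alpha> + 2 * pi * of_int l)\<^sup>2 = - c * \<alpha>\<^sup>2 + (4 * pi * c * (- \<alpha> * of_int l)  - (4 * pi\<^sup>2 * c) * (of_int l)\<^sup>2)"
      by (simp add: power2_eq_square algebra_simps)
    moreover have "4 * pi * c * (- \<alpha> * of_int l) \<le> 4 * pi * c * \<bar>\<alpha> * of_int l\<bar>"
      using assms by (intro mult_left_mono) (linarith, simp)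
    ultimately show "exp (- c * (\<alpha> + 2 * pi * of_int l)\<^sup>2) \<le> exp (- c * \<alpha>\<^sup>2) * exp ((4 * pi * c * \<bar>\<alpha>\<bar>) * \<bar>of_int l\<bar> - (4 * pi\<^sup>2 * c) * (of_int l)\<^sup>2)"
      unfolding exp_add[symmetric] by (simp add: abs_mult mult.assoc)
  qed auto
qed

text \<open>The finite identity carries the normalising constant \<open>N\<close> times the central
  binomial coefficient over \<open>4 ^ m\<close>, which does not depend on \<open>w\<close>.
  Cross-multiplying with the case \<open>w = 0\<close> removes it before the limit is taken, so its
  asymptotics never enter.\<close>

lemma poisson_gauss_proportional:
  fixes c :: real and w :: complex
  assumes c: "c > 0"
  shows "gauss_sum w c * dual_gauss_sum 0 c = gauss_sum 0 c * dual_gauss_sum w c"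
proof -
  define N where "N = (\<lambda>M::nat. 2 * M + 1)"
  \<comment> \<open>This size of \<open>m\<close> balances both sides: \<open>(N * j)^2 / m\<close>
    tends to \<open>c * j^2\<close> in the binomial coefficient, and
    \<open>2 * m * Ln (cosh (y / N))\<close> tends to \<open>y^2 / c\<close> in the power of
    cosh.\<close>
  define m where "m = (\<lambda>M. nat \<lfloor>(real (N M))\<^sup>2 / c\<rfloor>)"
  let ?B = "\<lambda>j M. of_real (real ((2 * m M) choose (m M + N M * nat \<bar>j\<bar>)) / real ((2 * m M) choose m M)) :: complex"
  let ?C = "\<lambda>w l M. cosh ((w + 2 * of_real pi * \<i> * of_int l) / 2 / of_nat (N M)) ^ (2 * m M)"
  define F where "F = (\<lambda>w M. \<Sum>\<^sub>\<infinity>j::int. ?B j M * exp (w * of_int j) :: complex)"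
  \<comment> \<open>The cutoff at \<open>M\<close> is built into the terms, so that a sum of growing
    length becomes a series over all integers with termwise limits.\<close>
  define G where "G = (\<lambda>w M. \<Sum>\<^sub>\<infinity>l::int. if \<bar>l\<bar> \<le> int M then ?C w l M else (0 :: complex))"
  have N: "filterlim (\<lambda>M. real (N M)) at_top sequentially"
    by (rule filterlim_at_top_mono[OF filterlim_real_sequentially]) (auto simp: N_def)
  have mlim: "(\<lambda>M. real (m M) / (real (N M))\<^sup>2) \<longlonglongrightarrow> 1 / c"
    unfolding m_def N_def by (rule tendsto_floor_square_ratio[OF c])
  have N0: "N M > 0" for M by (simp add: N_def)
  have m1: "real (m M) \<le> (real (N M))\<^sup>2 / c" for M
    unfolding m_def using c by simp
  have m2: "\<forall>\<^sub>F M in sequentially. real (m M) \<ge> (real (N M))\<^sup>2 / (2 * c)"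
  proof -
    have "\<forall>\<^sub>F M in sequentially. real (m M) / (real (N M))\<^sup>2 > 1 / (2 * c)"
      by (rule order_tendstoD(1)[OF mlim]) (use c in \<open>simp add: field_simps\<close>)
    thus ?thesis
    proof eventually_elim
      case (elim M)
      have "(real (N M))\<^sup>2 > 0" using N0[of M] by simp
      thus ?case using elim by (simp add: pos_less_divide_eq del: of_nat_0_less_iff)
    qed
  qed
  have Flim: "F w \<longlonglongrightarrow> gauss_sum w c" for w
    unfolding F_def gauss_sum_def
  proof (rule tannery_int)
    fix j :: int
    have "(\<lambda>M. ?B j M * exp (w * of_int j))
       \<longlonglongrightarrow> of_real (exp (- c * (real (nat \<bar>j\<bar>))\<^sup>2)) * exp (w * of_int j)"
      by (intro tendsto_mult tendsto_of_real tendsto_central_binomial_ratio c N mlim tendsto_const)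
    also have "of_real (exp (- c * (real (nat \<bar>j\<bar>))\<^sup>2)) * exp (w * of_int j) = exp (w * of_int j - of_real c * (of_int j)\<^sup>2)"
      by (simp add: exp_diff exp_minus field_simps flip: exp_of_real)
    finally show "(\<lambda>M. ?B j M * exp (w * of_int j))
       \<longlonglongrightarrow> exp (w * of_int j - of_real c * (of_int j)\<^sup>2)" .
  next
    show "(\<lambda>j::int. exp (\<bar>Re w\<bar> * \<bar>of_int j\<bar> - (c/2) * (of_int j)\<^sup>2)) summable_on UNIV"
      by (rule summable_on_exp_gauss_int) (use c in simp)
    show "\<forall>\<^sub>F M in sequentially. \<forall>j::int. norm (?B j M * exp (w * of_int j))
      \<le> exp (\<bar>Re w\<bar> * \<bar>of_int j\<bar> - (c/2) * (of_int j)\<^sup>2)"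
    proof (intro always_eventually allI)
      fix M and j :: int
      have "norm (?B j M * exp (w * of_int j))
        = real ((2 * m M) choose (m M + N M * nat \<bar>j\<bar>)) / real ((2 * m M) choose m M) * exp (Re w * of_int j)"
        by (simp add: norm_mult norm_divide)
      also have "\<dots> \<le> exp (- (c/2) * (real (nat \<bar>j\<bar>))\<^sup>2) * exp (\<bar>Re w\<bar> * \<bar>of_int j\<bar>)"
        by (intro mult_mono central_binomial_ratio_le_gauss c m1 N0)
           (auto simp: abs_mult[symmetric])
      also have "\<dots> = exp (\<bar>Re w\<bar> * \<bar>of_int j\<bar> - (c/2) * (of_int j)\<^sup>2)"
        unfolding exp_add[symmetric] by (simp add: algebra_simps)
      finally show "norm (?B j M * exp (w * of_int j))
         \<le> exp (\<bar>Re w\<bar> * \<bar>of_int j\<bar> - (c/2) * (of_int j)\<^sup>2)" .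
    qed
  qed simp
  have Glim: "G w \<longlonglongrightarrow> dual_gauss_sum w c" for w
    unfolding G_def dual_gauss_sum_def
  proof (rule tannery_int)
    fix l :: int
    have "(\<lambda>M. cosh ((w + 2 * of_real pi * \<i> * of_int l) / 2 / of_real (real (N M))) ^ (2 * m M)) \<longlonglongrightarrow> exp (of_real (1 / c) * ((w + 2 * of_real pi * \<i> * of_int l) / 2)\<^sup>2)"
      by (rule tendsto_cosh_power[OF N mlim])
    also have "of_real (1 / c) * ((w + 2 * of_real pi * \<i> * of_int l) / 2)\<^sup>2 = (w + 2 * of_real pi * \<i> * of_int l)\<^sup>2 / (4 * of_real c)"
      by (simp add: power_divide)
    finally have L: "(\<lambda>M. ?C w l M) \<longlonglongrightarrow> exp ((w + 2 * of_real pi * \<i> * of_int l)\<^sup>2 / (4 * of_real c))"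
      by simp
    have E: "\<forall>\<^sub>F M in sequentially. ?C w l M
        = (if \<bar>l\<bar> \<le> int M then ?C w l M else 0)"
      using eventually_ge_at_top[of "nat \<bar>l\<bar>"] by eventually_elim simp
    show "(\<lambda>M. if \<bar>l\<bar> \<le> int M then ?C w l M else 0)
       \<longlonglongrightarrow> exp ((w + 2 * of_real pi * \<i> * of_int l)\<^sup>2 / (4 * of_real c))"
      by (rule Lim_transform_eventually[OF L E])
  next
    have "(\<lambda>l::int. exp ((Re w)\<^sup>2 / c) * exp (- (1 / (72 * c)) * (Im w + 2 * pi * of_int l)\<^sup>2)) summable_on UNIV"
      by (intro summable_on_cmult_right summable_on_shifted_gauss) (use c in simp)
    thus "(\<lambda>l::int. exp ((Re w)\<^sup>2 / c - (Im w + 2 * pi * of_int l)\<^sup>2 / (72 * c))) summable_on UNIV"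
      by (simp add: exp_add[symmetric])
    have "\<forall>\<^sub>F M in sequentially. real (N M) \<ge> 5 * norm w"
      using N unfolding filterlim_at_top by blast
    with m2 show "\<forall>\<^sub>F M in sequentially. \<forall>l::int. norm (if \<bar>l\<bar> \<le> int M then ?C w l M else 0)
       \<le> exp ((Re w)\<^sup>2 / c - (Im w + 2 * pi * of_int l)\<^sup>2 / (72 * c))"
    proof eventually_elim
      case (elim M)
      show ?case
      proof
        fix l :: int
        show "norm (if \<bar>l\<bar> \<le> int M then ?C w l M else 0)
          \<le> exp ((Re w)\<^sup>2 / c - (Im w + 2 * pi * of_int l)\<^sup>2 / (72 * c))"
        proof (cases "\<bar>l\<bar> \<le> int M")
          case True
          have "N M = 2 * M + 1" by (simp add: N_def)
          from norm_cosh_power_le[OF c True this m1 elim] True show ?thesis by (simp only: if_True)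
        qed simp
      qed
    qed
  qed simp
  have id: "4 ^ m M * G w M = of_nat (N M) * of_nat ((2 * m M) choose m M) * F w M" for w M
  proof -
    have "G w M = (\<Sum>\<^sub>\<infinity>l\<in>{-int M..int M}. ?C w l M)"
      unfolding G_def by (rule infsum_cong_neutral) (auto simp: abs_le_iff)
    also have "\<dots> = (\<Sum>l=-int M..int M. ?C w l M)"
      by simp
    finally have "4 ^ m M * G w M = (\<Sum>l=-int M..int M. (2 * cosh ((w + 2 * of_real pi * \<i> * of_int l) / (2 * of_nat (N M)))) ^ (2 * m M))"
      by (simp add: sum_distrib_left power_mult_distrib power_mult)
    also have "\<dots> = of_nat (N M) * (\<Sum>\<^sub>\<infinity>j::int. of_nat ((2 * m M) choose (m M + N M * nat \<bar>j\<bar>)) * exp (w * of_int j))"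
      unfolding N_def by (rule binomial_roots_of_unity)
    also have "(\<Sum>\<^sub>\<infinity>j::int. of_nat ((2 * m M) choose (m M + N M * nat \<bar>j\<bar>)) * exp (w * of_int j))
       = (\<Sum>\<^sub>\<infinity>j::int. of_nat ((2 * m M) choose m M) * (?B j M * exp (w * of_int j)))"
      by (rule infsum_cong) simp
    also have "\<dots> = of_nat ((2 * m M) choose m M) * F w M"
      unfolding F_def by (rule infsum_cmult_right')
    finally show ?thesis by (simp add: mult.assoc)
  qed
  have "F w M * G 0 M = F 0 M * G w M" for M
  proof -
    define K where "K = of_nat (N M) * of_nat ((2 * m M) choose m M) / (4 ^ m M :: complex)"
    have G: "G w M = K * F w M" for w
      using id[of M w] by (simp add: K_def field_simps)
    show ?thesis unfolding G by simp
  qed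
  hence "(\<lambda>M. F 0 M * G w M) \<longlonglongrightarrow> gauss_sum w c * dual_gauss_sum 0 c"
    using tendsto_mult[OF Flim[of w] Glim[of 0]] by simp
  moreover have "(\<lambda>M. F 0 M * G w M) \<longlonglongrightarrow> gauss_sum 0 c * dual_gauss_sum w c"
    by (rule tendsto_mult[OF Flim Glim])
  ultimately show ?thesis by (rule LIMSEQ_unique)
qed

section \<open>Half-line Gaussian sums\<close>

lemma has_real_derivative_gauss:
  "((\<lambda>x::real. exp (- c * x\<^sup>2)) has_real_derivative - 2 * c * x * exp (- c * x\<^sup>2)) (at x within S)"
  by (auto intro!: derivative_eq_intros)

lemma has_real_derivative_gauss':
  "((\<lambda>x::real. - 2 * c * x * exp (- c * x\<^sup>2)) has_real_derivative (4 * c\<^sup>2 * x\<^sup>2 - 2 * c) * exp (- c * x\<^sup>2)) (at x within S)"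
  by (auto intro!: derivative_eq_intros simp: power2_eq_square algebra_simps)

lemma real_MVT:
  fixes f f' :: "real \<Rightarrow> real"
  assumes "\<And>x. (f has_real_derivative f' x) (at x)"
  shows "\<exists>\<xi>. min x y \<le> \<xi> \<and> \<xi> \<le> max x y \<and> f x - f y = (x - y) * f' \<xi>"
proof (cases x y rule: linorder_cases)
  case less
  then obtain z where "z > x" "z < y" "f y - f x = (y - x) * f' z"
    using MVT2[of x y f f'] assms by blast
  thus ?thesis by (intro exI[of _ z]) (auto simp: algebra_simps)
next
  case greater
  then obtain z where "z > y" "z < x" "f x - f y = (x - y) * f' z"
    using MVT2[of y x f f'] assms by blast
  thus ?thesis by (intro exI[of _ z]) auto
qed auto

text \<open>The bound is uniform in \<open>c\<close>: it only uses that \<open>y e\<^sup>-\<^sup>y\<close> and \<open>y\<^sup>2 e\<^sup>-\<^sup>y\<close> are bounded.\<close>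

lemma gauss_second_derivative_bound:
  fixes c x :: real
  assumes "c \<ge> 0" "x > 0"
  shows "\<bar>(4 * c\<^sup>2 * x\<^sup>2 - 2 * c) * exp (- c * x\<^sup>2)\<bar> \<le> 10 / x\<^sup>2"
proof -
  define y where "y = c * x\<^sup>2"
  have y: "y \<ge> 0" using assms by (simp add: y_def)
  have e: "exp y \<ge> 1 + y + y\<^sup>2 / 2" by (rule exp_lower_Taylor_quadratic[OF y])
  have "y \<le> exp y" "y\<^sup>2 \<le> 2 * exp y" using e y zero_le_power2[of y] by linarith+
  hence y1: "y * exp (- y) \<le> 1" and y2: "y\<^sup>2 * exp (- y) \<le> 2"
    by (simp_all add: exp_minus field_simps)
  have "(4 * c\<^sup>2 * x\<^sup>2 - 2 * c) * exp (- c * x\<^sup>2) * x\<^sup>2 = (4 * y\<^sup>2 - 2 * y) * exp (- y)"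
    by (simp add: y_def power2_eq_square algebra_simps)
  hence "\<bar>(4 * c\<^sup>2 * x\<^sup>2 - 2 * c) * exp (- c * x\<^sup>2)\<bar> * \<bar>x\<^sup>2\<bar> = \<bar>4 * y\<^sup>2 - 2 * y\<bar> * \<bar>exp (- y)\<bar>"
    by (simp only: abs_mult[symmetric])
  hence "\<bar>(4 * c\<^sup>2 * x\<^sup>2 - 2 * c) * exp (- c * x\<^sup>2)\<bar> * x\<^sup>2 = \<bar>4 * y\<^sup>2 - 2 * y\<bar> * exp (- y)"
    by (simp only: abs_power2 abs_exp_cancel)
  also have "\<dots> \<le> (4 * y\<^sup>2 + 2 * y) * exp (- y)"
    using y zero_le_power2[of y] by (intro mult_right_mono) (linarith, simp)
  also have "\<dots> \<le> 10" using y1 y2 by (simp add: algebra_simps)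
  finally show ?thesis using assms by (simp add: pos_le_divide_eq)
qed

text \<open>The quantity is a difference of two chord slopes, cleared of denominators so that
  coinciding points do no harm. Each slope is a derivative at an intermediate point. The mean value
  theorem for the derivative turns the gap between these points, at most \<open>R\<close>, into a
  factor of the second derivative.\<close>

lemma gauss_second_difference_bound:
  fixes c X :: real
  assumes c: "c \<ge> 0" and X: "X > 0" and x: "x \<ge> X" "y \<ge> X" "x' \<ge> X" "y' \<ge> X"
    and r: "x \<le> X + R" "y \<le> X + R" "x' \<le> X + R" "y' \<le> X + R"
  shows "\<bar>(exp (- c * x\<^sup>2) - exp (- c * y\<^sup>2)) * (x' - y') - (exp (- c * x'\<^sup>2) - exp (- c * y'\<^sup>2)) * (x - y)\<bar>
          \<le> \<bar>x - y\<bar> * \<bar>x' - y'\<bar> * (R * (10 / X\<^sup>2))"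
proof -
  let ?f' = "\<lambda>x::real. - 2 * c * x * exp (- c * x\<^sup>2)"
  obtain \<xi> where \<xi>: "min x y \<le> \<xi>" "\<xi> \<le> max x y" "exp (- c * x\<^sup>2) - exp (- c * y\<^sup>2) = (x - y) * ?f' \<xi>"
    using real_MVT[OF has_real_derivative_gauss, of x y c] by blast
  obtain \<eta> where \<eta>: "min x' y' \<le> \<eta>" "\<eta> \<le> max x' y'" "exp (- c * x'\<^sup>2) - exp (- c * y'\<^sup>2) = (x' - y') * ?f' \<eta>"
    using real_MVT[OF has_real_derivative_gauss, of x' y' c] by blast
  obtain \<zeta> where \<zeta>: "min \<xi> \<eta> \<le> \<zeta>" "?f' \<xi> - ?f' \<eta> = (\<xi> - \<eta>) * ((4 * c\<^sup>2 * \<zeta>\<^sup>2 - 2 * c) * exp (- c * \<zeta>\<^sup>2))"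
    using real_MVT[OF has_real_derivative_gauss', of \<xi> \<eta> c] by blast
  have \<zeta>X: "\<zeta> \<ge> X" using \<zeta>(1) \<xi> \<eta> x by linarith
  have "(exp (- c * x\<^sup>2) - exp (- c * y\<^sup>2)) * (x' - y') - (exp (- c * x'\<^sup>2) - exp (- c * y'\<^sup>2)) * (x - y)
     = (x - y) * (x' - y') * (?f' \<xi> - ?f' \<eta>)"
    unfolding \<xi>(3) \<eta>(3) by (simp add: algebra_simps)
  hence "\<bar>(exp (- c * x\<^sup>2) - exp (- c * y\<^sup>2)) * (x' - y') - (exp (- c * x'\<^sup>2) - exp (- c * y'\<^sup>2)) * (x - y)\<bar>
     = \<bar>x - y\<bar> * \<bar>x' - y'\<bar> * (\<bar>\<xi> - \<eta>\<bar> * \<bar>(4 * c\<^sup>2 * \<zeta>\<^sup>2 - 2 * c) * exp (- c * \<zeta>\<^sup>2)\<bar>)"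
    unfolding \<zeta>(2) by (simp only: abs_mult mult.assoc)
  also have "\<dots> \<le> \<bar>x - y\<bar> * \<bar>x' - y'\<bar> * (R * (10 / X\<^sup>2))"
  proof (intro mult_left_mono mult_mono)
    show "\<bar>\<xi> - \<eta>\<bar> \<le> R" using \<xi> \<eta> x r by linarith
    thus "0 \<le> R" by linarith
    have "\<bar>(4 * c\<^sup>2 * \<zeta>\<^sup>2 - 2 * c) * exp (- c * \<zeta>\<^sup>2)\<bar> \<le> 10 / \<zeta>\<^sup>2"
      using \<zeta>X X by (intro gauss_second_derivative_bound c) linarith
    also have "\<dots> \<le> 10 / X\<^sup>2"
      using \<zeta>X X by (intro divide_left_mono mult_pos_pos power_mono zero_less_power) auto
    finally show "\<bar>(4 * c\<^sup>2 * \<zeta>\<^sup>2 - 2 * c) * exp (- c * \<zeta>\<^sup>2)\<bar> \<le> 10 / X\<^sup>2" .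
  qed auto
  finally show ?thesis .
qed

text \<open>The quadratic decay of second differences, uniform in \<open>c\<close>, is what lets Tannery's theorem
  apply to half-line sums whose terms themselves are not uniformly summable.\<close>

lemma tendsto_gauss_second_difference_sum:
  fixes x y x' y' :: real and w :: complex
  assumes w: "norm w \<le> 1"
  shows "((\<lambda>c. \<Sum>n. w ^ n * of_real ((exp (- c * (real n + x)\<^sup>2) - exp (- c * (real n + y)\<^sup>2)) * (x' - y')
             - (exp (- c * (real n + x')\<^sup>2) - exp (- c * (real n + y')\<^sup>2)) * (x - y))) \<longlongrightarrow> 0) (at_right 0)"
proof -
  define R where "R = \<bar>x\<bar> + \<bar>y\<bar> + \<bar>x'\<bar> + \<bar>y'\<bar>"
  \<comment> \<open>The points lie in the interval of length \<open>2 * R\<close> that starts at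
    \<open>n - R\<close>, and \<open>n - R \<ge> n / 2\<close> turns \<open>10 / (n - R)^2\<close>
    into \<open>40 / n^2\<close>.\<close>
  define K where "K = \<bar>x - y\<bar> * \<bar>x' - y'\<bar> * (2 * R * 40)"
  define D where "D = (\<lambda>n c. w ^ n * of_real ((exp (- c * (real n + x)\<^sup>2) - exp (- c * (real n + y)\<^sup>2)) * (x' - y')
             - (exp (- c * (real n + x')\<^sup>2) - exp (- c * (real n + y')\<^sup>2)) * (x - y)))"
  have lim: "((\<lambda>c. D n c) \<longlongrightarrow> 0) (at_right 0)" for n
  proof -
    have "((\<lambda>c. D n c) \<longlongrightarrow> w ^ n * of_real ((exp (- 0 * (real n + x)\<^sup>2) - exp (- 0 * (real n + y)\<^sup>2)) * (x' - y')
             - (exp (- 0 * (real n + x')\<^sup>2) - exp (- 0 * (real n + y')\<^sup>2)) * (x - y))) (at_right 0)"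
      unfolding D_def by (intro tendsto_intros)
    thus ?thesis by simp
  qed
  have K: "summable (\<lambda>n. K * inverse (real n ^ 2))"
    by (intro summable_mult inverse_power_summable) auto
  have bnd: "norm (D n c) \<le> K * inverse (real n ^ 2)" if n: "real n > 2 * R" and c: "c > 0" for n c
  proof -
    have R0: "R \<ge> 0" by (simp add: R_def)
    have X: "real n - R > 0" "real n - R \<ge> real n / 2" using n R0 by linarith+
    have "norm (D n c) \<le> 1 * \<bar>(exp (- c * (real n + x)\<^sup>2) - exp (- c * (real n + y)\<^sup>2)) * (x' - y')
             - (exp (- c * (real n + x')\<^sup>2) - exp (- c * (real n + y')\<^sup>2)) * (x - y)\<bar>"
      unfolding D_def norm_mult norm_of_real norm_power
      by (intro mult_right_mono power_le_one w) auto
    also have "\<dots> = \<bar>(exp (- c * (real n + x)\<^sup>2) - exp (- c * (real n + y)\<^sup>2)) * ((real n + x') - (real n + y'))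
             - (exp (- c * (real n + x')\<^sup>2) - exp (- c * (real n + y')\<^sup>2)) * ((real n + x) - (real n + y))\<bar>"
      by simp
    also have "\<dots> \<le> \<bar>(real n + x) - (real n + y)\<bar> * \<bar>(real n + x') - (real n + y')\<bar> * (2 * R * (10 / (real n - R)\<^sup>2))"
    proof -
      have "\<bar>x\<bar> \<le> R" "\<bar>y\<bar> \<le> R" "\<bar>x'\<bar> \<le> R" "\<bar>y'\<bar> \<le> R" by (simp_all add: R_def)
      thus ?thesis using X c by (intro gauss_second_difference_bound) linarith+
    qed
    also have "\<dots> = \<bar>x - y\<bar> * \<bar>x' - y'\<bar> * (2 * R * (10 / (real n - R)\<^sup>2))" by simp
    also have "\<dots> \<le> \<bar>x - y\<bar> * \<bar>x' - y'\<bar> * (2 * R * (10 / (real n / 2)\<^sup>2))"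
      using X R0 n by (intro mult_left_mono divide_left_mono power_mono mult_pos_pos zero_less_power) auto
    also have "\<dots> = K * inverse (real n ^ 2)"
      by (simp add: K_def power_divide inverse_eq_divide)
    finally show ?thesis .
  qed
  \<comment> \<open>Tannery's theorem asks for the majorant only eventually, which exempts the small
    \<open>n\<close> whose shifted points may reach 0.\<close>
  have "\<forall>\<^sub>F (n, c) in at_top \<times>\<^sub>F at_right 0. norm (D n c) \<le> K * inverse (real n ^ 2)"
    unfolding eventually_prod_filter
  proof (intro exI conjI allI impI)
    show "\<forall>\<^sub>F n in sequentially. real n > 2 * R"
      using filterlim_real_sequentially unfolding filterlim_at_top_dense by blast
    show "\<forall>\<^sub>F c::real in at_right 0. c > 0" by (rule eventually_at_right_less)
  qed (use bnd in auto)
  from conjunct2[OF conjunct2[OF tannerys_theorem[OF lim this K]]]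
  show ?thesis unfolding D_def by simp
qed

abbreviation gauss_exp :: "complex \<Rightarrow> real \<Rightarrow> real \<Rightarrow> complex" where
  "gauss_exp z c x \<equiv> exp (2 * of_real pi * z * of_real x - of_real c * (of_real x)\<^sup>2)"

lemma norm_exp_gauss:
  fixes z :: complex
  shows "norm (gauss_exp z c x) = exp (2 * pi * Re z * x - c * x\<^sup>2)"
  by (simp flip: of_real_power)

lemma summable_gauss_shift:
  fixes c a b :: real
  assumes "c > 0"
  shows "summable (\<lambda>n. exp (b * (real n + a) - c * (real n + a)\<^sup>2))"
proof -
  have "summable (\<lambda>n. exp (b * a - c * a\<^sup>2) * exp ((b - 2 * a * c) * real n - c * (real n)\<^sup>2))"
    by (intro summable_mult summable_exp_gauss_nat assms)
  also have "(\<lambda>n. exp (b * a - c * a\<^sup>2) * exp ((b - 2 * a * c) * real n - c * (real n)\<^sup>2))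
     = (\<lambda>n. exp (b * (real n + a) - c * (real n + a)\<^sup>2))"
    by (simp add: exp_add[symmetric] power2_eq_square algebra_simps)
  finally show ?thesis .
qed

definition half_theta :: "complex \<Rightarrow> real \<Rightarrow> real \<Rightarrow> complex" where
  "half_theta z a c = (\<Sum>n. gauss_exp z c (real n + a))"

lemma summable_norm_half_theta:
  fixes z :: complex
  assumes "c > 0"
  shows "summable (\<lambda>n. norm (gauss_exp z c (real n + a)))"
  unfolding norm_exp_gauss by (rule summable_gauss_shift[OF assms])

lemma summable_half_theta:
  fixes z :: complex
  assumes "c > 0"
  shows "summable (\<lambda>n. gauss_exp z c (real n + a))"
  by (rule summable_norm_cancel[OF summable_norm_half_theta[OF assms]])

text \<open>Two summations by parts, with the denominators \<open>1 - w\<close> cleared so that the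
  identity holds on the whole closed unit disc. The series left on the right contains second
  differences only, and these remain uniformly summable when a Gaussian \<open>f\<close> flattens
  out.\<close>

lemma suminf_by_parts:
  fixes w :: complex and f :: "nat \<Rightarrow> real"
  assumes w: "norm w \<le> 1" and f: "summable f" and nn: "\<And>n. f n \<ge> 0"
  shows "(1 - w)\<^sup>2 * (\<Sum>n. w ^ n * of_real (f n)) =
     (1 - w) * of_real (f 0) + w * of_real (f 1 - f 0) + w\<^sup>2 * (\<Sum>n. w ^ n * of_real (f (n + 2) - 2 * f (n + 1) + f n))"
proof -
  have sm: "summable (\<lambda>n. w ^ n * of_real (f (n + k)))" for k
  proof (rule summable_comparison_test)
    show "summable (\<lambda>n. f (n + k))" using f by (simp add: summable_iff_shift)
    show "\<exists>N. \<forall>n\<ge>N. norm (w ^ n * of_real (f (n + k))) \<le> f (n + k)"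
      using nn w by (auto simp: norm_mult norm_power intro!: mult_left_le_one_le power_le_one)
  qed
  define S where "S = (\<lambda>k. \<Sum>n. w ^ n * of_real (f (n + k)))"
  have rec: "S k = of_real (f k) + w * S (Suc k)" for k
  proof -
    have "S k = (\<Sum>n. w ^ Suc n * of_real (f (Suc n + k))) + of_real (f k)"
      unfolding S_def by (subst suminf_split_head[OF sm]) simp
    also have "(\<Sum>n. w ^ Suc n * of_real (f (Suc n + k))) = w * S (Suc k)"
      unfolding S_def by (subst suminf_mult[symmetric]) (use sm[of "Suc k"] in \<open>simp_all add: mult.assoc\<close>)
    finally show ?thesis by simp
  qed
  have "(\<lambda>n. w ^ n * of_real (f (n + 2)) - 2 * (w ^ n * of_real (f (n + 1))) + w ^ n * of_real (f n)) sums (S 2 - 2 * S 1 + S 0)"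
    unfolding S_def using sm[of 2] sm[of 1] sm[of 0]
    by (intro sums_add sums_diff sums_mult summable_sums) auto
  hence eq: "(\<Sum>n. w ^ n * of_real (f (n + 2) - 2 * f (n + 1) + f n)) = S 2 - 2 * S 1 + S 0"
    by (intro sums_unique[symmetric]) (simp add: algebra_simps)
  have S0: "S 0 = of_real (f 0) + w * S 1" and S1: "S 1 = of_real (f 1) + w * S 2"
    using rec[of 0] rec[of 1] by (simp_all add: numeral_2_eq_2)
  have "(1 - w)\<^sup>2 * S 0 = (1 - w) * of_real (f 0) + w * of_real (f 1 - f 0) + w\<^sup>2 * (S 2 - 2 * S 1 + S 0)"
    unfolding S0 S1 by (simp add: power2_eq_square algebra_simps)
  thus ?thesis unfolding eq by (simp add: S_def)
qed

text \<open>After two summations by parts the second differences disappear in the limit and only the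
  boundary value \<open>(1 - w) * f 0\<close> contributes, leaving \<open>1 / (1 - w)\<close>. This
  includes the imaginary axis, where the limiting series itself diverges.\<close>

lemma tendsto_half_theta:
  assumes z: "Re z \<le> 0" and ne: "exp (2 * of_real pi * z) \<noteq> 1"
  shows "((\<lambda>c. half_theta z a c) \<longlongrightarrow> exp (2 * of_real pi * z * of_real a) / (1 - exp (2 * of_real pi * z))) (at_right 0)"
proof -
  define w where "w = exp (2 * of_real pi * z)"
  have w: "norm w \<le> 1" "w \<noteq> 1" using z ne by (simp_all add: w_def mult_le_0_iff)
  define f where "f = (\<lambda>c n. exp (- c * (real n + a)\<^sup>2))"
  let ?g = "\<lambda>c. exp (2 * of_real pi * z * of_real a) * (((1 - w) * of_real (f c 0) + w * of_real (f c 1 - f c 0) + w\<^sup>2 * (\<Sum>n. w ^ n * of_real (f c (n + 2) - 2 * f c (n + 1) + f c n))) / (1 - w)\<^sup>2)"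
  have D: "((\<lambda>c. \<Sum>n. w ^ n * of_real (f c (n + 2) - 2 * f c (n + 1) + f c n)) \<longlongrightarrow> 0) (at_right 0)"
  proof -
    have e: "(exp (- c * (real n + (a + 2))\<^sup>2) - exp (- c * (real n + (a + 1))\<^sup>2)) * ((a + 1) - a)
             - (exp (- c * (real n + (a + 1))\<^sup>2) - exp (- c * (real n + a)\<^sup>2)) * ((a + 2) - (a + 1))
         = f c (n + 2) - 2 * f c (n + 1) + f c n" for c n
      by (simp add: f_def add_ac)
    show ?thesis using tendsto_gauss_second_difference_sum[OF w(1), of "a + 2" "a + 1" "a + 1" a]
      unfolding e .
  qed
  have f: "((\<lambda>c. f c n) \<longlongrightarrow> 1) (at_right 0)" for n
  proof -
    have "((\<lambda>c. f c n) \<longlongrightarrow> exp (- 0 * (real n + a)\<^sup>2)) (at_right 0)"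
      unfolding f_def by (intro tendsto_intros)
    thus ?thesis by simp
  qed
  have "((\<lambda>c. ?g c) \<longlongrightarrow>
     exp (2 * of_real pi * z * of_real a) * (((1 - w) * of_real 1 + w * of_real (1 - 1) + w\<^sup>2 * 0) / (1 - w)\<^sup>2)) (at_right 0)"
    using w by (intro tendsto_intros f D) auto
  also have "exp (2 * of_real pi * z * of_real a) * (((1 - w) * of_real 1 + w * of_real (1 - 1) + w\<^sup>2 * 0) / (1 - w)\<^sup>2)
     = exp (2 * of_real pi * z * of_real a) / (1 - w)"
    by (simp add: power2_eq_square)
  finally have L: "((\<lambda>c. ?g c) \<longlongrightarrow>
     exp (2 * of_real pi * z * of_real a) / (1 - w)) (at_right 0)" .
  have "\<forall>\<^sub>F c::real in at_right 0. c > 0" by (rule eventually_at_right_less)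
  hence E: "\<forall>\<^sub>F c in at_right 0. ?g c = half_theta z a c"
  proof eventually_elim
    case (elim c)
    have sf: "summable (f c)"
      using summable_gauss_shift[OF elim, of 0 a] by (simp add: f_def)
    have t: "gauss_exp z c (real n + a)
       = exp (2 * of_real pi * z * of_real a) * (w ^ n * of_real (f c n))" for n
    proof -
      have "w ^ n * of_real (f c n) = exp (of_nat n * (2 * of_real pi * z) + of_real (- c * (real n + a)\<^sup>2))"
        by (simp only: w_def f_def exp_of_nat_mult exp_of_real exp_add)
      thus ?thesis by (simp only: exp_add[symmetric]) (simp add: algebra_simps)
    qed
    have "half_theta z a c = exp (2 * of_real pi * z * of_real a) * (\<Sum>n. w ^ n * of_real (f c n))"
      unfolding half_theta_def t
    proof (rule suminf_mult, rule summable_comparison_test)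
      show "summable (f c)" by (rule sf)
      show "\<exists>N. \<forall>n\<ge>N. norm (w ^ n * of_real (f c n)) \<le> f c n"
        using w by (auto simp: norm_mult norm_power f_def intro!: mult_left_le_one_le power_le_one)
    qed
    moreover have "f c n \<ge> 0" for n by (simp add: f_def)
    note suminf_by_parts[OF w(1) sf this, symmetric]
    ultimately show ?case using w by simp
  qed
  show ?thesis using Lim_transform_eventually[OF L E] by (simp add: w_def)
qed

text \<open>At \<open>z = 0\<close> each sum diverges. Their difference is compared with
  \<open>b - a\<close> times the sum of differences over unit steps, which telescopes to
  \<open>exp 0 = 1\<close>; the error is a sum of second differences.\<close>

lemma tendsto_half_theta_0_diff:
  "((\<lambda>c. half_theta 0 a c - half_theta 0 b c) \<longlongrightarrow> of_real (b - a)) (at_right 0)"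
proof -
  define f where "f = (\<lambda>c x. exp (- c * x\<^sup>2) :: real)"
  let ?d = "\<lambda>c n. 1 ^ n * of_real ((f c (real n + a) - f c (real n + b)) * (0 - 1) - (f c (real n + 0) - f c (real n + 1)) * (a - b)) :: complex"
  let ?D = "\<lambda>c. suminf (\<lambda>n. 1 ^ n * of_real ((f c (real n + a) - f c (real n + b)) * (0 - 1) - (f c (real n + 0) - f c (real n + 1)) * (a - b)) :: complex)"
  have D: "((\<lambda>c. ?D c) \<longlongrightarrow> 0) (at_right 0)"
    unfolding f_def by (rule tendsto_gauss_second_difference_sum) simp
  have "((\<lambda>c. of_real (b - a) - ?D c) \<longlongrightarrow> of_real (b - a) - 0) (at_right 0)"
    by (intro tendsto_diff D tendsto_const)
  hence L: "((\<lambda>c. of_real (b - a) - ?D c) \<longlongrightarrow> of_real (b - a)) (at_right 0)"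
    by simp
  have "\<forall>\<^sub>F c::real in at_right 0. c > 0" by (rule eventually_at_right_less)
  hence E: "\<forall>\<^sub>F c in at_right 0. of_real (b - a) - ?D c
     = half_theta 0 a c - half_theta 0 b c"
  proof eventually_elim
    case (elim c)
    have t: "gauss_exp 0 c x = (of_real (f c x) :: complex)" for x
      by (simp add: f_def flip: exp_of_real)
    have s: "(\<lambda>n. of_real (f c (real n + x))) sums half_theta 0 x c" for x
      using summable_sums[OF summable_half_theta[OF elim, of 0 x]] unfolding half_theta_def t .
    have z: "(\<lambda>n. f c (real n)) \<longlonglongrightarrow> 0"
      using summable_LIMSEQ_zero[OF summable_gauss_shift[OF elim, of 0 0]] by (simp add: f_def)
    have "(\<lambda>n. of_real (f c (real n + 0) - f c (real n + 1)) :: complex) sums (of_real 1)"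
      using telescope_sums'[OF z] by (intro sums_of_real) (simp add: f_def add_ac)
    hence "(\<lambda>n. of_real (b - a) * of_real (f c (real n + 0) - f c (real n + 1)) - (of_real (f c (real n + a)) - of_real (f c (real n + b))))
       sums (of_real (b - a) * of_real 1 - (half_theta 0 a c - half_theta 0 b c))"
      by (intro sums_diff sums_mult s)
    also have "(\<lambda>n. of_real (b - a) * of_real (f c (real n + 0) - f c (real n + 1)) - (of_real (f c (real n + a)) - of_real (f c (real n + b))))
      = ?d c"
      by (simp add: algebra_simps)
    finally show ?case by (simp add: sums_iff)
  qed
  show ?thesis by (rule Lim_transform_eventually[OF L E])
qed

section \<open>Theta series near the cusp\<close>

text \<open>On the missing half line \<open>n = - j - 1\<close> one has
  \<open>n + a = - (j + (1 - a))\<close>, so reflection changes the sign of \<open>z\<close> and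
  turns the shift into \<open>1 - a\<close>. For \<open>Re z > 0\<close> the added sum has a finite
  limit.\<close>

lemma half_theta_reflect:
  fixes z :: complex
  assumes c: "c > 0"
  shows "half_theta z a c + half_theta (- z) (1 - a) c =
    (\<Sum>\<^sub>\<infinity>n::int. gauss_exp z c (of_int n + a))"
proof -
  define f where "f = (\<lambda>n::int. gauss_exp z c (of_int n + a))"
  have 1: "(f has_sum half_theta z a c) (range int)"
  proof (subst has_sum_reindex)
    show "(f \<circ> int has_sum half_theta z a c) UNIV"
      using norm_summable_imp_has_sum[OF summable_norm_half_theta[OF c] summable_sums[OF summable_half_theta[OF c]], of z a]
      by (simp add: f_def o_def half_theta_def)
  qed (auto simp: inj_on_def)
  have 2: "(f has_sum half_theta (- z) (1 - a) c) (range (\<lambda>n. - int n - 1))"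
  proof (subst has_sum_reindex)
    have e: "f (- int n - 1) = gauss_exp (- z) c (real n + (1 - a))" for n
    proof -
      have "real_of_int (- int n - 1) + a = - (real n + (1 - a))" by simp
      thus ?thesis unfolding f_def by (simp only: of_real_minus power2_minus mult_minus_right mult_minus_left)
    qed
    show "(f \<circ> (\<lambda>n. - int n - 1) has_sum half_theta (- z) (1 - a) c) UNIV"
      unfolding o_def e half_theta_def
      by (rule norm_summable_imp_has_sum[OF summable_norm_half_theta[OF c] summable_sums[OF summable_half_theta[OF c]]])
  qed (auto simp: inj_on_def)
  have "(f has_sum (half_theta z a c + half_theta (- z) (1 - a) c)) (range int \<union> range (\<lambda>n. - int n - 1))"
    by (rule has_sum_Un_disjoint[OF 1 2]) auto
  also have "range int \<union> range (\<lambda>n. - int n - 1) = UNIV"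
  proof -
    have "x \<in> range int \<or> x \<in> range (\<lambda>n. - int n - 1)" for x
      by (cases x rule: int_cases) auto
    thus ?thesis by blast
  qed
  finally show ?thesis unfolding f_def by (rule infsumI[symmetric])
qed

text \<open>Classically \<open>sqrt (pi / c)\<close>. Its divergence and a bound of order
  \<open>1 / c\<close> are all that is derived about it, since it only has to dominate constants and
  be dominated by exponentials.\<close>

definition theta_scale :: "real \<Rightarrow> complex" where
  "theta_scale c = gauss_sum 0 c / dual_gauss_sum 0 c"

abbreviation dual_term :: "complex \<Rightarrow> real \<Rightarrow> int \<Rightarrow> complex" where
  "dual_term z c m \<equiv> exp (of_real (pi\<^sup>2 / c) * (z - \<i> * of_int m)\<^sup>2)"

lemma theta_transform:
  fixes z :: complex
  assumes c: "c > 0" and nz: "dual_gauss_sum 0 c \<noteq> 0"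
  shows "(\<Sum>\<^sub>\<infinity>n::int. gauss_exp z c (of_int n + a)) =
    theta_scale c * (\<Sum>\<^sub>\<infinity>m::int. exp (2 * of_real pi * \<i> * of_int m * of_real a) * dual_term z c m)"
proof -
  \<comment> \<open>Expanding \<open>c * (n + a)^2\<close> moves its cross term into the linear
    coefficient \<open>w\<close>; squaring \<open>w\<close> in the dual series then produces the
    phase \<open>exp (2 * of_real pi * \<i> * of_int m * of_real a)\<close>.\<close>
  define w where "w = 2 * of_real pi * z - 2 * of_real (c * a)"
  define e where "e = exp (2 * of_real pi * z * of_real a - of_real (c * a\<^sup>2))"
  have "(\<Sum>\<^sub>\<infinity>n::int. gauss_exp z c (of_int n + a))
    = (\<Sum>\<^sub>\<infinity>n::int. e * exp (w * of_int n - of_real c * (of_int n)\<^sup>2))"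
    unfolding e_def w_def exp_add[symmetric]
    by (intro infsum_cong arg_cong[where f = exp]) (simp add: power2_eq_square algebra_simps)
  also have "\<dots> = e * gauss_sum w c" unfolding gauss_sum_def by (rule infsum_cmult_right')
  also have "gauss_sum w c = theta_scale c * dual_gauss_sum w c"
    using poisson_gauss_proportional[OF c, of w] nz by (simp add: theta_scale_def field_simps)
  also have "e * (theta_scale c * dual_gauss_sum w c) = theta_scale c * (e * dual_gauss_sum w c)" by simp
  also have "e * dual_gauss_sum w c = (\<Sum>\<^sub>\<infinity>j::int. e * exp ((w + 2 * of_real pi * \<i> * of_int j)\<^sup>2 / (4 * of_real c)))"
    unfolding dual_gauss_sum_def by (rule infsum_cmult_right'[symmetric])
  also have "\<dots> = (\<Sum>\<^sub>\<infinity>m::int. e * exp ((w + 2 * of_real pi * \<i> * of_int (- m))\<^sup>2 / (4 * of_real c)))"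
    by (rule infsum_reindex_bij_witness[of _ uminus uminus]) auto
  also have "\<dots> = (\<Sum>\<^sub>\<infinity>m::int. exp (2 * of_real pi * \<i> * of_int m * of_real a) * dual_term z c m)"
  proof (rule infsum_cong)
    fix m :: int
    have "of_real c \<noteq> (0::complex)" using c by simp
    hence "2 * of_real pi * z * of_real a - of_real (c * a\<^sup>2) + (w + 2 * of_real pi * \<i> * of_int (- m))\<^sup>2 / (4 * of_real c)
      = 2 * of_real pi * \<i> * of_int m * of_real a + of_real (pi\<^sup>2 / c) * (z - \<i> * of_int m)\<^sup>2"
      unfolding w_def by (simp add: power2_eq_square field_simps)
    thus "e * exp ((w + 2 * of_real pi * \<i> * of_int (- m))\<^sup>2 / (4 * of_real c)) =
       exp (2 * of_real pi * \<i> * of_int m * of_real a) * dual_term z c m"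
      unfolding e_def exp_add[symmetric] by (simp only:)
  qed
  finally show ?thesis .
qed

lemma norm_dual_term:
  fixes z :: complex
  shows "norm (dual_term z c m) = exp (pi\<^sup>2 * ((Re z)\<^sup>2 - (Im z - of_int m)\<^sup>2) / c)"
proof -
  have "Re ((z - \<i> * of_int m)\<^sup>2) = (Re z)\<^sup>2 - (Im z - of_int m)\<^sup>2"
    by (simp add: power2_eq_square)
  hence "Re (of_real (pi\<^sup>2 / c) * (z - \<i> * of_int m)\<^sup>2) = pi\<^sup>2 / c * ((Re z)\<^sup>2 - (Im z - of_int m)\<^sup>2)"
    by (simp only: Re_complex_of_real Im_complex_of_real times_complex.sel mult_zero_left diff_zero)
  thus ?thesis by (simp add: norm_exp_eq_Re)
qed

section \<open>Tails of the dual series\<close>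

lemma summable_on_exp_shifted_square:
  fixes c v :: real
  assumes "c > 0"
  shows "(\<lambda>m::int. exp (- c * (v - of_int m)\<^sup>2)) summable_on A"
proof -
  have "(\<lambda>m::int. exp (- (c / (4 * pi\<^sup>2)) * (- 2 * pi * v + 2 * pi * of_int m)\<^sup>2)) summable_on UNIV"
    by (rule summable_on_shifted_gauss) (use assms in simp)
  moreover have "- (c / (4 * pi\<^sup>2)) * (- 2 * pi * v + 2 * pi * of_int m)\<^sup>2 = - c * (v - of_int m)\<^sup>2" for m :: int
    by (simp add: power2_eq_square field_simps)
  ultimately have "(\<lambda>m::int. exp (- c * (v - of_int m)\<^sup>2)) summable_on UNIV" by (simp only:)
  thus ?thesis by (rule summable_on_subset_banach) auto
qed

lemma abs_summable_on_dual:
  fixes z :: complex and \<beta> :: "int \<Rightarrow> complex"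
  assumes c: "c > 0" and \<beta>: "\<And>m. norm (\<beta> m) \<le> R"
  shows "(\<lambda>m. norm (\<beta> m * dual_term z c m)) summable_on A"
proof (rule Infinite_Sum.abs_summable_on_comparison_test')
  show "(\<lambda>m. (R * exp (pi\<^sup>2 * (Re z)\<^sup>2 / c)) * exp (- (pi\<^sup>2 / c) * (Im z - of_int m)\<^sup>2)) summable_on A"
    by (intro summable_on_cmult_right summable_on_exp_shifted_square) (use c in simp)
  fix m
  have "norm (\<beta> m * dual_term z c m) \<le> R * exp (pi\<^sup>2 * ((Re z)\<^sup>2 - (Im z - of_int m)\<^sup>2) / c)"
    unfolding norm_mult norm_dual_term by (intro mult_right_mono \<beta>) auto
  also have "\<dots> = (R * exp (pi\<^sup>2 * (Re z)\<^sup>2 / c)) * exp (- (pi\<^sup>2 / c) * (Im z - of_int m)\<^sup>2)"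
    unfolding mult.assoc exp_add[symmetric] by (simp add: diff_divide_distrib right_diff_distrib)
  finally show "norm (\<beta> m * dual_term z c m) \<le>
     (R * exp (pi\<^sup>2 * (Re z)\<^sup>2 / c)) * exp (- (pi\<^sup>2 / c) * (Im z - of_int m)\<^sup>2)" .
qed

text \<open>Finitely many integers lie within \<open>d + 1\<close> of \<open>v\<close>, and for all
  others the excess is at least \<open>(d + 1)\<^sup>2 - d\<^sup>2 \<ge> 1\<close>. Infinitely many
  strict inequalities thus yield one uniform gap, which exponential smallness of a tail
  requires.\<close>

lemma separated_from_interval:
  fixes v d :: real
  assumes d: "d \<ge> 0" and B: "\<And>m::int. m \<in> B \<Longrightarrow> \<bar>v - of_int m\<bar> > d"
  shows "\<exists>\<delta>>0. \<forall>m\<in>B. (v - of_int m)\<^sup>2 - d\<^sup>2 \<ge> \<delta>"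
proof -
  define A where "A = {m\<in>B. \<bar>v - of_int m\<bar> \<le> d + 1}"
  have "A \<subseteq> {\<lfloor>v - d - 1\<rfloor>..\<lceil>v + d + 1\<rceil>}"
    unfolding A_def by (auto simp: abs_le_iff floor_le_iff le_ceiling_iff; linarith)
  hence fin: "finite A" by (rule finite_subset) auto
  have pos: "(v - of_int m)\<^sup>2 - d\<^sup>2 > 0" if "m \<in> B" for m
    using power_strict_mono[OF B[OF that] d, of 2] by simp
  \<comment> \<open>Inserting 1 accounts for the integers outside \<open>A\<close> and keeps the
    minimum meaningful when \<open>A\<close> is empty.\<close>
  define \<delta> where "\<delta> = Min (insert 1 ((\<lambda>m. (v - of_int m)\<^sup>2 - d\<^sup>2) ` A))"
  have "\<delta> > 0" unfolding \<delta>_def using fin pos by (subst Min_gr_iff) (auto simp: A_def)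
  moreover have "(v - of_int m)\<^sup>2 - d\<^sup>2 \<ge> \<delta>" if "m \<in> B" for m
  proof (cases "m \<in> A")
    case True
    thus ?thesis unfolding \<delta>_def using fin by (intro Min_le) auto
  next
    case False
    hence "(d + 1)\<^sup>2 \<le> \<bar>v - of_int m\<bar>\<^sup>2" using that d by (intro power_mono) (auto simp: A_def)
    hence "(v - of_int m)\<^sup>2 - d\<^sup>2 \<ge> 1" using d by (simp add: power2_eq_square algebra_simps)
    moreover have "\<delta> \<le> 1" unfolding \<delta>_def using fin by (intro Min_le) auto
    ultimately show ?thesis by linarith
  qed
  ultimately show ?thesis by blast
qed

text \<open>With \<open>x\<close> the excess of the squared distance over \<open>d\<^sup>2\<close>,
  the surplus \<open>pi\<^sup>2 * x / c \<ge> 2 * x / c\<close> is spent twice. One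
  \<open>x / c\<close> is at least \<open>\<delta> / c\<close> and gives the factor
  \<open>exp (- \<delta> / c)\<close>; the other, since \<open>c \<le> 1\<close>, is at least
  \<open>x\<close> and leaves a summable majorant free of \<open>c\<close>.\<close>

lemma dual_tail_bound:
  fixes z :: complex and \<beta> :: "int \<Rightarrow> complex"
  assumes d: "d \<ge> 0" and B: "\<And>m. m \<in> B \<Longrightarrow> \<bar>Im z - of_int m\<bar> > d" and \<beta>: "\<And>m. norm (\<beta> m) \<le> R"
  shows "\<exists>K \<delta>. \<delta> > 0 \<and> (\<forall>c. 0 < c \<and> c \<le> 1 \<longrightarrow>
    norm (\<Sum>\<^sub>\<infinity>m\<in>B. \<beta> m * dual_term z c m) \<le> K * exp (pi\<^sup>2 * ((Re z)\<^sup>2 - d\<^sup>2) / c) * exp (- \<delta> / c))"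
proof -
  obtain \<delta> where \<delta>: "\<delta> > 0" "\<And>m. m \<in> B \<Longrightarrow> (Im z - of_int m)\<^sup>2 - d\<^sup>2 \<ge> \<delta>"
    using separated_from_interval[OF d B] by blast
  have R: "R \<ge> 0" using \<beta>[of 0] norm_ge_zero order_trans by blast
  define M where "M = (\<lambda>m::int. R * exp (d\<^sup>2) * exp (- 1 * (Im z - of_int m)\<^sup>2))"
  have M: "M summable_on B" unfolding M_def
    by (intro summable_on_cmult_right summable_on_exp_shifted_square) simp
  show ?thesis
  proof (intro exI conjI allI impI)
    fix c :: real assume c: "0 < c \<and> c \<le> 1"
    define E where "E = exp (pi\<^sup>2 * ((Re z)\<^sup>2 - d\<^sup>2) / c) * exp (- \<delta> / c)"
    have "norm (\<Sum>\<^sub>\<infinity>m\<in>B. \<beta> m * dual_term z c m) \<le>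
      (\<Sum>\<^sub>\<infinity>m\<in>B. norm (\<beta> m * dual_term z c m))"
      by (rule norm_infsum_bound[OF abs_summable_on_dual[OF _ \<beta>]]) (use c in simp)
    also have "\<dots> \<le> (\<Sum>\<^sub>\<infinity>m\<in>B. M m * E)"
    proof (rule infsum_mono)
      show "(\<lambda>m. norm (\<beta> m * dual_term z c m)) summable_on B"
        by (rule abs_summable_on_dual[OF _ \<beta>]) (use c in simp)
      show "(\<lambda>m. M m * E) summable_on B" by (rule summable_on_cmult_left[OF M])
      fix m assume m: "m \<in> B"
      define x where "x = (Im z - of_int m)\<^sup>2 - d\<^sup>2"
      have x: "x \<ge> \<delta>" "x > 0" using \<delta>(2)[OF m] \<delta>(1) by (simp_all add: x_def)
      have "pi\<^sup>2 * x / c \<ge> 2 * x / c"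
      proof -
        have "pi * pi \<ge> 2 * 1" using pi_gt3 by (intro mult_mono) auto
        thus ?thesis using c x by (intro divide_right_mono mult_right_mono) (auto simp: power2_eq_square)
      qed
      moreover have "x / c \<ge> \<delta> / c" using x c by (intro divide_right_mono) auto
      moreover have "x / c \<ge> x" using x c by (simp add: le_divide_eq mult_left_le)
      ultimately have px: "pi\<^sup>2 * x / c \<ge> \<delta> / c + x" by simp
      have "norm (\<beta> m * dual_term z c m) \<le> R * exp (pi\<^sup>2 * ((Re z)\<^sup>2 - (Im z - of_int m)\<^sup>2) / c)"
        unfolding norm_mult norm_dual_term by (intro mult_right_mono \<beta>) auto
      also have "pi\<^sup>2 * ((Re z)\<^sup>2 - (Im z - of_int m)\<^sup>2) / c = pi\<^sup>2 * ((Re z)\<^sup>2 - d\<^sup>2) / c - pi\<^sup>2 * x / c"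
        by (simp add: x_def diff_divide_distrib[symmetric] right_diff_distrib)
      also have "R * exp (pi\<^sup>2 * ((Re z)\<^sup>2 - d\<^sup>2) / c - pi\<^sup>2 * x / c) \<le> R * exp (pi\<^sup>2 * ((Re z)\<^sup>2 - d\<^sup>2) / c - \<delta> / c - x)"
        using px R by (intro mult_left_mono) auto
      also have "\<dots> = M m * E"
        unfolding M_def E_def mult.assoc exp_add[symmetric] by (simp add: x_def)
      finally show "norm (\<beta> m * dual_term z c m) \<le> M m * E" .
    qed
    also have "\<dots> = infsum M B * E" by (rule infsum_cmult_left')
    finally show "norm (\<Sum>\<^sub>\<infinity>m\<in>B. \<beta> m * dual_term z c m) \<le> infsum M B * exp (pi\<^sup>2 * ((Re z)\<^sup>2 - d\<^sup>2) / c) * exp (- \<delta> / c)"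
      by (simp add: E_def mult.assoc)
  qed (rule \<delta>)
qed

lemma tendsto_exp_neg_inverse_div:
  fixes \<delta> :: real
  assumes "\<delta> > 0"
  shows "((\<lambda>c. exp (- \<delta> / c) / c) \<longlongrightarrow> 0) (at_right 0)" "((\<lambda>c. exp (- \<delta> / c)) \<longlongrightarrow> 0) (at_right 0)"
proof -
  have l: "filterlim (\<lambda>c::real. \<delta> / c) at_top (at_right 0)"
    unfolding divide_inverse
    by (rule filterlim_tendsto_pos_mult_at_top[OF tendsto_const assms filterlim_inverse_at_top_right])
  have p: "((\<lambda>c. (\<delta> / c) ^ k / exp (\<delta> / c)) \<longlongrightarrow> 0) (at_right 0)" for k
    by (rule filterlim_compose[OF tendsto_power_div_exp_0 l])
  have "((\<lambda>c. (1 / \<delta>) * ((\<delta> / c) ^ 1 / exp (\<delta> / c))) \<longlongrightarrow> (1 / \<delta>) * 0) (at_right 0)"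
    by (intro tendsto_intros p)
  thus "((\<lambda>c. exp (- \<delta> / c) / c) \<longlongrightarrow> 0) (at_right 0)"
    using assms by (simp add: exp_minus field_simps)
  show "((\<lambda>c. exp (- \<delta> / c)) \<longlongrightarrow> 0) (at_right 0)"
    using p[of 0] by (simp add: exp_minus inverse_eq_divide)
qed

lemma infsum_dual_split:
  fixes z :: complex and \<beta> :: "int \<Rightarrow> complex"
  assumes c: "c > 0" and \<beta>: "\<And>m. norm (\<beta> m) \<le> R" and A: "finite A"
  shows "(\<Sum>\<^sub>\<infinity>m. \<beta> m * dual_term z c m) =
     (\<Sum>m\<in>A. \<beta> m * dual_term z c m) +
     (\<Sum>\<^sub>\<infinity>m\<in>-A. \<beta> m * dual_term z c m)"
proof -
  have s: "(\<lambda>m. \<beta> m * dual_term z c m) summable_on B" for B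
    by (rule abs_summable_summable[OF abs_summable_on_dual[OF c \<beta>]])
  have "(\<Sum>\<^sub>\<infinity>m\<in>A \<union> -A. \<beta> m * dual_term z c m) =
     (\<Sum>\<^sub>\<infinity>m\<in>A. \<beta> m * dual_term z c m) +
     (\<Sum>\<^sub>\<infinity>m\<in>-A. \<beta> m * dual_term z c m)"
    by (rule infsum_Un_disjoint[OF s s]) auto
  thus ?thesis using A by (simp add: infsum_finite)
qed

section \<open>Size of the prefactor\<close>

lemma eventually_at_right_0_unit: "\<forall>\<^sub>F c::real in at_right 0. 0 < c \<and> c \<le> 1"
  by (auto simp: eventually_at_right_field intro: exI[of _ 1])

text \<open>At \<open>z = 0\<close> the frequency 0 contributes 1; with \<open>d = 0\<close> the
  tail bound has no growing factor, so all other frequencies vanish in the limit.\<close>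

lemma tendsto_dual_gauss_sum_0: "(dual_gauss_sum 0 \<longlongrightarrow> 1) (at_right 0)"
proof -
  obtain K \<delta> where K: "\<delta> > 0" "\<And>c. 0 < c \<and> c \<le> 1 \<Longrightarrow>
    norm (\<Sum>\<^sub>\<infinity>m\<in>-{0}. 1 * dual_term 0 c m) \<le> K * exp (pi\<^sup>2 * ((Re 0)\<^sup>2 - 0\<^sup>2) / c) * exp (- \<delta> / c)"
    using dual_tail_bound[of 0 "-{0}" 0 "\<lambda>_. 1" 1] by auto
  have "((\<lambda>c. dual_gauss_sum 0 c - 1) \<longlongrightarrow> 0) (at_right 0)"
  proof (rule Lim_null_comparison)
    have "((\<lambda>c. K * exp (- \<delta> / c)) \<longlongrightarrow> K * 0) (at_right 0)"
      by (intro tendsto_intros tendsto_exp_neg_inverse_div K)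
    thus "((\<lambda>c. K * exp (- \<delta> / c)) \<longlongrightarrow> 0) (at_right 0)" by simp
    show "\<forall>\<^sub>F c in at_right 0. norm (dual_gauss_sum 0 c - 1) \<le> K * exp (- \<delta> / c)"
      using eventually_at_right_0_unit
    proof eventually_elim
      case (elim c)
      have "dual_gauss_sum 0 c = (\<Sum>\<^sub>\<infinity>m. 1 * dual_term 0 c m)"
        unfolding dual_gauss_sum_def
        by (intro infsum_cong) (simp add: power_mult_distrib)
      also have "\<dots> = 1 + (\<Sum>\<^sub>\<infinity>m\<in>-{0}. 1 * dual_term 0 c m)"
        using elim by (subst infsum_dual_split[where R = 1 and A = "{0}"]) auto
      finally show ?case using K(2)[OF elim] by simp
    qed
  qed
  thus ?thesis by (simp add: LIM_zero_iff)
qed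

lemma gauss_sum_0_half_theta:
  assumes "c > 0"
  shows "gauss_sum 0 c = half_theta 0 0 c + half_theta 0 1 c"
  using half_theta_reflect[OF assms, of 0 0] by (simp add: gauss_sum_def)

text \<open>\<open>n \<le> n\<^sup>2\<close> replaces the Gaussian by a geometric series. The true
  order is \<open>1 / sqrt c\<close>, but the cruder bound is good enough against a factor
  \<open>exp (- \<delta> / c)\<close>.\<close>

lemma norm_gauss_sum_0_le:
  assumes c: "0 < c" "c \<le> 1"
  shows "norm (gauss_sum 0 c) \<le> 4 / c"
proof -
  have h: "norm (half_theta 0 a c) \<le> 2 / c" if a: "a \<ge> 0" for a
  proof -
    have e1: "norm (exp (- c)) < 1" using c by simp
    have "norm (half_theta 0 a c) \<le> (\<Sum>n. norm (gauss_exp 0 c (real n + a)))"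
      unfolding half_theta_def by (rule summable_norm[OF summable_norm_half_theta[OF c(1)]])
    also have "\<dots> \<le> (\<Sum>n. exp (- c) ^ n)"
    proof (rule suminf_le[OF _ summable_norm_half_theta[OF c(1)] summable_geometric[OF e1]])
      fix n
      have "real n \<le> (real n)\<^sup>2" by (cases n) (auto simp: power2_eq_square)
      also have "\<dots> \<le> (real n + a)\<^sup>2" using a by (intro power_mono) auto
      finally have "c * real n \<le> c * (real n + a)\<^sup>2" using c by (intro mult_left_mono) auto
      thus "norm (gauss_exp 0 c (real n + a)) \<le> exp (- c) ^ n"
        unfolding norm_exp_gauss by (simp add: exp_of_nat_mult[symmetric] mult.commute)
    qed
    also have "\<dots> = 1 / (1 - exp (- c))" by (rule suminf_geometric[OF e1])
    also have "\<dots> \<le> 2 / c"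
    proof -
      have "exp c \<ge> 1 + c" by (rule exp_ge_add_one_self)
      hence "exp (- c) \<le> 1 / (1 + c)" using c by (simp add: exp_minus inverse_eq_divide frac_le)
      also have "\<dots> \<le> 1 - c / 2"
        using c by (simp add: field_simps)
      finally show ?thesis using c by (simp add: field_simps)
    qed
    finally show ?thesis .
  qed
  show ?thesis unfolding gauss_sum_0_half_theta[OF c(1)]
    using norm_triangle_ineq[of "half_theta 0 0 c" "half_theta 0 1 c"] h[of 0] h[of 1] by simp
qed

text \<open>The first \<open>N\<close> terms of the positive half-line series tend to 1 each, so the
  whole sum eventually exceeds every bound.\<close>

lemma filterlim_gauss_sum_0: "filterlim (gauss_sum 0) at_infinity (at_right 0)"
proof (subst filterlim_at_infinity[OF order_refl], intro allI impI)
  fix r :: real assume "r > 0"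
  obtain N where N: "real N > r" using reals_Archimedean2 by blast
  have "((\<lambda>c. \<Sum>n<N. exp (- c * (real n)\<^sup>2)) \<longlongrightarrow> (\<Sum>n<N. exp (- 0 * (real n)\<^sup>2))) (at_right 0)"
    by (intro tendsto_intros)
  hence "\<forall>\<^sub>F c in at_right 0. (\<Sum>n<N. exp (- c * (real n)\<^sup>2)) > r"
    by (rule order_tendstoD) (use N in simp)
  thus "\<forall>\<^sub>F c in at_right 0. r \<le> norm (gauss_sum 0 c)"
    using eventually_at_right_0_unit
  proof eventually_elim
    case (elim c)
    have ht: "half_theta 0 a c = of_real (\<Sum>n. exp (- c * (real n + a)\<^sup>2))" for a
    proof -
      have s: "summable (\<lambda>n. exp (- c * (real n + a)\<^sup>2))"
        using summable_gauss_shift[of c 0 a] elim by simp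
      have t: "gauss_exp 0 c x = (of_real (exp (- c * x\<^sup>2)) :: complex)" for x
        by (simp flip: exp_of_real)
      show ?thesis unfolding half_theta_def t by (rule suminf_of_real[OF s, symmetric])
    qed
    have "r \<le> (\<Sum>n<N. exp (- c * (real n + 0)\<^sup>2))" using elim by simp
    also have "\<dots> \<le> (\<Sum>n. exp (- c * (real n + 0)\<^sup>2))"
      by (rule sum_le_suminf) (use summable_gauss_shift[of c 0 0] elim in auto)
    also have "\<dots> \<le> (\<Sum>n. exp (- c * (real n + 0)\<^sup>2)) + (\<Sum>n. exp (- c * (real n + 1)\<^sup>2))"
      using suminf_nonneg[of "\<lambda>n. exp (- c * (real n + 1)\<^sup>2)"] summable_gauss_shift[of c 0 1] elim by simp
    also have "\<dots> \<le> norm (gauss_sum 0 c)"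
    proof -
      have "gauss_sum 0 c = of_real ((\<Sum>n. exp (- c * (real n + 0)\<^sup>2)) + (\<Sum>n. exp (- c * (real n + 1)\<^sup>2)))"
        unfolding of_real_add ht[symmetric] by (rule gauss_sum_0_half_theta) (use elim in simp)
      thus ?thesis by (simp only: norm_of_real abs_ge_self)
    qed
    finally show ?case .
  qed
qed

lemma filterlim_theta_scale: "filterlim theta_scale at_infinity (at_right 0)"
proof -
  have "((\<lambda>c. inverse (dual_gauss_sum 0 c)) \<longlongrightarrow> inverse 1) (at_right 0)"
    by (intro tendsto_inverse tendsto_dual_gauss_sum_0) simp
  from tendsto_mult_filterlim_at_infinity[OF this _ filterlim_gauss_sum_0] show ?thesis
    unfolding theta_scale_def[abs_def] by (simp add: divide_inverse mult.commute)
qed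

lemma eventually_dual_gauss_sum_0: "\<forall>\<^sub>F c in at_right 0. norm (dual_gauss_sum 0 c) > 1 / 2"
  by (rule order_tendstoD(1)[OF tendsto_norm[OF tendsto_dual_gauss_sum_0]]) simp

lemma eventually_norm_theta_scale_le: "\<forall>\<^sub>F c in at_right 0. norm (theta_scale c) \<le> 8 / c"
  using eventually_dual_gauss_sum_0 eventually_at_right_0_unit
proof eventually_elim
  case (elim c)
  have "norm (theta_scale c) \<le> (4 / c) / (1 / 2)"
    unfolding theta_scale_def norm_divide using elim norm_gauss_sum_0_le[of c]
    by (intro frac_le) auto
  thus ?case by simp
qed

section \<open>Differences of half-line sums for Re z > 0\<close>

lemma infsum_diff:
  fixes f g :: "'a \<Rightarrow> complex"
  assumes "f summable_on A" "g summable_on A"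
  shows "(\<Sum>\<^sub>\<infinity>x\<in>A. f x - g x) = infsum f A - infsum g A"
  using infsum_add[of f A "\<lambda>x. - g x"] assms by (simp add: summable_on_uminus infsum_uminus)

text \<open>Completion to full theta series subtracts half-line sums of \<open>- z\<close>, which
  converge to their Abel values \<open>T\<close>, and \<open>- T a\<close> simplifies to the
  expression found for \<open>Re z \<le> 0\<close>. The constant part thus obeys one formula on both
  sides of the imaginary axis; only the dual series makes a difference.\<close>

lemma half_theta_diff_asymp:
  fixes z :: complex
  assumes z: "Re z > 0"
  shows "((\<lambda>c. half_theta z a c - half_theta z b c - theta_scale c *
      (\<Sum>\<^sub>\<infinity>m::int. (exp (2 * of_real pi * \<i> * of_int m * of_real a) - exp (2 * of_real pi * \<i> * of_int m * of_real b)) * dual_term z c m))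
     \<longlongrightarrow> (exp (2 * of_real pi * z * of_real a) - exp (2 * of_real pi * z * of_real b)) / (1 - exp (2 * of_real pi * z))) (at_right 0)"
proof -
  define T where "T = (\<lambda>a. exp (2 * of_real pi * (- z) * of_real (1 - a)) / (1 - exp (2 * of_real pi * (- z))))"
  have gt: "norm (exp (2 * of_real pi * z)) > 1" using z by simp
  hence ne: "exp (2 * of_real pi * z) \<noteq> 1" by (metis norm_one less_irrefl)
  have ne': "exp (2 * of_real pi * (- z)) \<noteq> 1" using ne by (simp add: exp_minus)
  have T: "- T a = exp (2 * of_real pi * z * of_real a) / (1 - exp (2 * of_real pi * z))" for a
  proof -
    have 1: "exp (2 * of_real pi * (- z) * of_real (1 - a)) = exp (2 * of_real pi * z * of_real a) / exp (2 * of_real pi * z)"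
      unfolding exp_diff[symmetric] by (simp add: algebra_simps)
    have 2: "exp (2 * of_real pi * (- z)) = 1 / exp (2 * of_real pi * z)"
      by (simp add: exp_minus inverse_eq_divide)
    have "- (X / w / (1 - 1 / w)) = X / (1 - w)" if "w \<noteq> 0" "w \<noteq> 1" for X w :: complex
      using that by (simp add: field_simps)
    from this[OF exp_not_eq_zero ne] show ?thesis unfolding T_def 1 2 .
  qed
  have L: "((\<lambda>c. half_theta (- z) (1 - b) c - half_theta (- z) (1 - a) c) \<longlongrightarrow> T b - T a) (at_right 0)"
    unfolding T_def using z ne' by (intro tendsto_diff tendsto_half_theta) auto
  have E: "\<forall>\<^sub>F c in at_right 0. half_theta (- z) (1 - b) c - half_theta (- z) (1 - a) c = half_theta z a c - half_theta z b c - theta_scale c *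
      (\<Sum>\<^sub>\<infinity>m::int. (exp (2 * of_real pi * \<i> * of_int m * of_real a) - exp (2 * of_real pi * \<i> * of_int m * of_real b)) * dual_term z c m)"
    using eventually_dual_gauss_sum_0 eventually_at_right_0_unit
  proof eventually_elim
    case (elim c)
    have c: "c > 0" and nz: "dual_gauss_sum 0 c \<noteq> 0" using elim by auto
    let ?D = "\<lambda>a. \<Sum>\<^sub>\<infinity>m::int. exp (2 * of_real pi * \<i> * of_int m * of_real a) * dual_term z c m"
    have h: "half_theta z a c + half_theta (- z) (1 - a) c = theta_scale c * ?D a" for a
      unfolding half_theta_reflect[OF c] theta_transform[OF c nz] ..
    have s: "(\<lambda>m::int. exp (2 * of_real pi * \<i> * of_int m * of_real a) * dual_term z c m) summable_on UNIV" for a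
      by (rule abs_summable_summable[OF abs_summable_on_dual[OF c, where R = 1]]) simp
    have D: "(\<Sum>\<^sub>\<infinity>m::int. (exp (2 * of_real pi * \<i> * of_int m * of_real a) - exp (2 * of_real pi * \<i> * of_int m * of_real b)) * dual_term z c m)
      = ?D a - ?D b"
      unfolding left_diff_distrib by (rule infsum_diff[OF s s])
    have "theta_scale c * (?D a - ?D b) = (half_theta z a c + half_theta (- z) (1 - a) c) - (half_theta z b c + half_theta (- z) (1 - b) c)"
      unfolding h by (rule right_diff_distrib)
    thus ?case unfolding D by simp
  qed
  have "T b - T a = (exp (2 * of_real pi * z * of_real a) - exp (2 * of_real pi * z * of_real b)) / (1 - exp (2 * of_real pi * z))"
    unfolding diff_divide_distrib T[symmetric] by simp
  thus ?thesis using Lim_transform_eventually[OF L E] by simp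
qed

definition theta_coeff :: "real \<Rightarrow> real \<Rightarrow> int \<Rightarrow> complex" where
  "theta_coeff a b m = exp (2 * of_real pi * \<i> * of_int m * of_real a) - exp (2 * of_real pi * \<i> * of_int m * of_real b)"

lemma norm_theta_coeff_le: "norm (theta_coeff a b m) \<le> 2"
proof -
  have "norm (exp (2 * of_real pi * \<i> * of_int m * of_real x)) = 1" for x :: real
    by simp
  thus ?thesis unfolding theta_coeff_def
    by (metis norm_triangle_ineq4 one_add_one)
qed

lemma infsum_theta_coeff_restrict:
  "(\<Sum>\<^sub>\<infinity>m\<in>A. theta_coeff a b m * g m) = (\<Sum>\<^sub>\<infinity>m\<in>{m\<in>A. theta_coeff a b m \<noteq> 0}. theta_coeff a b m * g m)"
  by (rule infsum_cong_neutral) auto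

text \<open>With \<open>d = Re z\<close> the growth rate in the tail bound is 0, and the remaining
  \<open>exp (- \<delta> / c)\<close> beats the \<open>8 / c\<close> of the prefactor, so the dual
  series contributes nothing. Frequencies with coefficient 0 may be arbitrarily near.\<close>

lemma half_theta_diff_tendsto:
  fixes z :: complex
  assumes z: "Re z > 0" and far: "\<And>m. theta_coeff a b m \<noteq> 0 \<Longrightarrow> \<bar>Im z - of_int m\<bar> > Re z"
  shows "((\<lambda>c. half_theta z a c - half_theta z b c) \<longlongrightarrow>
     (exp (2 * of_real pi * z * of_real a) - exp (2 * of_real pi * z * of_real b)) / (1 - exp (2 * of_real pi * z))) (at_right 0)"
proof -
  let ?T = "(exp (2 * of_real pi * z * of_real a) - exp (2 * of_real pi * z * of_real b)) / (1 - exp (2 * of_real pi * z))"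
  let ?D = "\<lambda>c. \<Sum>\<^sub>\<infinity>m. theta_coeff a b m * dual_term z c m"
  obtain K \<delta> where K: "\<delta> > 0" "\<And>c. 0 < c \<and> c \<le> 1 \<Longrightarrow>
    norm (\<Sum>\<^sub>\<infinity>m\<in>{m\<in>UNIV. theta_coeff a b m \<noteq> 0}. theta_coeff a b m * dual_term z c m)
       \<le> K * exp (pi\<^sup>2 * ((Re z)\<^sup>2 - (Re z)\<^sup>2) / c) * exp (- \<delta> / c)"
    using dual_tail_bound[of "Re z" "{m\<in>UNIV. theta_coeff a b m \<noteq> 0}" z "theta_coeff a b" 2] z far norm_theta_coeff_le by auto
  have 0: "((\<lambda>c. theta_scale c * ?D c) \<longlongrightarrow> 0) (at_right 0)"
  proof (rule Lim_null_comparison)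
    have "((\<lambda>c. 8 * K * (exp (- \<delta> / c) / c)) \<longlongrightarrow> 8 * K * 0) (at_right 0)"
      by (intro tendsto_intros tendsto_exp_neg_inverse_div K)
    thus "((\<lambda>c. 8 * K * (exp (- \<delta> / c) / c)) \<longlongrightarrow> 0) (at_right 0)" by simp
    show "\<forall>\<^sub>F c in at_right 0. norm (theta_scale c * ?D c) \<le> 8 * K * (exp (- \<delta> / c) / c)"
      using eventually_norm_theta_scale_le eventually_at_right_0_unit
    proof eventually_elim
      case (elim c)
      have "norm (?D c) \<le> K * exp (- \<delta> / c)"
        unfolding infsum_theta_coeff_restrict[of a b _ UNIV] using K(2)[OF elim(2)] by simp
      hence "norm (theta_scale c * ?D c) \<le> (8 / c) * (K * exp (- \<delta> / c))"
        unfolding norm_mult using elim by (intro mult_mono) auto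
      thus ?case by simp
    qed
  qed
  have "((\<lambda>c. (half_theta z a c - half_theta z b c - theta_scale c * ?D c) + theta_scale c * ?D c) \<longlongrightarrow> ?T + 0) (at_right 0)"
    by (rule tendsto_add[OF half_theta_diff_asymp[OF z, of a b, folded theta_coeff_def] 0])
  thus ?thesis by simp
qed

lemma filterlim_theta_scale_exp:
  assumes "x \<ge> 0"
  shows "filterlim (\<lambda>c. theta_scale c * of_real (exp (x / c))) at_infinity (at_right 0)"
proof (subst filterlim_at_infinity[OF order_refl], intro allI impI)
  fix r :: real assume "r > 0"
  hence "\<forall>\<^sub>F c in at_right 0. r \<le> norm (theta_scale c)"
    using filterlim_theta_scale filterlim_at_infinity[OF order_refl, of theta_scale] by blast
  thus "\<forall>\<^sub>F c in at_right 0. r \<le> norm (theta_scale c * of_real (exp (x / c)))"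
    using eventually_at_right_0_unit
  proof eventually_elim
    case (elim c)
    have "r \<le> norm (theta_scale c) * 1" using elim by simp
    also have "\<dots> \<le> norm (theta_scale c) * exp (x / c)"
      using elim assms by (intro mult_left_mono) auto
    finally show ?case by (simp add: norm_mult)
  qed
qed

text \<open>\<open>A\<close> is meant to hold the frequencies at distance \<open>d\<close>, and the
  divisor is their common size. It tends to infinity even for \<open>d = Re z\<close>, where the
  exponential is 1 and the prefactor alone diverges. Hence the constant part drops out, on the
  boundary \<open>\<bar>v\<^sub>0\<bar> = \<bar>u\<^sub>0\<bar>\<close> as well as inside.\<close>

lemma half_theta_diff_dominant:
  fixes z :: complex
  assumes z: "Re z > 0" and d: "0 \<le> d" "d \<le> Re z" and A: "finite A"
    and far: "\<And>m. m \<notin> A \<Longrightarrow> theta_coeff a b m \<noteq> 0 \<Longrightarrow> \<bar>Im z - of_int m\<bar> > d"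
  defines "x \<equiv> pi\<^sup>2 * ((Re z)\<^sup>2 - d\<^sup>2)"
  shows "((\<lambda>c. (half_theta z a c - half_theta z b c) / (theta_scale c * of_real (exp (x / c))) -
     (\<Sum>m\<in>A. theta_coeff a b m * (dual_term z c m / of_real (exp (x / c))))) \<longlongrightarrow> 0) (at_right 0)"
proof -
  let ?H = "\<lambda>c. half_theta z a c - half_theta z b c"
  let ?S = "\<lambda>c. theta_scale c * of_real (exp (x / c))"
  let ?T = "(exp (2 * of_real pi * z * of_real a) - exp (2 * of_real pi * z * of_real b)) / (1 - exp (2 * of_real pi * z))"
  let ?D = "\<lambda>c. \<Sum>\<^sub>\<infinity>m. theta_coeff a b m * dual_term z c m"
  let ?R = "\<lambda>c. \<Sum>\<^sub>\<infinity>m\<in>-A. theta_coeff a b m * dual_term z c m"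
  have x: "x \<ge> 0" using d z by (simp add: x_def power_mono)
  obtain K \<delta> where K: "\<delta> > 0" "\<And>c. 0 < c \<and> c \<le> 1 \<Longrightarrow>
    norm (\<Sum>\<^sub>\<infinity>m\<in>{m\<in>-A. theta_coeff a b m \<noteq> 0}. theta_coeff a b m * dual_term z c m)
       \<le> K * exp (x / c) * exp (- \<delta> / c)"
    using dual_tail_bound[of d "{m\<in>-A. theta_coeff a b m \<noteq> 0}" z "theta_coeff a b" 2] d far norm_theta_coeff_le
    unfolding x_def by auto
  have 0: "((\<lambda>c. ?R c / of_real (exp (x / c))) \<longlongrightarrow> 0) (at_right 0)"
  proof (rule Lim_null_comparison)
    have "((\<lambda>c. K * exp (- \<delta> / c)) \<longlongrightarrow> K * 0) (at_right 0)"
      by (intro tendsto_intros tendsto_exp_neg_inverse_div K)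
    thus "((\<lambda>c. K * exp (- \<delta> / c)) \<longlongrightarrow> 0) (at_right 0)" by simp
    show "\<forall>\<^sub>F c in at_right 0. norm (?R c / of_real (exp (x / c))) \<le> K * exp (- \<delta> / c)"
      using eventually_at_right_0_unit
    proof eventually_elim
      case (elim c)
      have "norm (?R c) \<le> K * exp (x / c) * exp (- \<delta> / c)"
        unfolding infsum_theta_coeff_restrict[of a b _ "-A"] using K(2)[OF elim] .
      hence "norm (?R c) / exp (x / c) \<le> K * exp (x / c) * exp (- \<delta> / c) / exp (x / c)"
        by (intro divide_right_mono) auto
      thus ?case by (simp add: norm_divide)
    qed
  qed
  have "((\<lambda>c. (?H c - theta_scale c * ?D c) / (?S c)) \<longlongrightarrow> 0) (at_right 0)"
    by (rule tendsto_divide_0[OF half_theta_diff_asymp[OF z, of a b, folded theta_coeff_def] filterlim_theta_scale_exp[OF x]])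
  from tendsto_add[OF this 0]
  have L: "((\<lambda>c. (?H c - theta_scale c * ?D c) / (?S c) + ?R c / of_real (exp (x / c))) \<longlongrightarrow> 0) (at_right 0)"
    by simp
  have ne: "\<forall>\<^sub>F c in at_right 0. theta_scale c \<noteq> 0"
    using filterlim_theta_scale by (rule filterlim_at_infinity_imp_eventually_ne)
  have E: "\<forall>\<^sub>F c in at_right 0. (?H c - theta_scale c * ?D c) / (?S c) + ?R c / of_real (exp (x / c))
    = (?H c) / (?S c) -
     (\<Sum>m\<in>A. theta_coeff a b m * (dual_term z c m / of_real (exp (x / c))))"
    using ne eventually_at_right_0_unit
  proof eventually_elim
    case (elim c)
    have "?D c = (\<Sum>m\<in>A. theta_coeff a b m * dual_term z c m) + ?R c"
      using elim by (intro infsum_dual_split[OF _ norm_theta_coeff_le A]) simp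
    moreover have "(\<Sum>m\<in>A. theta_coeff a b m * (dual_term z c m / of_real (exp (x / c))))
       = (\<Sum>m\<in>A. theta_coeff a b m * dual_term z c m) / of_real (exp (x / c))"
      by (simp add: sum_divide_distrib)
    ultimately show ?case using elim
      by (simp add: diff_divide_distrib add_divide_distrib ring_distribs)
  qed
  show ?thesis by (rule Lim_transform_eventually[OF L E])
qed

text \<open>Twice the sum is \<open>gauss_sum 0\<close>, which is the sum of the shifts 0 and 1, up
  to two differences that converge.\<close>

lemma filterlim_half_theta_0: "filterlim (half_theta 0 a) at_infinity (at_right 0)"
proof -
  have "((\<lambda>c. (half_theta 0 a c - half_theta 0 0 c) + (half_theta 0 a c - half_theta 0 1 c)) \<longlongrightarrow> of_real (0 - a) + of_real (1 - a)) (at_right 0)"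
    by (intro tendsto_add tendsto_half_theta_0_diff)
  from tendsto_add_filterlim_at_infinity[OF this filterlim_gauss_sum_0]
  have "filterlim (\<lambda>c. (half_theta 0 a c - half_theta 0 0 c) + (half_theta 0 a c - half_theta 0 1 c) + gauss_sum 0 c) at_infinity (at_right 0)" .
  from tendsto_mult_filterlim_at_infinity[OF tendsto_const _ this, of "1/2"]
  have F: "filterlim (\<lambda>c. 1/2 * ((half_theta 0 a c - half_theta 0 0 c) + (half_theta 0 a c - half_theta 0 1 c) + gauss_sum 0 c)) at_infinity (at_right 0)"
    by simp
  have "\<forall>\<^sub>F c in at_right 0. 1/2 * ((half_theta 0 a c - half_theta 0 0 c) + (half_theta 0 a c - half_theta 0 1 c) + gauss_sum 0 c) = half_theta 0 a c"
    using eventually_at_right_0_unit by eventually_elim (simp add: gauss_sum_0_half_theta)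
  from filterlim_cong[OF refl refl this] F show ?thesis by simp
qed

section \<open>Purely imaginary integer arguments\<close>

lemma half_theta_imaginary_integer:
  assumes c: "c > 0"
  shows "half_theta (\<i> * of_int k) a c = exp (2 * of_real pi * \<i> * of_int k * of_real a) * half_theta 0 a c"
proof -
  have "exp (2 * of_real pi * (\<i> * of_int k) * of_real (real n + a) - of_real c * (of_real (real n + a))\<^sup>2)
     = exp (2 * of_real pi * \<i> * of_int k * of_real a) * gauss_exp 0 c (real n + a)" for n
  proof -
    have "exp (2 * of_real pi * (\<i> * of_int k) * of_real (real n + a) - of_real c * (of_real (real n + a))\<^sup>2)
      = exp (\<i> * (of_int (k * int n) * (of_real pi * 2))) * exp (2 * of_real pi * \<i> * of_int k * of_real a + (2 * of_real pi * 0 * of_real (real n + a) - of_real c * (of_real (real n + a))\<^sup>2))"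
      unfolding exp_add[symmetric] by (simp add: algebra_simps)
    thus ?thesis by (simp only: exp_2pi_1_int mult_1 exp_add)
  qed
  thus ?thesis unfolding half_theta_def
    by (simp only: suminf_mult[OF summable_half_theta[OF c]])
qed

text \<open>At \<open>z = \<i> * of_int k\<close> the phase depends on the shift only. The
  difference therefore splits into a divergent half-line sum, weighted by the dual coefficient at
  \<open>k\<close>, and a convergent part. Whether \<open>theta_coeff a b k\<close> vanishes decides
  which of them governs the quotient.\<close>

lemma half_theta_diff_imaginary_integer:
  assumes c: "c > 0"
  shows "half_theta (\<i> * of_int k) a c - half_theta (\<i> * of_int k) b c =
    theta_coeff a b k * half_theta 0 a c + exp (2 * of_real pi * \<i> * of_int k * of_real b) * (half_theta 0 a c - half_theta 0 b c)"
  unfolding half_theta_imaginary_integer[OF c] theta_coeff_def by (simp add: algebra_simps)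

lemma tendsto_half_theta_diff_imaginary_integer:
  "((\<lambda>c. (half_theta (\<i> * of_int k) a c - half_theta (\<i> * of_int k) b c) / half_theta 0 0 c) \<longlongrightarrow> theta_coeff a b k) (at_right 0)"
proof -
  let ?e = "exp (2 * of_real pi * \<i> * of_int k * of_real b)"
  have q: "((\<lambda>c. (half_theta 0 x c - half_theta 0 y c) / half_theta 0 0 c) \<longlongrightarrow> 0) (at_right 0)" for x y
    by (rule tendsto_divide_0[OF tendsto_half_theta_0_diff filterlim_half_theta_0])
  have "((\<lambda>c. theta_coeff a b k * (1 + (half_theta 0 a c - half_theta 0 0 c) / half_theta 0 0 c) +
      ?e * ((half_theta 0 a c - half_theta 0 b c) / half_theta 0 0 c)) \<longlongrightarrow>
     theta_coeff a b k * (1 + 0) + ?e * 0) (at_right 0)"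
    by (intro tendsto_intros q)
  hence L: "((\<lambda>c. theta_coeff a b k * (1 + (half_theta 0 a c - half_theta 0 0 c) / half_theta 0 0 c) +
      ?e * ((half_theta 0 a c - half_theta 0 b c) / half_theta 0 0 c)) \<longlongrightarrow> theta_coeff a b k) (at_right 0)"
    by simp
  have ne: "\<forall>\<^sub>F c in at_right 0. half_theta 0 0 c \<noteq> 0"
    using filterlim_half_theta_0 by (rule filterlim_at_infinity_imp_eventually_ne)
  have E: "\<forall>\<^sub>F c in at_right 0. theta_coeff a b k * (1 + (half_theta 0 a c - half_theta 0 0 c) / half_theta 0 0 c) +
      ?e * ((half_theta 0 a c - half_theta 0 b c) / half_theta 0 0 c)
    = (half_theta (\<i> * of_int k) a c - half_theta (\<i> * of_int k) b c) / half_theta 0 0 c"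
    using ne eventually_at_right_0_unit
  proof eventually_elim
    case (elim c)
    have "1 + (half_theta 0 a c - half_theta 0 0 c) / half_theta 0 0 c = half_theta 0 a c / half_theta 0 0 c"
      using elim by (simp add: field_simps)
    thus ?case using elim by (simp add: half_theta_diff_imaginary_integer add_divide_distrib)
  qed
  show ?thesis by (rule Lim_transform_eventually[OF L E])
qed

lemma tendsto_half_theta_diff_imaginary_integer_0:
  assumes "theta_coeff a b k = 0"
  shows "((\<lambda>c. half_theta (\<i> * of_int k) a c - half_theta (\<i> * of_int k) b c) \<longlongrightarrow> exp (2 * of_real pi * \<i> * of_int k * of_real b) * of_real (b - a)) (at_right 0)"
proof (rule Lim_transform_eventually)
  show "((\<lambda>c. exp (2 * of_real pi * \<i> * of_int k * of_real b) * (half_theta 0 a c - half_theta 0 b c)) \<longlongrightarrow> exp (2 * of_real pi * \<i> * of_int k * of_real b) * of_real (b - a)) (at_right 0)"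
    by (intro tendsto_mult tendsto_const tendsto_half_theta_0_diff)
  show "\<forall>\<^sub>F c in at_right 0. exp (2 * of_real pi * \<i> * of_int k * of_real b) * (half_theta 0 a c - half_theta 0 b c) = half_theta (\<i> * of_int k) a c - half_theta (\<i> * of_int k) b c"
    using eventually_at_right_0_unit
    by eventually_elim (simp add: half_theta_diff_imaginary_integer assms)
qed

section \<open>Characters of the singlet algebra\<close>

text \<open>The shifts come from dividing \<open>2pn - s - pr + 2p\<close> and
  \<open>2pn + s - pr + 2p\<close> by \<open>2p\<close>, after which consecutive terms are one unit
  apart.\<close>

definition singlet_num :: "nat \<Rightarrow> complex \<Rightarrow> int \<Rightarrow> nat \<Rightarrow> real \<Rightarrow> complex" where
  "singlet_num p z r s c = half_theta z (1 - of_int r / 2 - real s / (2 * real p)) c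
     - half_theta z (1 - of_int r / 2 + real s / (2 * real p)) c"

definition singlet_coeff :: "nat \<Rightarrow> int \<Rightarrow> nat \<Rightarrow> int \<Rightarrow> complex" where
  "singlet_coeff p r s = theta_coeff (1 - of_int r / 2 - real s / (2 * real p)) (1 - of_int r / 2 + real s / (2 * real p))"

lemma theta_term_conv:
  fixes z :: complex and x t :: real
  assumes p: "p > 0" and m: "of_int m = 2 * real p * x"
  shows "theta_term p (z / of_real (sqrt (2 * real p))) m (\<i> * of_real t)
    = exp (2 * of_real pi * z * of_real x - of_real (2 * pi * real p * t) * (of_real x)\<^sup>2)"
proof -
  have m': "(of_int m :: complex) = 2 * of_nat p * of_real x"
    using arg_cong[OF m, of complex_of_real] by simp
  have sq: "of_real (sqrt (2 * real p)) * of_real (sqrt (2 * real p)) = (2 * of_nat p :: complex)"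
    unfolding of_real_mult[symmetric] by simp
  have "2 * of_real pi * (z / of_real (sqrt (2 * real p))) / of_real (sqrt (2 * real p)) * of_int m
     = 2 * of_real pi * z * of_int m / (of_real (sqrt (2 * real p)) * of_real (sqrt (2 * real p)))"
    by simp
  also have "\<dots> = 2 * of_real pi * z * of_real x"
    unfolding sq m' using p by simp
  finally have 1: "2 * of_real pi * (z / of_real (sqrt (2 * real p))) / of_real (sqrt (2 * real p)) * of_int m = 2 * of_real pi * z * of_real x" .
  have 2: "2 * of_real pi * \<i> * ((of_int m)\<^sup>2 / (4 * of_nat p)) * (\<i> * of_real t) = - (of_real (2 * pi * real p * t) * (of_real x)\<^sup>2)"
    unfolding m' using p by (simp add: power2_eq_square)
  show ?thesis unfolding theta_term_def qpow_def 1 2 by (simp add: exp_diff exp_minus divide_inverse)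
qed

lemma ch_M_conv:
  fixes z :: complex
  assumes p: "p > 0" and t: "t > 0"
  shows "ch_M p (z / of_real (sqrt (2 * real p))) r s (\<i> * of_real t)
    = 1 / dedekind_eta (\<i> * of_real t) * singlet_num p z r s (2 * pi * real p * t)"
proof -
  define c where "c = 2 * pi * real p * t"
  have c: "c > 0" using p t by (simp add: c_def)
  have 1: "theta_term p (z / of_real (sqrt (2 * real p))) (2 * int p * int n - int s - int p * r + 2 * int p) (\<i> * of_real t)
    = gauss_exp z c (real n + (1 - of_int r / 2 - real s / (2 * real p)))" for n
    unfolding c_def by (rule theta_term_conv[OF p]) (use p in \<open>simp add: field_simps\<close>)
  have 2: "theta_term p (z / of_real (sqrt (2 * real p))) (2 * int p * int n + int s - int p * r + 2 * int p) (\<i> * of_real t)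
    = gauss_exp z c (real n + (1 - of_int r / 2 + real s / (2 * real p)))" for n
    unfolding c_def by (rule theta_term_conv[OF p]) (use p in \<open>simp add: field_simps\<close>)
  show ?thesis
    unfolding ch_M_def 1 2 singlet_num_def half_theta_def c_def[symmetric]
    by (subst suminf_diff[OF summable_half_theta[OF c] summable_half_theta[OF c]]) (rule refl)
qed

text \<open>Needed to cancel the eta factors: an absolutely convergent product without zero factors
  is nonzero.\<close>

lemma dedekind_eta_nonzero:
  assumes t: "t > 0"
  shows "dedekind_eta (\<i> * of_real t) \<noteq> 0"
proof -
  have q: "qpow (of_nat (Suc n)) (\<i> * of_real t) = of_real (exp (- (2 * pi * t)) ^ Suc n)" for n
  proof -
    have "2 * of_real pi * \<i> * of_nat (Suc n) * (\<i> * of_real t) = of_real (real (Suc n) * (- (2 * pi * t)))"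
      by (simp add: algebra_simps)
    thus ?thesis unfolding qpow_def exp_of_nat_mult[symmetric] by (simp only: exp_of_real)
  qed
  have lt: "exp (- (2 * pi * t)) < 1" using t by simp
  have "summable (\<lambda>n. exp (- (2 * pi * t)) ^ Suc n)"
    using lt by (subst summable_Suc_iff) (intro summable_geometric, simp)
  hence "summable (\<lambda>n. norm ((1 - qpow (of_nat (Suc n)) (\<i> * of_real t)) - 1))"
    unfolding q by (simp add: norm_mult norm_power del: of_real_power)
  hence conv: "convergent_prod (\<lambda>n. 1 - qpow (of_nat (Suc n)) (\<i> * of_real t))"
    by (intro abs_convergent_prod_imp_convergent_prod summable_imp_abs_convergent_prod)
  have "1 - qpow (of_nat (Suc n)) (\<i> * of_real t) \<noteq> 0" for n
  proof -
    have "exp (- (2 * pi * t)) ^ Suc n < 1" using lt by (intro power_Suc_less_one) auto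
    hence "complex_of_real (exp (- (2 * pi * t)) ^ Suc n) \<noteq> 1"
      by (metis less_irrefl of_real_eq_1_iff)
    thus ?thesis unfolding q by (metis eq_iff_diff_eq_0)
  qed
  with prodinf_nonzero[OF conv] show ?thesis
    unfolding dedekind_eta_def by (simp add: qpow_def)
qed

text \<open>An equivalence rather than an implication, because the nonexistence of a limit has to be
  transferred as well.\<close>

lemma tendsto_rescale_at_right_0:
  fixes f :: "real \<Rightarrow> 'a :: topological_space"
  assumes "k > 0"
  shows "((\<lambda>t. f (k * t)) \<longlongrightarrow> L) (at_right 0) \<longleftrightarrow> (f \<longlongrightarrow> L) (at_right 0)"
proof -
  have "filtermap f (filtermap ((*) k) (at_right 0)) = filtermap f (at_right 0)"
    using filtermap_times_pos_at_right[OF assms, of 0] by simp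
  thus ?thesis unfolding filterlim_def filtermap_filtermap by simp
qed

lemma has_qdim_M_iff:
  fixes z :: complex
  assumes p: "p > 0"
  shows "has_qdim p (z / of_real (sqrt (2 * real p))) (ch_M p (z / of_real (sqrt (2 * real p))) r s) L \<longleftrightarrow>
    ((\<lambda>c. singlet_num p z r s c / singlet_num p z 1 1 c) \<longlongrightarrow> L) (at_right 0)"
proof -
  have k: "2 * pi * real p > 0" using p by simp
  have "\<forall>\<^sub>F t::real in at_right 0. t > 0" by (rule eventually_at_right_less)
  hence "\<forall>\<^sub>F t::real in at_right 0. ch_M p (z / of_real (sqrt (2 * real p))) r s (\<i> * of_real t) / ch_M p (z / of_real (sqrt (2 * real p))) 1 1 (\<i> * of_real t)
    = singlet_num p z r s (2 * pi * real p * t) / singlet_num p z 1 1 (2 * pi * real p * t)"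
    by eventually_elim (simp add: ch_M_conv[OF p] dedekind_eta_nonzero)
  note tendsto_cong[OF this, of L]
  also note tendsto_rescale_at_right_0[OF k]
  finally show ?thesis unfolding has_qdim_def .
qed

text \<open>At \<open>\<i> * of_real t\<close> the q-power of a typical character tends to 1, so up
  to a constant factor its dimension is the limit of \<open>1 / singlet_num p z 1 1\<close>. Every
  statement about typical modules reduces to that limit.\<close>

lemma has_qdim_F:
  fixes z \<mu> :: complex
  assumes p: "p > 0" and L: "((\<lambda>c. 1 / singlet_num p z 1 1 c) \<longlongrightarrow> L) (at_right 0)"
    and M: "M = exp (2 * of_real pi * (z / of_real (sqrt (2 * real p))) * (\<mu> - of_real (alpha0 p / 2))) * L"
  shows "has_qdim p (z / of_real (sqrt (2 * real p))) (ch_F p (z / of_real (sqrt (2 * real p))) \<mu>) M"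
proof -
  define \<epsilon> where "\<epsilon> = z / of_real (sqrt (2 * real p))"
  let ?e = "exp (2 * of_real pi * \<epsilon> * (\<mu> - of_real (alpha0 p / 2)))"
  let ?q = "\<lambda>t::real. qpow ((\<mu> - of_real (alpha0 p / 2))\<^sup>2 / 2) (\<i> * of_real t)"
  have k: "2 * pi * real p > 0" using p by simp
  have "(?q \<longlongrightarrow> exp (2 * of_real pi * \<i> * ((\<mu> - of_real (alpha0 p / 2))\<^sup>2 / 2) * (\<i> * of_real 0))) (at_right 0)"
    unfolding qpow_def by (intro tendsto_intros)
  hence q: "(?q \<longlongrightarrow> 1) (at_right 0)" by simp
  have l: "((\<lambda>t. 1 / singlet_num p z 1 1 (2 * pi * real p * t)) \<longlongrightarrow> L) (at_right 0)"
    using L tendsto_rescale_at_right_0[OF k, of "\<lambda>c. 1 / singlet_num p z 1 1 c"] by simp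
  have T: "((\<lambda>t. ?e * ?q t * (1 / singlet_num p z 1 1 (2 * pi * real p * t))) \<longlongrightarrow> ?e * 1 * L) (at_right 0)"
    by (intro tendsto_mult tendsto_const q l)
  have "\<forall>\<^sub>F t::real in at_right 0. t > 0" by (rule eventually_at_right_less)
  hence E: "\<forall>\<^sub>F t::real in at_right 0. ?e * ?q t * (1 / singlet_num p z 1 1 (2 * pi * real p * t)) = ch_F p \<epsilon> \<mu> (\<i> * of_real t) / ch_M p \<epsilon> 1 1 (\<i> * of_real t)"
    by eventually_elim (simp add: ch_M_conv[OF p] \<epsilon>_def dedekind_eta_nonzero ch_F_def)
  show ?thesis
    using Lim_transform_eventually[OF T E] M unfolding has_qdim_def \<epsilon>_def by simp
qed

lemma exp_pi_i_int: "exp (of_real pi * \<i> * of_int n) = of_real ((- 1) powi n)"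
proof (cases "even n")
  case True
  then obtain j where j: "n = 2 * j" by blast
  have "of_real pi * \<i> * of_int n = \<i> * (of_int j * (of_real pi * 2))" by (simp add: j)
  thus ?thesis using True by (simp only: exp_2pi_1_int) simp
next
  case False
  then obtain j where j: "n = 2 * j + 1" using oddE by blast
  have "of_real pi * \<i> * of_int n = \<i> * (of_int j * (of_real pi * 2)) + \<i> * of_real pi" by (simp add: j algebra_simps)
  thus ?thesis using False by (simp only: exp_add exp_2pi_1_int exp_pi_i') simp
qed

lemma singlet_coeff_eq:
  assumes p: "p > 0"
  shows "singlet_coeff p r s m = - 2 * \<i> * of_real ((- 1) powi (m * r) * sin (pi * of_int m * real s / real p))"
proof -
  define x where "x = pi * of_int m * real s / real p"
  have e: "exp (2 * of_real pi * \<i> * of_int m * of_real (1 - of_int r / 2 + y / (2 * real p)))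
     = of_real ((- 1) powi (m * r)) * exp (\<i> * of_real (pi * of_int m * y / real p))" for y :: real
  proof -
    have "2 * of_real pi * \<i> * of_int m * of_real (1 - of_int r / 2 + y / (2 * real p))
      = \<i> * (of_int m * (of_real pi * 2)) + of_real pi * \<i> * of_int (- (m * r)) + \<i> * of_real (pi * of_int m * y / real p)"
      using p by (simp add: field_simps)
    thus ?thesis by (simp only: exp_add exp_2pi_1_int exp_pi_i_int power_int_minus_one_minus mult_1)
  qed
  have e1: "1 - of_int r / 2 - real s / (2 * real p) = 1 - of_int r / 2 + (- real s) / (2 * real p)" by simp
  have x2: "pi * of_int m * (- real s) / real p = - x" by (simp add: x_def)
  have "singlet_coeff p r s m = of_real ((- 1) powi (m * r)) * (exp (\<i> * of_real (- x)) - exp (\<i> * of_real x))"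
    unfolding singlet_coeff_def theta_coeff_def e1 e x2 by (simp add: x_def right_diff_distrib)
  also have "exp (\<i> * of_real (- x)) - exp (\<i> * of_real x) = - 2 * \<i> * of_real (sin x)"
    by (simp add: cis_conv_exp[symmetric] complex_eq_iff flip: of_real_minus)
  finally show ?thesis by (simp add: x_def)
qed

lemma singlet_limit_eq:
  fixes z :: complex
  assumes p: "p > 0"
  shows "(exp (2 * of_real pi * z * of_real (1 - of_int r / 2 - real s / (2 * real p))) - exp (2 * of_real pi * z * of_real (1 - of_int r / 2 + real s / (2 * real p))))
     = - 2 * exp (of_real pi * z * (2 - of_int r)) * sinh (of_real pi * z * of_nat s / of_nat p)"
proof -
  have e: "exp (2 * of_real pi * z * of_real (1 - of_int r / 2 + y / (2 * real p)))
    = exp (of_real pi * z * (2 - of_int r)) * exp (of_real pi * z * of_real y / of_nat p)" for y :: real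
    unfolding exp_add[symmetric] using p by (intro arg_cong[where f = exp]) (simp add: field_simps)
  have e1: "1 - of_int r / 2 - real s / (2 * real p) = 1 - of_int r / 2 + (- real s) / (2 * real p)" by simp
  show ?thesis unfolding e1 e by (simp add: sinh_field_def algebra_simps)
qed

section \<open>Quotients of numerators\<close>

lemma singlet_num_tendsto:
  fixes z :: complex
  assumes p: "p > 0"
    and z: "Re z \<le> 0 \<and> exp (2 * of_real pi * z) \<noteq> 1 \<or>
            Re z > 0 \<and> (\<forall>m. singlet_coeff p r s m \<noteq> 0 \<longrightarrow> \<bar>Im z - of_int m\<bar> > Re z)"
  shows "(singlet_num p z r s \<longlongrightarrow> - 2 * exp (of_real pi * z * (2 - of_int r)) * sinh (of_real pi * z * of_nat s / of_nat p) / (1 - exp (2 * of_real pi * z))) (at_right 0)"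
  using z
proof (elim disjE conjE)
  assume *: "Re z \<le> 0" "exp (2 * of_real pi * z) \<noteq> 1"
  show ?thesis unfolding singlet_num_def[abs_def] singlet_limit_eq[OF p, symmetric] diff_divide_distrib
    by (intro tendsto_diff tendsto_half_theta *)
next
  assume *: "Re z > 0" "\<forall>m. singlet_coeff p r s m \<noteq> 0 \<longrightarrow> \<bar>Im z - of_int m\<bar> > Re z"
  show ?thesis unfolding singlet_num_def[abs_def] singlet_limit_eq[OF p, symmetric]
    by (rule half_theta_diff_tendsto) (use * in \<open>auto simp: singlet_coeff_def\<close>)
qed

text \<open>The premise on \<open>z\<close> concerns just the two characters of the quotient, the
  given one and the vacuum. Both limits share the divisor \<open>1 - X * X\<close>, which cancels in
  the first quotient and, divided by \<open>- 2 * X\<close>, becomes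
  \<open>sinh (of_real pi * z)\<close> in the second.\<close>

lemma singlet_ratio_generic:
  fixes z :: complex
  assumes p: "p > 0" and ne: "exp (2 * of_real pi * z) \<noteq> 1"
    and z: "\<And>r s. r = r0 \<and> s = s0 \<or> r = 1 \<and> s = 1 \<Longrightarrow> Re z \<le> 0 \<or>
            Re z > 0 \<and> (\<forall>m. singlet_coeff p r s m \<noteq> 0 \<longrightarrow> \<bar>Im z - of_int m\<bar> > Re z)"
  shows "((\<lambda>c. singlet_num p z r0 s0 c / singlet_num p z 1 1 c) \<longlongrightarrow>
       exp (of_real pi * z * (1 - of_int r0)) * sinh (of_real pi * z * of_nat s0 / of_nat p) / sinh (of_real pi * z / of_nat p)) (at_right 0)" (is ?A)
    and "((\<lambda>c. 1 / singlet_num p z 1 1 c) \<longlongrightarrow> sinh (of_real pi * z) / sinh (of_real pi * z / of_nat p)) (at_right 0)" (is ?B)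
proof -
  define X where "X = exp (of_real pi * z)"
  have X0: "X \<noteq> 0" by (simp add: X_def)
  have e2: "exp (2 * of_real pi * z) = X * X" unfolding X_def exp_add[symmetric] by (simp only: mult_2 distrib_right)
  \<comment> \<open>A zero of this \<open>sinh\<close> would make
    \<open>exp (of_real pi * z / of_nat p)\<close> equal to 1 or -1, but its power with exponent
    \<open>2 * p\<close> is \<open>exp (2 * of_real pi * z)\<close>.\<close>
  have sh: "sinh (of_real pi * z / of_nat p) \<noteq> 0"
  proof
    assume "sinh (of_real pi * z / of_nat p) = 0"
    hence "exp (of_real pi * z / of_nat p) \<in> {1, -1}" by (simp only: sinh_zero_iff)
    hence "exp (of_real pi * z / of_nat p) ^ (2 * p) = 1" by auto
    moreover have "of_nat (2 * p) * (of_real pi * z / of_nat p) = 2 * of_real pi * z" using p by simp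
    ultimately show False using ne by (simp only: exp_of_nat_mult[symmetric])
  qed
  have l: "(singlet_num p z r s \<longlongrightarrow> - 2 * exp (of_real pi * z * (2 - of_int r)) * sinh (of_real pi * z * of_nat s / of_nat p) / (1 - X * X)) (at_right 0)"
    if "r = r0 \<and> s = s0 \<or> r = 1 \<and> s = 1" for r s
    unfolding e2[symmetric] by (rule singlet_num_tendsto[OF p]) (use z[OF that] ne in auto)
  have ne': "1 - X * X \<noteq> 0" using ne unfolding e2 by auto
  have l1: "(singlet_num p z 1 1 \<longlongrightarrow> - 2 * X * sinh (of_real pi * z / of_nat p) / (1 - X * X)) (at_right 0)"
    using l[of 1 1] by (simp add: X_def)
  have l0: "(singlet_num p z r0 s0 \<longlongrightarrow> - 2 * (X * exp (of_real pi * z * (1 - of_int r0))) * sinh (of_real pi * z * of_nat s0 / of_nat p) / (1 - X * X)) (at_right 0)"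
  proof -
    have "exp (of_real pi * z * (2 - of_int r0)) = X * exp (of_real pi * z * (1 - of_int r0))"
      unfolding X_def exp_add[symmetric] by (simp add: algebra_simps)
    thus ?thesis using l[of r0 s0] by simp
  qed
  have d: "- 2 * X * sinh (of_real pi * z / of_nat p) / (1 - X * X) \<noteq> 0" using X0 sh ne' by simp
  have "- 2 * (X * E) * S / (1 - X * X) / (- 2 * X * S' / (1 - X * X)) = E * S / S'" if "S' \<noteq> 0" for E S S'
    using X0 ne' that by (simp add: field_simps)
  from tendsto_divide[OF l0 l1 d, unfolded this[OF sh]] show ?A .
  have e: "1 / (- 2 * X * S' / (1 - X * X)) = ((X - inverse X) / 2) / S'" if "S' \<noteq> 0" for S'
    using X0 ne' that by (simp add: field_simps)
  have s: "sinh (of_real pi * z) = (X - inverse X) / 2"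
    by (simp add: X_def sinh_field_def exp_minus)
  from tendsto_divide[OF tendsto_const l1 d, of 1] show ?B unfolding s e[OF sh] .
qed

lemma singlet_num_dominant:
  fixes z :: complex
  assumes z: "Re z > 0" and d: "0 \<le> d" "d \<le> Re z" and A: "finite A"
    and far: "\<And>m. m \<notin> A \<Longrightarrow> singlet_coeff p r s m \<noteq> 0 \<Longrightarrow> \<bar>Im z - of_int m\<bar> > d"
  shows "((\<lambda>c. singlet_num p z r s c / (theta_scale c * of_real (exp (pi\<^sup>2 * ((Re z)\<^sup>2 - d\<^sup>2) / c))) -
     (\<Sum>m\<in>A. singlet_coeff p r s m * (dual_term z c m / of_real (exp (pi\<^sup>2 * ((Re z)\<^sup>2 - d\<^sup>2) / c))))) \<longlongrightarrow> 0) (at_right 0)"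
  unfolding singlet_num_def singlet_coeff_def
  by (rule half_theta_diff_dominant[OF z d A]) (use far in \<open>simp add: singlet_coeff_def\<close>)

text \<open>The normalised numerators need not converge: the dominant term carries a unimodular
  phase \<open>P\<close>, which rotates ever faster as \<open>c\<close> decreases unless
  \<open>Im z = of_int m0\<close>. The phase is common to both characters and cancels.\<close>

lemma singlet_ratio_single:
  fixes z :: complex
  assumes z: "Re z > 0" and m0: "\<bar>Im z - of_int m0\<bar> \<le> Re z"
    and far: "\<And>r s m. r = r0 \<and> s = s0 \<or> r = 1 \<and> s = 1 \<Longrightarrow> m \<noteq> m0 \<Longrightarrow> singlet_coeff p r s m \<noteq> 0 \<Longrightarrow> \<bar>Im z - of_int m\<bar> > \<bar>Im z - of_int m0\<bar>"
    and nz: "singlet_coeff p 1 1 m0 \<noteq> 0"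
  shows "((\<lambda>c. singlet_num p z r0 s0 c / singlet_num p z 1 1 c) \<longlongrightarrow> singlet_coeff p r0 s0 m0 / singlet_coeff p 1 1 m0) (at_right 0)" (is ?A)
    and "((\<lambda>c. 1 / singlet_num p z 1 1 c) \<longlongrightarrow> 0) (at_right 0)" (is ?B)
proof -
  let ?N = "\<lambda>c. singlet_num p z r0 s0 c"
  let ?N1 = "\<lambda>c. singlet_num p z 1 1 c"
  define d where "d = \<bar>Im z - of_int m0\<bar>"
  define x where "x = pi\<^sup>2 * ((Re z)\<^sup>2 - d\<^sup>2)"
  define P where "P = (\<lambda>c. dual_term z c m0 / of_real (exp (x / c)))"
  define S where "S = (\<lambda>c. theta_scale c * of_real (exp (x / c)))"
  have "d\<^sup>2 \<le> (Re z)\<^sup>2" using m0 by (intro power_mono) (auto simp: d_def)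
  hence x: "x \<ge> 0" by (simp add: x_def)
  have nP: "norm (P c) = 1" for c
    unfolding P_def norm_divide norm_dual_term by (simp add: x_def d_def)
  have P0: "P c \<noteq> 0" for c using nP[of c] by auto
  have Sinf: "filterlim S at_infinity (at_right 0)" unfolding S_def by (rule filterlim_theta_scale_exp[OF x])
  have S0: "\<forall>\<^sub>F c in at_right 0. S c \<noteq> 0" using Sinf by (rule filterlim_at_infinity_imp_eventually_ne)
  have lim: "((\<lambda>c. singlet_num p z r s c / S c / P c) \<longlongrightarrow> singlet_coeff p r s m0) (at_right 0)"
    if "r = r0 \<and> s = s0 \<or> r = 1 \<and> s = 1" for r s
  proof -
    have "((\<lambda>c. singlet_num p z r s c / S c - singlet_coeff p r s m0 * P c) \<longlongrightarrow> 0) (at_right 0)"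
      using singlet_num_dominant[OF z, of d "{m0}" p r s] far[OF that] m0
      unfolding S_def P_def x_def by (simp add: d_def)
    hence "((\<lambda>c. norm (singlet_num p z r s c / S c - singlet_coeff p r s m0 * P c)) \<longlongrightarrow> 0) (at_right 0)"
      by (rule tendsto_norm_zero)
    also have "(\<lambda>c. norm (singlet_num p z r s c / S c - singlet_coeff p r s m0 * P c)) = (\<lambda>c. norm (singlet_num p z r s c / S c / P c - singlet_coeff p r s m0))"
    proof
      fix c
      have "singlet_num p z r s c / S c / P c - singlet_coeff p r s m0 = (singlet_num p z r s c / S c - singlet_coeff p r s m0 * P c) / P c"
        using P0[of c] by (simp add: diff_divide_distrib)
      thus "norm (singlet_num p z r s c / S c - singlet_coeff p r s m0 * P c) = norm (singlet_num p z r s c / S c / P c - singlet_coeff p r s m0)"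
        by (simp only: norm_divide nP div_by_1)
    qed
    finally show ?thesis by (simp add: tendsto_norm_zero_iff LIM_zero_iff)
  qed
  show ?A
  proof (rule Lim_transform_eventually)
    show "((\<lambda>c. (?N c / S c / P c) / (?N1 c / S c / P c)) \<longlongrightarrow> singlet_coeff p r0 s0 m0 / singlet_coeff p 1 1 m0) (at_right 0)"
      by (intro tendsto_divide lim nz) auto
    show "\<forall>\<^sub>F c in at_right 0. (?N c / S c / P c) / (?N1 c / S c / P c) = ?N c / ?N1 c"
      using S0 by eventually_elim (simp add: P0)
  qed
  have SP: "((\<lambda>c. 1 / S c / P c) \<longlongrightarrow> 0) (at_right 0)"
  proof -
    have "((\<lambda>c. 1 / S c) \<longlongrightarrow> 0) (at_right 0)" by (rule tendsto_divide_0[OF tendsto_const Sinf])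
    hence "((\<lambda>c. norm (1 / S c)) \<longlongrightarrow> 0) (at_right 0)" by (rule tendsto_norm_zero)
    moreover have "norm (1 / S c / P c) = norm (1 / S c)" for c
      by (simp only: norm_divide nP div_by_1)
    ultimately have "((\<lambda>c. norm (1 / S c / P c)) \<longlongrightarrow> 0) (at_right 0)" by (simp only:)
    thus ?thesis by (simp only: tendsto_norm_zero_iff)
  qed
  show ?B
  proof (rule Lim_transform_eventually)
    have "((\<lambda>c. (1 / S c / P c) / (?N1 c / S c / P c)) \<longlongrightarrow> 0 / singlet_coeff p 1 1 m0) (at_right 0)"
      by (intro tendsto_divide lim nz SP) auto
    thus "((\<lambda>c. (1 / S c / P c) / (?N1 c / S c / P c)) \<longlongrightarrow> 0) (at_right 0)" by simp
    show "\<forall>\<^sub>F c in at_right 0. (1 / S c / P c) / (?N1 c / S c / P c) = 1 / ?N1 c"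
      using S0 by eventually_elim (simp add: P0)
  qed
qed

text \<open>\<open>k\<close> and \<open>k + 1\<close> are both at distance 1/2, on opposite sides.
  The imaginary part of \<open>(Re z + \<i> * \<sigma>)\<^sup>2\<close> is
  \<open>2 * \<sigma> * Re z\<close>, so \<open>\<sigma> = 1/2\<close> and
  \<open>\<sigma> = - 1/2\<close> give conjugate phases.\<close>

lemma singlet_ratio_double_asymp:
  fixes z :: complex
  assumes z: "Re z \<ge> 1 / 2" and v: "Im z = of_int k + 1 / 2"
  shows "((\<lambda>c. singlet_num p z r s c / (theta_scale c * of_real (exp (pi\<^sup>2 * ((Re z)\<^sup>2 - (1/2)\<^sup>2) / c))) -
     (singlet_coeff p r s k * cis (pi\<^sup>2 * Re z / c) + singlet_coeff p r s (k + 1) * cis (- (pi\<^sup>2 * Re z / c)))) \<longlongrightarrow> 0) (at_right 0)"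
proof -
  have far: "\<bar>Im z - of_int m\<bar> > 1 / 2" if "m \<notin> {k, k + 1}" for m
  proof -
    have "m \<le> k - 1 \<or> m \<ge> k + 2" using that by auto
    hence "real_of_int m \<le> of_int k - 1 \<or> real_of_int m \<ge> of_int k + 2" by linarith
    thus ?thesis unfolding v by linarith
  qed
  have e: "dual_term z c m / of_real (exp (pi\<^sup>2 * ((Re z)\<^sup>2 - (1/2)\<^sup>2) / c)) = cis (2 * \<sigma> * (pi\<^sup>2 * Re z / c))"
    if \<sigma>: "Im z - of_int m = \<sigma>" "\<sigma>\<^sup>2 = (1/2)\<^sup>2" for m \<sigma> c
  proof -
    have "z - \<i> * of_int m = Complex (Re z) \<sigma>" by (simp add: complex_eq_iff \<sigma>)
    hence "(z - \<i> * of_int m)\<^sup>2 = Complex ((Re z)\<^sup>2 - (1/2)\<^sup>2) (2 * \<sigma> * Re z)"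
      unfolding \<sigma>(2)[symmetric] by (simp add: complex_eq_iff power2_eq_square)
    hence "of_real (pi\<^sup>2 / c) * (z - \<i> * of_int m)\<^sup>2 = of_real (pi\<^sup>2 * ((Re z)\<^sup>2 - (1/2)\<^sup>2) / c) + \<i> * of_real (2 * \<sigma> * (pi\<^sup>2 * Re z / c))"
      by (simp only:) (simp add: complex_eq_iff)
    thus ?thesis by (simp only: exp_add exp_of_real cis_conv_exp) simp
  qed
  have "((\<lambda>c. singlet_num p z r s c / (theta_scale c * of_real (exp (pi\<^sup>2 * ((Re z)\<^sup>2 - (1/2)\<^sup>2) / c))) -
     (\<Sum>m\<in>{k, k + 1}. singlet_coeff p r s m * (dual_term z c m / of_real (exp (pi\<^sup>2 * ((Re z)\<^sup>2 - (1/2)\<^sup>2) / c))))) \<longlongrightarrow> 0) (at_right 0)"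
    using z far by (intro singlet_num_dominant) auto
  moreover have "dual_term z c k / of_real (exp (pi\<^sup>2 * ((Re z)\<^sup>2 - (1/2)\<^sup>2) / c)) = cis (pi\<^sup>2 * Re z / c)" for c
    using e[of k "1/2" c] by (simp add: v)
  moreover have "dual_term z c (k + 1) / of_real (exp (pi\<^sup>2 * ((Re z)\<^sup>2 - (1/2)\<^sup>2) / c)) = cis (- (pi\<^sup>2 * Re z / c))" for c
    using e[of "k + 1" "- (1/2)" c] by (simp add: v)
  moreover have "sum f {k, k + 1} = f k + f (k + 1)" for f :: "int \<Rightarrow> complex" by simp
  ultimately show ?thesis by (simp only:)
qed

text \<open>Along \<open>c n = w / (\<phi> + 2 * pi * real n)\<close> the expression is constant, so
  it vanishes at every phase \<open>\<phi> > 0\<close>. The full turn gives \<open>X + Y = 0\<close>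
  and the quarter turn \<open>X = Y\<close>.\<close>

lemma oscillation_tendsto_0_imp:
  fixes X Y :: complex and w :: real
  assumes w: "w > 0" and lim: "((\<lambda>c. X * cis (w / c) + Y * cis (- (w / c))) \<longlongrightarrow> 0) (at_right 0)"
  shows "X = 0 \<and> Y = 0"
proof -
  have key: "X * cis \<phi> + Y * cis (- \<phi>) = 0" if \<phi>: "\<phi> > 0" for \<phi>
  proof -
    define c where "c = (\<lambda>n::nat. w / (\<phi> + 2 * pi * real n))"
    have pos: "\<phi> + 2 * pi * real n > 0" for n using \<phi> by (simp add: add_pos_nonneg)
    have top: "filterlim (\<lambda>n. \<phi> + 2 * pi * real n) at_top sequentially"
      by (intro filterlim_tendsto_add_at_top[OF tendsto_const] filterlim_tendsto_pos_mult_at_top[OF tendsto_const _ filterlim_real_sequentially]) simp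
    have "c \<longlonglongrightarrow> 0" unfolding c_def
      by (rule tendsto_divide_0[OF tendsto_const filterlim_at_top_imp_at_infinity[OF top]])
    moreover have "c n > 0" for n unfolding c_def by (intro divide_pos_pos w pos)
    ultimately have "filterlim c (at_right 0) sequentially"
      unfolding filterlim_at by (auto intro!: always_eventually simp: less_imp_neq[symmetric])
    from filterlim_compose[OF lim this]
    have "(\<lambda>n. X * cis (w / c n) + Y * cis (- (w / c n))) \<longlonglongrightarrow> 0" .
    moreover have "cis (w / c n) = cis \<phi>" "cis (- (w / c n)) = cis (- \<phi>)" for n
    proof -
      have "w / c n = \<phi> + 2 * pi * real n" using w pos[of n] by (simp add: c_def)
      moreover have "cis (2 * pi * real n) = 1" by (simp add: cis_multiple_2pi)
      ultimately show "cis (w / c n) = cis \<phi>" by (simp add: cis_mult[symmetric])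
      thus "cis (- (w / c n)) = cis (- \<phi>)" by (metis cis_cnj)
    qed
    ultimately have "(\<lambda>n::nat. X * cis \<phi> + Y * cis (- \<phi>)) \<longlonglongrightarrow> 0" by simp
    thus ?thesis by (simp add: LIMSEQ_const_iff)
  qed
  have 1: "X + Y = 0" using key[of "2 * pi"] by (simp add: cis_cnj[symmetric])
  have "X * \<i> - Y * \<i> = 0" using key[of "pi / 2"] by simp
  hence "X = Y" by (simp add: left_diff_distrib[symmetric])
  with 1 show ?thesis by simp
qed

text \<open>Unequal moduli keep the leading part \<open>V 1 1\<close> of the denominator at distance
  \<open>\<eta>\<close> from 0 at every phase. Convergence to \<open>L\<close> then means that
  \<open>V r s - L * V 1 1\<close> tends to 0, and an oscillation of this shape does so only when
  both its coefficients are 0.\<close>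

lemma singlet_ratio_double:
  fixes z :: complex
  assumes z: "Re z \<ge> 1 / 2" and v: "Im z = of_int k + 1 / 2"
    and ne: "norm (singlet_coeff p 1 1 k) \<noteq> norm (singlet_coeff p 1 1 (k + 1))"
  shows "((\<lambda>c. 1 / singlet_num p z 1 1 c) \<longlongrightarrow> 0) (at_right 0)" (is ?A)
    and "((\<lambda>c. singlet_num p z r s c / singlet_num p z 1 1 c) \<longlongrightarrow> L) (at_right 0) \<longleftrightarrow>
       singlet_coeff p r s k = L * singlet_coeff p 1 1 k \<and> singlet_coeff p r s (k + 1) = L * singlet_coeff p 1 1 (k + 1)" (is "?B \<longleftrightarrow> ?C")
proof -
  let ?q = "\<lambda>c. singlet_num p z r s c / singlet_num p z 1 1 c" and ?c0 = "singlet_coeff p r s k" and ?c1 = "singlet_coeff p r s (k + 1)"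
    and ?d0 = "singlet_coeff p 1 1 k" and ?d1 = "singlet_coeff p 1 1 (k + 1)"
  define x where "x = pi\<^sup>2 * ((Re z)\<^sup>2 - (1/2)\<^sup>2)"
  define S where "S = (\<lambda>c. theta_scale c * of_real (exp (x / c)))"
  define w where "w = pi\<^sup>2 * Re z"
  have w: "w > 0" using z by (simp add: w_def)
  define V where "V = (\<lambda>r s c. singlet_coeff p r s k * cis (w / c) + singlet_coeff p r s (k + 1) * cis (- (w / c)))"
  define Q where "Q = (\<lambda>r s c. singlet_num p z r s c / S c)"
  have "(1/2)\<^sup>2 \<le> (Re z)\<^sup>2" using z by (intro power_mono) auto
  hence x: "x \<ge> 0" by (simp add: x_def)
  have Sinf: "filterlim S at_infinity (at_right 0)" unfolding S_def by (rule filterlim_theta_scale_exp[OF x])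
  have S0: "\<forall>\<^sub>F c in at_right 0. S c \<noteq> 0" using Sinf by (rule filterlim_at_infinity_imp_eventually_ne)
  have lim: "((\<lambda>c. Q r s c - V r s c) \<longlongrightarrow> 0) (at_right 0)" for r s
    unfolding Q_def V_def S_def x_def w_def by (rule singlet_ratio_double_asymp[OF z v])
  define \<eta> where "\<eta> = \<bar>norm (?d0) - norm (?d1)\<bar>"
  have \<eta>: "\<eta> > 0" using ne by (simp add: \<eta>_def)
  have V: "norm (V 1 1 c) \<ge> \<eta>" for c
  proof -
    have "\<bar>norm (?d0 * cis (w / c)) - norm (- (?d1 * cis (- (w / c))))\<bar> \<le> norm (V 1 1 c)"
      unfolding V_def using norm_triangle_ineq3[of "?d0 * cis (w / c)" "- (?d1 * cis (- (w / c)))"] by simp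
    thus ?thesis by (simp add: \<eta>_def norm_mult)
  qed
  have Q: "\<forall>\<^sub>F c in at_right 0. norm (Q 1 1 c) \<ge> \<eta> / 2"
  proof -
    have "\<forall>\<^sub>F c in at_right 0. norm (Q 1 1 c - V 1 1 c) < \<eta> / 2"
      using order_tendstoD(2)[OF tendsto_norm_zero[OF lim[of 1 1]], of "\<eta> / 2"] \<eta> by simp
    thus ?thesis
    proof eventually_elim
      case (elim c)
      have "norm (V 1 1 c) \<le> norm (Q 1 1 c) + norm (Q 1 1 c - V 1 1 c)"
        using norm_triangle_sub[of "V 1 1 c" "Q 1 1 c"] by (simp add: norm_minus_commute)
      thus ?case using elim V[of c] by linarith
    qed
  qed
  have div0: "((\<lambda>c. f c / Q 1 1 c) \<longlongrightarrow> 0) (at_right 0)" if f: "(f \<longlongrightarrow> 0) (at_right 0)" for f :: "real \<Rightarrow> complex"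
  proof (rule Lim_null_comparison)
    have "((\<lambda>c. norm (f c) * (2 / \<eta>)) \<longlongrightarrow> 0 * (2 / \<eta>)) (at_right 0)"
      by (intro tendsto_mult tendsto_norm_zero f tendsto_const)
    thus "((\<lambda>c. norm (f c) * (2 / \<eta>)) \<longlongrightarrow> 0) (at_right 0)" by simp
    show "\<forall>\<^sub>F c in at_right 0. norm (f c / Q 1 1 c) \<le> norm (f c) * (2 / \<eta>)"
      using Q
    proof eventually_elim
      case (elim c)
      have "norm (f c) / norm (Q 1 1 c) \<le> norm (f c) / (\<eta> / 2)"
        using elim \<eta> by (intro divide_left_mono mult_pos_pos) auto
      thus ?case by (simp add: norm_divide)
    qed
  qed
  show ?A
  proof (rule Lim_transform_eventually)
    show "((\<lambda>c. (1 / S c) / Q 1 1 c) \<longlongrightarrow> 0) (at_right 0)"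
      by (intro div0 tendsto_divide_0[OF tendsto_const Sinf])
    show "\<forall>\<^sub>F c in at_right 0. (1 / S c) / Q 1 1 c = 1 / singlet_num p z 1 1 c"
      using S0 by eventually_elim (simp add: Q_def)
  qed
  show "?B \<longleftrightarrow> ?C"
  proof
    assume C: ?C
    have "V r s c = L * V 1 1 c" for c using C by (simp add: V_def algebra_simps)
    hence eq: "Q r s c - L * Q 1 1 c = (Q r s c - V r s c) - L * (Q 1 1 c - V 1 1 c)" for c by (simp add: algebra_simps)
    have "((\<lambda>c. Q r s c - L * Q 1 1 c) \<longlongrightarrow> 0 - L * 0) (at_right 0)"
      unfolding eq by (intro tendsto_intros lim)
    hence "((\<lambda>c. (Q r s c - L * Q 1 1 c) / Q 1 1 c) \<longlongrightarrow> 0) (at_right 0)" by (intro div0) simp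
    hence T: "((\<lambda>c. (Q r s c - L * Q 1 1 c) / Q 1 1 c + L) \<longlongrightarrow> 0 + L) (at_right 0)" by (intro tendsto_intros)
    have E: "\<forall>\<^sub>F c in at_right 0. (Q r s c - L * Q 1 1 c) / Q 1 1 c + L = ?q c"
      using S0 Q
    proof eventually_elim
      case (elim c)
      hence "Q 1 1 c \<noteq> 0" using \<eta> by auto
      hence "(Q r s c - L * Q 1 1 c) / Q 1 1 c + L = Q r s c / Q 1 1 c" by (simp add: field_simps)
      thus ?case using elim by (simp add: Q_def)
    qed
    show ?B using Lim_transform_eventually[OF T E] by simp
  next
    assume B: ?B
    have bnd: "norm (V 1 1 c) \<le> norm (?d0) + norm (?d1)" for c
      unfolding V_def by (rule order_trans[OF norm_triangle_ineq]) (simp add: norm_mult)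
    have Z: "((\<lambda>c. ?q c - L) \<longlongrightarrow> 0) (at_right 0)"
      using B by (simp add: LIM_zero_iff)
    have B0: "((\<lambda>c. (?q c - L) * V 1 1 c) \<longlongrightarrow> 0) (at_right 0)"
    proof (rule Lim_null_comparison)
      show "((\<lambda>c. norm (?q c - L) * (norm (?d0) + norm (?d1))) \<longlongrightarrow> 0) (at_right 0)"
        by (rule tendsto_mult_left_zero[OF tendsto_norm_zero[OF Z]])
      show "\<forall>\<^sub>F c in at_right 0. norm ((?q c - L) * V 1 1 c) \<le> norm (?q c - L) * (norm (?d0) + norm (?d1))"
        unfolding norm_mult by (rule always_eventually, rule allI, rule mult_left_mono[OF bnd norm_ge_zero])
    qed
    \<comment> \<open>Since \<open>?q c * Q 1 1 c = Q r s c\<close>, this sum is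
      \<open>V r s c - L * V 1 1 c\<close>, arranged so that every summand visibly tends to
      0.\<close>
    have T: "((\<lambda>c. (?q c - L) * (Q 1 1 c - V 1 1 c) + (?q c - L) * V 1 1 c
        - (Q r s c - V r s c) + L * (Q 1 1 c - V 1 1 c)) \<longlongrightarrow> (L - L) * 0 + 0 - 0 + L * 0) (at_right 0)"
      by (intro tendsto_intros B B0 lim)
    have E: "\<forall>\<^sub>F c in at_right 0. (?q c - L) * (Q 1 1 c - V 1 1 c) + (?q c - L) * V 1 1 c
        - (Q r s c - V r s c) + L * (Q 1 1 c - V 1 1 c) =
       (?c0 - L * ?d0) * cis (w / c) + (?c1 - L * ?d1) * cis (- (w / c))"
      using S0 Q
    proof eventually_elim
      case (elim c)
      hence "singlet_num p z 1 1 c \<noteq> 0" using \<eta> by (auto simp: Q_def)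
      hence q: "?q c * Q 1 1 c = Q r s c" by (simp add: Q_def)
      have "(q - L) * (Q1 - V1) + (q - L) * V1 - (Qr - Vr) + L * (Q1 - V1) = Vr - L * V1" if "q * Q1 = Qr" for q Q1 V1 Qr Vr :: complex
        unfolding that[symmetric] by (simp add: algebra_simps)
      note this[OF q, of "V 1 1 c" "V r s c"]
      moreover have "V r s c - L * V 1 1 c = (?c0 - L * ?d0) * cis (w / c) + (?c1 - L * ?d1) * cis (- (w / c))"
        by (simp add: V_def algebra_simps)
      ultimately show ?case by (rule trans)
    qed
    have "((\<lambda>c. (?c0 - L * ?d0) * cis (w / c) + (?c1 - L * ?d1) * cis (- (w / c))) \<longlongrightarrow> 0) (at_right 0)"
      using Lim_transform_eventually[OF T E] by simp
    from oscillation_tendsto_0_imp[OF w this] show ?C by simp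
  qed
qed

section \<open>Quantum dimensions\<close>

lemma sin_pi_rational_eq_0_iff:
  assumes p: "p > 0"
  shows "sin (pi * of_int m * real s / real p) = 0 \<longleftrightarrow> int p dvd m * int s"
proof -
  have "sin (pi * of_int m * real s / real p) = 0 \<longleftrightarrow> (\<exists>i::int. pi * of_int m * real s / real p = of_int i * pi)"
    by (rule sin_zero_iff_int2)
  also have "\<dots> \<longleftrightarrow> (\<exists>i::int. m * int s = int p * i)"
  proof (intro ex_cong1)
    fix i :: int
    have "pi * of_int m * real s / real p = of_int i * pi \<longleftrightarrow> pi * (of_int m * real s) = pi * (real p * of_int i)"
      using p by (simp add: divide_eq_eq mult_ac)
    also have "\<dots> \<longleftrightarrow> real_of_int (m * int s) = real_of_int (int p * i)" by simp
    finally show "pi * of_int m * real s / real p = of_int i * pi \<longleftrightarrow> m * int s = int p * i"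
      by (simp only: of_int_eq_iff)
  qed
  finally show ?thesis by (simp only: dvd_def)
qed

lemma singlet_coeff_eq_0_iff:
  assumes p: "p > 0"
  shows "singlet_coeff p r s m = 0 \<longleftrightarrow> int p dvd m * int s"
  unfolding singlet_coeff_eq[OF p] sin_pi_rational_eq_0_iff[OF p, symmetric] by simp

lemma minus_one_powi_add: "((- 1) powi (a + b) :: real) = (- 1) powi a * (- 1) powi b"
  by (simp add: power_int_add)

lemma singlet_coeff_ratio:
  assumes p: "p > 0"
  shows "singlet_coeff p r s m / singlet_coeff p 1 1 m =
    of_real ((- 1) powi (m * (r + 1)) * sin (pi * of_int m * real s / real p) / sin (pi * of_int m / real p))"
proof -
  have "(- 1) powi (m * r) / (- 1) powi m = ((- 1) powi (m * (r + 1)) :: real)"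
    by (auto simp: power_int_minus_left)
  hence "of_real ((- 1) powi (m * (r + 1)) * sin (pi * of_int m * real s / real p) / sin (pi * of_int m / real p))
    = (of_real ((- 1) powi (m * r) / (- 1) powi m * sin (pi * of_int m * real s / real p) / sin (pi * of_int m / real p)) :: complex)"
    by (simp only:)
  thus ?thesis unfolding singlet_coeff_eq[OF p] by simp
qed

lemma int_distance:
  fixes v\<^sub>0 :: real
  assumes "m \<noteq> k"
  shows "\<bar>v\<^sub>0 + of_int k - of_int m\<bar> \<ge> 1 - \<bar>v\<^sub>0\<bar>"
proof -
  have "\<bar>real_of_int (k - m)\<bar> \<ge> 1" using assms by linarith
  thus ?thesis by (simp add: abs_if split: if_splits)
qed

lemma sin_add_pi_int: "sin (x + pi * of_int n) = (- 1) powi n * sin x"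
proof -
  have "cis (pi * of_int n) = exp (of_real pi * \<i> * of_int n)"
    unfolding cis_conv_exp by (intro arg_cong[where f = exp]) simp
  also have "\<dots> = of_real ((- 1) powi n)" by (rule exp_pi_i_int)
  finally have e: "cis (pi * of_int n) = of_real ((- 1) powi n)" .
  have "cos (pi * of_int n) = (- 1) powi n" "sin (pi * of_int n) = 0"
    using arg_cong[OF e, of Re] arg_cong[OF e, of Im]
    by (simp_all only: cis.sel Re_complex_of_real Im_complex_of_real)
  thus ?thesis by (simp add: sin_add)
qed

lemma sin_pi_multiple_shift:
  assumes p: "p > 0" and \<sigma>: "\<sigma> \<in> {1, -1}"
  shows "sin (pi * of_int (int p * j + \<sigma>) * real s / real p) = (- 1) powi (j * int s) * (of_int \<sigma> * sin (pi * real s / real p))"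
proof -
  have "pi * of_int (int p * j + \<sigma>) * real s / real p = of_int \<sigma> * (pi * real s / real p) + pi * of_int (j * int s)"
    using p by (simp add: field_simps)
  also have "sin \<dots> = (- 1) powi (j * int s) * sin (of_int \<sigma> * (pi * real s / real p))"
    by (rule sin_add_pi_int)
  finally show ?thesis using \<sigma> by auto
qed

lemma singlet_ratio_imaginary_integer:
  assumes p: "p > 0" and k: "\<not> int p dvd k"
  shows "((\<lambda>c. singlet_num p (\<i> * of_int k) r s c / singlet_num p (\<i> * of_int k) 1 1 c) \<longlongrightarrow> singlet_coeff p r s k / singlet_coeff p 1 1 k) (at_right 0)"
    and "((\<lambda>c. 1 / singlet_num p (\<i> * of_int k) 1 1 c) \<longlongrightarrow> 0) (at_right 0)"
proof -
  let ?N = "singlet_num p (\<i> * of_int k)"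
  have nz: "singlet_coeff p 1 1 k \<noteq> 0" using k by (simp add: singlet_coeff_eq_0_iff[OF p])
  have l: "((\<lambda>c. ?N r s c / half_theta 0 0 c) \<longlongrightarrow> singlet_coeff p r s k) (at_right 0)" for r s
    unfolding singlet_num_def singlet_coeff_def by (rule tendsto_half_theta_diff_imaginary_integer)
  have ne: "\<forall>\<^sub>F c in at_right 0. half_theta 0 0 c \<noteq> 0"
    using filterlim_half_theta_0 by (rule filterlim_at_infinity_imp_eventually_ne)
  show "((\<lambda>c. ?N r s c / ?N 1 1 c) \<longlongrightarrow> singlet_coeff p r s k / singlet_coeff p 1 1 k) (at_right 0)"
  proof (rule Lim_transform_eventually[OF tendsto_divide[OF l l nz]])
    show "\<forall>\<^sub>F c in at_right 0. ?N r s c / half_theta 0 0 c / (?N 1 1 c / half_theta 0 0 c) = ?N r s c / ?N 1 1 c"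
      using ne by eventually_elim simp
  qed
  have i: "((\<lambda>c. 1 / half_theta 0 0 c) \<longlongrightarrow> 0) (at_right 0)"
    by (rule tendsto_divide_0[OF tendsto_const filterlim_half_theta_0])
  have "((\<lambda>c. 1 / ?N 1 1 c) \<longlongrightarrow> 0 / singlet_coeff p 1 1 k) (at_right 0)"
  proof (rule Lim_transform_eventually[OF tendsto_divide[OF i l nz]])
    show "\<forall>\<^sub>F c in at_right 0. 1 / half_theta 0 0 c / (?N 1 1 c / half_theta 0 0 c) = 1 / ?N 1 1 c"
      using ne by eventually_elim simp
  qed
  thus "((\<lambda>c. 1 / ?N 1 1 c) \<longlongrightarrow> 0) (at_right 0)" by simp
qed

text \<open>\<open>p\<close> divides \<open>k\<close>, so the coefficient of the divergent part
  vanishes. What remains is the difference \<open>s / p\<close> of the two shifts, times a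
  sign.\<close>

lemma singlet_num_imaginary_multiple:
  assumes p: "p > 0" and k: "k = int p * j"
  shows "(singlet_num p (\<i> * of_int k) r s \<longlongrightarrow> of_real ((- 1) powi (k * r + j * int s) * (real s / real p))) (at_right 0)"
proof -
  have z: "singlet_coeff p r s k = 0" unfolding singlet_coeff_eq_0_iff[OF p] k by simp
  have e: "exp (2 * of_real pi * \<i> * of_int k * of_real (1 - of_int r / 2 + real s / (2 * real p))) = of_real ((- 1) powi (k * r + j * int s))"
  proof -
    have "2 * of_real pi * \<i> * of_int k * of_real (1 - of_int r / 2 + real s / (2 * real p))
      = of_real pi * \<i> * of_int (2 * k - k * r + j * int s)"
      using p by (simp add: k field_simps)
    also have "exp \<dots> = of_real ((- 1) powi (2 * k - k * r + j * int s))" by (rule exp_pi_i_int)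
    also have "(- 1) powi (2 * k - k * r + j * int s) = ((- 1) powi (k * r + j * int s) :: real)"
      by (auto simp: power_int_minus_left)
    finally show ?thesis .
  qed
  have b: "(1 - of_int r / 2 + real s / (2 * real p)) - (1 - of_int r / 2 - real s / (2 * real p)) = real s / real p"
    by simp
  show ?thesis
    using tendsto_half_theta_diff_imaginary_integer_0[OF z[unfolded singlet_coeff_def]]
    unfolding e b singlet_num_def[abs_def] by simp
qed

text \<open>With \<open>\<alpha>\<close>, \<open>\<kappa>\<close> the arguments of the two tangents, both coefficients at the two dominant
  frequencies become \<open>sin (\<kappa> \<mp> \<alpha>)\<close> up to a common sign, which removes the case distinction on
  the parity of \<open>r\<close>.\<close>

lemma tan_condition_iff:
  fixes \<alpha> \<kappa> H K :: real
  assumes "cos H \<noteq> 0" "sin H \<noteq> 0" "cos K \<noteq> 0" "sin K \<noteq> 0" "cos \<alpha> \<noteq> 0" "sin \<alpha> \<noteq> 0"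
  shows "tan \<alpha> * tan H = tan \<kappa> * tan K \<longleftrightarrow> sin \<kappa> * cos \<alpha> * sin K * cos H = cos \<kappa> * sin \<alpha> * cos K * sin H"
proof (cases "cos \<kappa> = 0")
  \<comment> \<open>Here \<open>tan \<kappa>\<close> takes the default value 0, while the left
    product of tangents is nonzero. The polynomial identity fails as well, because
    \<open>sin \<kappa>\<close> is nonzero.\<close>
  case True
  hence "sin \<kappa> \<noteq> 0" using sin_cos_squared_add[of \<kappa>] by auto
  thus ?thesis using assms True by (simp add: tan_def)
next
  case False
  show ?thesis unfolding tan_def using assms False by (auto simp: field_simps)
qed

text \<open>The left side says that the determinant of the two coefficient pairs vanishes, common
  factors removed: the pair of \<open>M\<close> is \<open>sin (\<kappa> - \<alpha>)\<close>,
  \<open>sin (\<kappa> + \<alpha>)\<close>, that of the vacuum \<open>sin (K - H)\<close>,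
  \<open>- sin (K + H)\<close>.\<close>

lemma cross_product_iff:
  fixes \<alpha> \<kappa> H K :: real
  shows "sin (\<kappa> - \<alpha>) * sin (K + H) = - (sin (\<kappa> + \<alpha>) * sin (K - H)) \<longleftrightarrow>
     sin \<kappa> * cos \<alpha> * sin K * cos H = cos \<kappa> * sin \<alpha> * cos K * sin H"
proof -
  have "sin (\<kappa> - \<alpha>) * sin (K + H) + sin (\<kappa> + \<alpha>) * sin (K - H) = 2 * (sin \<kappa> * cos \<alpha> * sin K * cos H - cos \<kappa> * sin \<alpha> * cos K * sin H)"
    by (simp add: sin_add sin_diff algebra_simps)
  thus ?thesis unfolding eq_neg_iff_add_eq_0 by simp
qed

lemma singlet_coeff_half_angles:
  fixes s :: nat and r k :: int
  assumes p: "p > 0"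
  defines "\<alpha> \<equiv> pi * real s / (2 * real p) + pi * of_int r / 2"
    and "\<kappa> \<equiv> pi * of_int (2 * k + 1) * real s / (2 * real p) + pi * of_int r / 2"
  shows "singlet_coeff p r s k = - 2 * \<i> * of_real ((- 1) powi (k * r) * sin (\<kappa> - \<alpha>))"
    and "singlet_coeff p r s (k + 1) = - 2 * \<i> * of_real ((- 1) powi (k * r) * sin (\<kappa> + \<alpha>))"
proof -
  have 1: "pi * of_int k * real s / real p = \<kappa> - \<alpha>" using p by (simp add: \<kappa>_def \<alpha>_def field_simps)
  show "singlet_coeff p r s k = - 2 * \<i> * of_real ((- 1) powi (k * r) * sin (\<kappa> - \<alpha>))"
    unfolding singlet_coeff_eq[OF p] 1 ..
  \<comment> \<open>The full \<open>pi * r\<close> collected in \<open>\<kappa> + \<alpha>\<close>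
    supplies the sign \<open>(- 1) powi r\<close> by which the coefficient at \<open>k + 1\<close>
    differs from the common sign.\<close>
  have 2: "\<kappa> + \<alpha> = pi * of_int (k + 1) * real s / real p + pi * of_int r" using p by (simp add: \<kappa>_def \<alpha>_def field_simps)
  have "sin (\<kappa> + \<alpha>) = (- 1) powi r * sin (pi * of_int (k + 1) * real s / real p)"
    unfolding 2 by (rule sin_add_pi_int)
  hence "(- 1) powi (k * r) * sin (\<kappa> + \<alpha>) = (- 1) powi (k * r + r) * sin (pi * of_int (k + 1) * real s / real p)"
    unfolding minus_one_powi_add by simp
  also have "k * r + r = (k + 1) * r" by (simp add: algebra_simps)
  finally show "singlet_coeff p r s (k + 1) = - 2 * \<i> * of_real ((- 1) powi (k * r) * sin (\<kappa> + \<alpha>))"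
    unfolding singlet_coeff_eq[OF p] by simp
qed

section \<open>The dimensions in each range of parameters\<close>

lemma alpha0_half:
  assumes "p > 0"
  shows "alpha0 p / 2 = sqrt (real p / 2) - sqrt (1 / (2 * real p))"
proof -
  have "sqrt (2 * real p) / 2 = sqrt (2 * real p) / sqrt 4" by simp
  also have "\<dots> = sqrt (real p / 2)" unfolding real_sqrt_divide[symmetric] by simp
  finally have 1: "sqrt (2 * real p) / 2 = sqrt (real p / 2)" .
  have "sqrt (2 / real p) / 2 = sqrt (2 / real p) / sqrt 4" by simp
  also have "\<dots> = sqrt (1 / (2 * real p))" unfolding real_sqrt_divide[symmetric] by simp
  finally have 2: "sqrt (2 / real p) / 2 = sqrt (1 / (2 * real p))" .
  show ?thesis unfolding alpha0_def diff_divide_distrib 1 2 ..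
qed

text \<open>Integers divisible by \<open>p\<close> are left unconstrained: there the coefficient
  vanishes whatever \<open>s\<close> is, so such a frequency may even be the nearest one.\<close>

lemma qdim_generic:
  fixes p s :: nat and r :: int and \<mu> z :: complex
  assumes p: "p > 0" and ne: "exp (2 * of_real pi * z) \<noteq> 1"
    and z: "Re z \<le> 0 \<or> Re z > 0 \<and> (\<forall>m. \<not> int p dvd m \<longrightarrow> \<bar>Im z - of_int m\<bar> > Re z)"
    and \<epsilon>: "\<epsilon> = z / of_real (sqrt (2 * real p))"
  shows "has_qdim p \<epsilon> (ch_M p \<epsilon> r s)
            (exp (of_real pi * \<epsilon> * of_real (sqrt (2 * real p)) * (1 - of_int r))
              * sinh (of_real (sqrt 2 * pi * real s) * \<epsilon> / of_real (sqrt (real p)))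
              / sinh (of_real (sqrt 2 * pi) * \<epsilon> / of_real (sqrt (real p))))
        \<and> has_qdim p \<epsilon> (ch_F p \<epsilon> \<mu>)
            (exp (2 * of_real pi * \<epsilon>
                  * (\<mu> - of_real (sqrt (real p / 2)) + of_real (sqrt (1 / (2 * real p)))))
              * sinh (of_real (sqrt (2 * real p) * pi) * \<epsilon>)
              / sinh (of_real (sqrt 2 * pi) * \<epsilon> / of_real (sqrt (real p))))"
proof -
  define S where "S = complex_of_real (sqrt (2 * real p))"
  have S0: "S \<noteq> 0" using p by (simp add: S_def)
  have zS: "\<epsilon> * S = z" using S0 by (simp add: \<epsilon> S_def)
  have sq: "complex_of_real (sqrt 2) * \<epsilon> / of_real (sqrt (real p)) = z / of_nat p"
  proof -
    have pp: "of_real (sqrt (real p)) * of_real (sqrt (real p)) = (of_nat p :: complex)"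
      unfolding of_real_mult[symmetric] by simp
    have "complex_of_real (sqrt 2) * \<epsilon> / of_real (sqrt (real p)) = z / (of_real (sqrt (real p)) * of_real (sqrt (real p)))"
      unfolding \<epsilon> real_sqrt_mult by simp
    thus ?thesis unfolding pp .
  qed
  have e1: "of_real pi * \<epsilon> * of_real (sqrt (2 * real p)) * (1 - of_int r) = of_real pi * z * (1 - of_int r)"
    unfolding S_def[symmetric] zS[symmetric] by simp
  have e2: "of_real (sqrt 2 * pi * real s) * \<epsilon> / of_real (sqrt (real p)) = of_real pi * z * of_nat s / of_nat p"
    using arg_cong[OF sq, of "\<lambda>x. of_real pi * of_nat s * x"] by (simp add: mult_ac)
  have e3: "of_real (sqrt 2 * pi) * \<epsilon> / of_real (sqrt (real p)) = of_real pi * z / of_nat p"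
    using arg_cong[OF sq, of "\<lambda>x. of_real pi * x"] by (simp add: mult_ac)
  have e4: "of_real (sqrt (2 * real p) * pi) * \<epsilon> = of_real pi * z"
    unfolding zS[symmetric] S_def by simp
  have far: "Re z \<le> 0 \<or> Re z > 0 \<and> (\<forall>m. singlet_coeff p r' s' m \<noteq> 0 \<longrightarrow> \<bar>Im z - of_int m\<bar> > Re z)" for r' s'
    using z dvd_mult2[of "int p"] unfolding singlet_coeff_eq_0_iff[OF p] by blast
  have L: "((\<lambda>c. singlet_num p z r s c / singlet_num p z 1 1 c) \<longlongrightarrow>
       exp (of_real pi * z * (1 - of_int r)) * sinh (of_real pi * z * of_nat s / of_nat p) / sinh (of_real pi * z / of_nat p)) (at_right 0)"
    "((\<lambda>c. 1 / singlet_num p z 1 1 c) \<longlongrightarrow> sinh (of_real pi * z) / sinh (of_real pi * z / of_nat p)) (at_right 0)"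
    using singlet_ratio_generic[OF p ne, of r s] far by blast+
  have m: "\<mu> - of_real (sqrt (real p / 2)) + of_real (sqrt (1 / (2 * real p))) = \<mu> - of_real (alpha0 p / 2)"
    unfolding alpha0_half[OF p] by simp
  have F: "has_qdim p \<epsilon> (ch_F p \<epsilon> \<mu>)
            (exp (2 * of_real pi * \<epsilon> * (\<mu> - of_real (sqrt (real p / 2)) + of_real (sqrt (1 / (2 * real p)))))
              * sinh (of_real pi * z) / sinh (of_real pi * z / of_nat p))"
    unfolding \<epsilon> m by (rule has_qdim_F[OF p L(2)]) simp
  show ?thesis unfolding e1 e2 e3 e4 using F L(1) has_qdim_M_iff[OF p, of z r s] unfolding \<epsilon> by simp
qed

lemma qdim_from_ratio:
  fixes p s :: nat and r :: int and \<mu> z :: complex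
  assumes p: "p > 0" and \<epsilon>: "\<epsilon> = z / of_real (sqrt (2 * real p))"
    and M: "((\<lambda>c. singlet_num p z r s c / singlet_num p z 1 1 c) \<longlongrightarrow> L) (at_right 0)"
    and F: "((\<lambda>c. 1 / singlet_num p z 1 1 c) \<longlongrightarrow> 0) (at_right 0)"
  shows "has_qdim p \<epsilon> (ch_M p \<epsilon> r s) L \<and> has_qdim p \<epsilon> (ch_F p \<epsilon> \<mu>) 0"
  using M has_qdim_M_iff[OF p, of z r s L] has_qdim_F[OF p F, of 0 \<mu>] unfolding \<epsilon> by simp

text \<open>\<open>\<bar>v\<^sub>0\<bar> < 1 / 2\<close> makes \<open>k\<close> the unique nearest
  integer, and its vacuum coefficient is nonzero because \<open>p\<close> does not divide
  \<open>k\<close>.\<close>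

lemma qdim_nearest:
  fixes p s :: nat and r k :: int and \<mu> z :: complex
  assumes p: "p > 0" and \<epsilon>: "\<epsilon> = z / of_real (sqrt (2 * real p))"
    and z: "Re z > 0" "Im z = v\<^sub>0 + of_int k" "\<bar>v\<^sub>0\<bar> \<le> Re z" "\<bar>v\<^sub>0\<bar> < 1 / 2" and k: "\<not> int p dvd k"
  shows "has_qdim p \<epsilon> (ch_M p \<epsilon> r s)
            (of_real ((- 1) powi (k * (r + 1)) * sin (pi * of_int k * real s / real p) / sin (pi * of_int k / real p)))
        \<and> has_qdim p \<epsilon> (ch_F p \<epsilon> \<mu>) 0"
proof -
  have far: "\<bar>Im z - of_int m\<bar> > \<bar>Im z - of_int k\<bar>" if "m \<noteq> k" for m
    using int_distance[OF that, of v\<^sub>0] z by simp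
  have nz: "singlet_coeff p 1 1 k \<noteq> 0" using k by (simp add: singlet_coeff_eq_0_iff[OF p])
  have m0: "\<bar>Im z - of_int k\<bar> \<le> Re z" using z by simp
  show ?thesis
    using qdim_from_ratio[OF p \<epsilon> singlet_ratio_single[OF z(1) m0 far nz]]
    unfolding singlet_coeff_ratio[OF p] .
qed

text \<open>The nearest frequency \<open>k\<close> is a multiple of \<open>p\<close> and has
  coefficient 0, so its neighbour on the side of \<open>v\<^sub>0\<close> takes over, at distance
  \<open>1 - \<bar>v\<^sub>0\<bar>\<close>. The division by \<open>p\<close> in the exponent is
  exact.\<close>

lemma qdim_second_nearest:
  fixes p s :: nat and r k :: int and \<mu> z :: complex
  assumes p: "p \<ge> 2" and \<epsilon>: "\<epsilon> = z / of_real (sqrt (2 * real p))"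
    and z: "Re z > 0" "Im z = v\<^sub>0 + of_int k" "1 - \<bar>v\<^sub>0\<bar> \<le> Re z" "\<bar>v\<^sub>0\<bar> < 1 / 2" "v\<^sub>0 \<noteq> 0" and k: "int p dvd k"
  shows "has_qdim p \<epsilon> (ch_M p \<epsilon> r s)
            (of_real ((- 1) powi ((r + 1) * (k + 1) + (k * (int s + 1)) div int p)
              * sin (pi * real s / real p) / sin (pi / real p)))
        \<and> has_qdim p \<epsilon> (ch_F p \<epsilon> \<mu>) 0"
proof -
  have p0: "p > 0" using p by simp
  obtain j where j: "k = int p * j" using k by blast
  define \<sigma> :: int where "\<sigma> = (if v\<^sub>0 > 0 then 1 else - 1)"
  define m0 where "m0 = int p * j + \<sigma>"
  have \<sigma>: "\<sigma> \<in> {1, -1}" by (simp add: \<sigma>_def)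
  have d0: "\<bar>Im z - of_int m0\<bar> = 1 - \<bar>v\<^sub>0\<bar>"
    using z(2,4,5) by (simp add: m0_def \<sigma>_def j)
  have far: "\<bar>Im z - of_int m\<bar> > \<bar>Im z - of_int m0\<bar>" if "m \<noteq> m0" "singlet_coeff p r' s' m \<noteq> 0" for r' s' m
  proof -
    have "\<not> int p dvd m" using that(2) unfolding singlet_coeff_eq_0_iff[OF p0] by auto
    hence "m \<noteq> k" using k by auto
    define i where "i = k - m"
    have i: "i \<noteq> 0" "i \<noteq> - \<sigma>" using \<open>m \<noteq> k\<close> that(1) by (auto simp: i_def m0_def j)
    have "Im z - of_int m = v\<^sub>0 + of_int i" using z(2) by (simp add: i_def)
    moreover have "\<bar>v\<^sub>0 + of_int i\<bar> > 1 - \<bar>v\<^sub>0\<bar>"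
    proof (cases "v\<^sub>0 > 0")
      case True
      hence "i \<ge> 1 \<or> i \<le> - 2" using i by (auto simp: \<sigma>_def)
      hence "real_of_int i \<ge> 1 \<or> real_of_int i \<le> - 2" by linarith
      thus ?thesis using True z(4) by linarith
    next
      case False
      hence "i \<ge> 2 \<or> i \<le> - 1" using i by (auto simp: \<sigma>_def)
      hence "real_of_int i \<ge> 2 \<or> real_of_int i \<le> - 1" by linarith
      thus ?thesis using False z(4,5) by linarith
    qed
    ultimately show ?thesis unfolding d0 by simp
  qed
  have "\<not> int p dvd m0" unfolding m0_def using \<sigma> p by (auto simp: zdvd_reduce dvd_add_right_iff)
  hence nz: "singlet_coeff p 1 1 m0 \<noteq> 0" by (simp add: singlet_coeff_eq_0_iff[OF p0])
  have m0: "\<bar>Im z - of_int m0\<bar> \<le> Re z" using z d0 by simp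
  have L: "(- 1) powi (m0 * (r + 1)) * sin (pi * of_int m0 * real s / real p) / sin (pi * of_int m0 / real p)
     = (- 1) powi ((r + 1) * (k + 1) + (k * (int s + 1)) div int p) * sin (pi * real s / real p) / sin (pi / real p)"
  proof -
    have q: "(k * (int s + 1)) div int p = j * (int s + 1)" using p0 by (simp add: j mult.assoc)
    have s1: "sin (pi * of_int m0 * real s / real p) = (- 1) powi (j * int s) * (of_int \<sigma> * sin (pi * real s / real p))"
      unfolding m0_def by (rule sin_pi_multiple_shift[OF p0 \<sigma>])
    have s2: "sin (pi * of_int m0 / real p) = (- 1) powi j * (of_int \<sigma> * sin (pi / real p))"
      using sin_pi_multiple_shift[OF p0 \<sigma>, of j 1] unfolding m0_def by simp
    \<comment> \<open>\<open>m0\<close> is \<open>k + 1\<close> or \<open>k - 1\<close>, and these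
      have the same parity.\<close>
    have "even (m0 * (r + 1)) = even ((r + 1) * (k + 1))"
      using \<sigma> by (auto simp: m0_def j)
    hence p1: "(- 1) powi (m0 * (r + 1)) = ((- 1) powi ((r + 1) * (k + 1)) :: real)"
      by (simp add: power_int_minus_left)
    have p2: "(- 1) powi (j * (int s + 1)) = ((- 1) powi (j * int s) / (- 1) powi j :: real)"
      by (auto simp: power_int_minus_left)
    have "of_int \<sigma> \<noteq> (0::real)" using \<sigma> by auto
    thus ?thesis unfolding q s1 s2 p1 minus_one_powi_add p2 by simp
  qed
  have "((\<lambda>c. singlet_num p z r s c / singlet_num p z 1 1 c) \<longlongrightarrow> singlet_coeff p r s m0 / singlet_coeff p 1 1 m0) (at_right 0)"
    and "((\<lambda>c. 1 / singlet_num p z 1 1 c) \<longlongrightarrow> 0) (at_right 0)"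
    using singlet_ratio_single[OF z(1) m0 _ nz, of r s] far by blast+
  from qdim_from_ratio[OF p0 \<epsilon> this] show ?thesis
    unfolding singlet_coeff_ratio[OF p0] L .
qed

text \<open>The squared moduli of the vacuum coefficients at \<open>k\<close> and
  \<open>k + 1\<close> differ by a nonzero multiple of \<open>sin (2 * K) * sin (2 * H)\<close>, and
  \<open>sin (2 * K)\<close> vanishes exactly when \<open>p\<close> divides
  \<open>2 * k + 1\<close>. Under the tangent condition the factor of proportionality appears on
  dividing by \<open>cos H * sin K\<close>.\<close>

lemma qdim_half_integer:
  fixes p s :: nat and r k :: int and \<mu> z :: complex
  assumes p: "p \<ge> 2" and s: "1 \<le> s" "s \<le> p - 1" and \<epsilon>: "\<epsilon> = z / of_real (sqrt (2 * real p))"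
    and z: "Re z \<ge> 1 / 2" "Im z = of_int k + 1 / 2" and k: "\<not> int p dvd 2 * k + 1"
  shows "has_qdim p \<epsilon> (ch_F p \<epsilon> \<mu>) 0
        \<and> ((\<exists>L. has_qdim p \<epsilon> (ch_M p \<epsilon> r s) L) \<longleftrightarrow>
             tan (pi * real s / (2 * real p) + pi * of_int r / 2) * tan (pi / (2 * real p))
             = tan (pi * of_int (2 * k + 1) * real s / (2 * real p) + pi * of_int r / 2)
               * tan (pi * of_int (2 * k + 1) / (2 * real p)))
        \<and> (tan (pi * real s / (2 * real p) + pi * of_int r / 2) * tan (pi / (2 * real p))
             = tan (pi * of_int (2 * k + 1) * real s / (2 * real p) + pi * of_int r / 2)
               * tan (pi * of_int (2 * k + 1) / (2 * real p))
           \<longrightarrow> has_qdim p \<epsilon> (ch_M p \<epsilon> r s)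
                 (of_real ((- 1) powi ((r + 1) * k + 1)
                   * sin (pi * real s / (2 * real p) + pi * of_int r / 2)
                   * cos (pi / (2 * real p) * of_int (2 * k + 1) * real s + pi * of_int r / 2)
                   / (cos (pi / (2 * real p)) * sin (pi / (2 * real p) * of_int (2 * k + 1))))))"
proof -
  have p0: "p > 0" using p by simp
  define \<alpha> where "\<alpha> = pi * real s / (2 * real p) + pi * of_int r / 2"
  define \<kappa> where "\<kappa> = pi * of_int (2 * k + 1) * real s / (2 * real p) + pi * of_int r / 2"
  define H where "H = pi / (2 * real p)"
  define K where "K = pi * of_int (2 * k + 1) / (2 * real p)"
  have dbl: "sin x \<noteq> 0 \<and> cos x \<noteq> 0" if "sin (2 * x) \<noteq> 0" for x :: real
    using that by (auto simp: sin_double)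
  have H: "sin H \<noteq> 0" "cos H \<noteq> 0"
  proof -
    have "2 * H = pi * of_int 1 * real 1 / real p" by (simp add: H_def)
    moreover have "\<not> int p dvd 1 * int 1" using p by auto
    ultimately have "sin (2 * H) \<noteq> 0" by (simp only: sin_pi_rational_eq_0_iff[OF p0]) simp
    from dbl[OF this] show "sin H \<noteq> 0" "cos H \<noteq> 0" by auto
  qed
  have K: "sin K \<noteq> 0" "cos K \<noteq> 0" and K2: "sin (2 * K) \<noteq> 0"
  proof -
    have "2 * K = pi * of_int (2 * k + 1) * real 1 / real p" by (simp add: K_def)
    moreover have "\<not> int p dvd (2 * k + 1) * int 1" using k by simp
    ultimately show "sin (2 * K) \<noteq> 0" by (simp only: sin_pi_rational_eq_0_iff[OF p0]) simp
    from dbl[OF this] show "sin K \<noteq> 0" "cos K \<noteq> 0" by auto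
  qed
  have \<alpha>: "sin \<alpha> \<noteq> 0" "cos \<alpha> \<noteq> 0"
  proof -
    have "2 * \<alpha> = pi * of_int 1 * real s / real p + pi * of_int r" by (simp add: \<alpha>_def)
    hence "sin (2 * \<alpha>) = (- 1) powi r * sin (pi * of_int 1 * real s / real p)" by (simp only: sin_add_pi_int)
    moreover have "\<not> int p dvd 1 * int s" using s p by (auto dest: dvd_imp_le)
    hence "sin (pi * of_int 1 * real s / real p) \<noteq> 0" by (simp only: sin_pi_rational_eq_0_iff[OF p0]) simp
    ultimately have "sin (2 * \<alpha>) \<noteq> 0" by simp
    from dbl[OF this] show "sin \<alpha> \<noteq> 0" "cos \<alpha> \<noteq> 0" by auto
  qed
  define \<tau> :: real where "\<tau> = (- 1) powi k"
  define \<rho> :: real where "\<rho> = (- 1) powi (k * r)"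
  have \<tau>: "\<tau> * \<tau> = 1" and \<rho>: "\<rho> \<noteq> 0" by (simp_all add: \<tau>_def \<rho>_def power_int_minus_left)
  have c0: "singlet_coeff p r s k = - 2 * \<i> * of_real (\<rho> * sin (\<kappa> - \<alpha>))"
    and c1: "singlet_coeff p r s (k + 1) = - 2 * \<i> * of_real (\<rho> * sin (\<kappa> + \<alpha>))"
    unfolding \<alpha>_def \<kappa>_def \<rho>_def by (rule singlet_coeff_half_angles[OF p0])+
  have d0: "singlet_coeff p 1 1 k = - 2 * \<i> * of_real (\<tau> * sin (K - H))"
    using singlet_coeff_half_angles(1)[OF p0, of 1 1 k] by (simp add: K_def H_def \<tau>_def)
  \<comment> \<open>For \<open>r = s = 1\<close> the two angles are \<open>K + pi / 2\<close> and
    \<open>H + pi / 2\<close>; the two quarter turns add up to the minus sign.\<close>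
  have d1: "singlet_coeff p 1 1 (k + 1) = - 2 * \<i> * of_real (- (\<tau> * sin (K + H)))"
  proof -
    have "sin (K + pi / 2 + (H + pi / 2)) = - sin (K + H)"
      using sin_add_pi_int[of "K + H" 1] by (simp add: add_ac)
    moreover have "singlet_coeff p 1 1 (k + 1) = - 2 * \<i> * of_real (\<tau> * sin (K + pi / 2 + (H + pi / 2)))"
      using singlet_coeff_half_angles(2)[OF p0, of 1 1 k] by (simp add: K_def H_def \<tau>_def)
    ultimately show ?thesis by simp
  qed
  have cmul: "- 2 * \<i> * of_real a = L * (- 2 * \<i> * of_real b) \<longleftrightarrow> of_real a = L * of_real b" for a b :: real and L :: complex
    by (simp add: mult.left_commute)
  have norm_c: "norm (- 2 * \<i> * of_real a) = 2 * \<bar>a\<bar>" for a :: real by (simp add: norm_mult)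
  have ne: "norm (singlet_coeff p 1 1 k) \<noteq> norm (singlet_coeff p 1 1 (k + 1))"
  proof
    assume "norm (singlet_coeff p 1 1 k) = norm (singlet_coeff p 1 1 (k + 1))"
    moreover have "\<bar>\<tau>\<bar> = 1" by (simp add: \<tau>_def power_int_minus_left)
    ultimately have "\<bar>sin (K - H)\<bar> = \<bar>sin (K + H)\<bar>" unfolding d0 d1 norm_c by (simp add: abs_mult)
    hence "(sin (K - H))\<^sup>2 = (sin (K + H))\<^sup>2" by (simp only: abs_eq_iff power2_eq_iff)
    moreover have "(sin (K + H))\<^sup>2 - (sin (K - H))\<^sup>2 = sin (2 * K) * (2 * sin H * cos H)"
      unfolding sin_double sin_add sin_diff by (simp add: power2_eq_square algebra_simps)
    ultimately show False using K2 H by simp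
  qed
  note R = singlet_ratio_double[OF z ne]
  have iff: "has_qdim p \<epsilon> (ch_M p \<epsilon> r s) L \<longleftrightarrow> of_real (\<rho> * sin (\<kappa> - \<alpha>)) = L * of_real (\<tau> * sin (K - H)) \<and> of_real (\<rho> * sin (\<kappa> + \<alpha>)) = L * of_real (- (\<tau> * sin (K + H)))" for L
    unfolding \<epsilon> has_qdim_M_iff[OF p0] R(2) c0 c1 d0 d1 cmul ..
  have tan_iff: "tan \<alpha> * tan H = tan \<kappa> * tan K \<longleftrightarrow> sin \<kappa> * cos \<alpha> * sin K * cos H = cos \<kappa> * sin \<alpha> * cos K * sin H"
    by (rule tan_condition_iff) (use H K \<alpha> in auto)
  have F: "has_qdim p \<epsilon> (ch_F p \<epsilon> \<mu>) 0"
    unfolding \<epsilon> by (rule has_qdim_F[OF p0 R(1)]) simp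
  have nec: "tan \<alpha> * tan H = tan \<kappa> * tan K" if L: "has_qdim p \<epsilon> (ch_M p \<epsilon> r s) L" for L
  proof -
    have "complex_of_real (\<rho> * sin (\<kappa> - \<alpha>)) * of_real (- (\<tau> * sin (K + H))) = of_real (\<rho> * sin (\<kappa> + \<alpha>)) * of_real (\<tau> * sin (K - H))"
      using L unfolding iff by simp
    hence "(\<rho> * sin (\<kappa> - \<alpha>)) * (- (\<tau> * sin (K + H))) = (\<rho> * sin (\<kappa> + \<alpha>)) * (\<tau> * sin (K - H))"
      unfolding of_real_mult[symmetric] of_real_eq_iff .
    hence "\<rho> * \<tau> * (sin (\<kappa> - \<alpha>) * sin (K + H)) = \<rho> * \<tau> * (- (sin (\<kappa> + \<alpha>) * sin (K - H)))"
      by (simp add: algebra_simps)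
    moreover have "\<rho> * \<tau> \<noteq> 0" using \<rho> \<tau> by auto
    ultimately have "sin (\<kappa> - \<alpha>) * sin (K + H) = - (sin (\<kappa> + \<alpha>) * sin (K - H))"
      by (simp only: mult_cancel_left) simp
    thus ?thesis unfolding tan_iff cross_product_iff .
  qed
  have suf: "has_qdim p \<epsilon> (ch_M p \<epsilon> r s) (of_real ((- 1) powi ((r + 1) * k + 1) * sin \<alpha> * cos \<kappa> / (cos H * sin K)))"
    if T: "tan \<alpha> * tan H = tan \<kappa> * tan K"
  proof -
    have C: "sin \<kappa> * cos \<alpha> * sin K * cos H = cos \<kappa> * sin \<alpha> * cos K * sin H" using T unfolding tan_iff .
    have sgn: "(- 1) powi ((r + 1) * k + 1) = - (\<rho> * \<tau>)"
      by (auto simp: \<rho>_def \<tau>_def power_int_minus_left)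
    have D: "cos H * sin K \<noteq> 0" using H K by simp
    \<comment> \<open>\<open>C\<close> replaces the part with
      \<open>sin \<kappa> * cos \<alpha>\<close> by one with
      \<open>cos \<kappa> * sin \<alpha>\<close>; the rest is an addition formula for
      \<open>K\<close> and \<open>H\<close>.\<close>
    have 1: "sin (\<kappa> - \<alpha>) * (cos H * sin K) = - (sin \<alpha> * cos \<kappa>) * sin (K - H)"
      using C by (simp add: sin_diff algebra_simps)
    have 2: "sin (\<kappa> + \<alpha>) * (cos H * sin K) = (sin \<alpha> * cos \<kappa>) * sin (K + H)"
      using C by (simp add: sin_add algebra_simps)
    have s1: "sin (\<kappa> - \<alpha>) = - (sin \<alpha> * cos \<kappa>) * sin (K - H) / (cos H * sin K)"
      using 1 D by (simp only: eq_divide_eq) simp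
    have s2: "sin (\<kappa> + \<alpha>) = (sin \<alpha> * cos \<kappa>) * sin (K + H) / (cos H * sin K)"
      using 2 D by (simp only: eq_divide_eq) simp
    have 3: "\<rho> * sin (\<kappa> - \<alpha>) = (- (\<rho> * \<tau>) * sin \<alpha> * cos \<kappa> / (cos H * sin K)) * (\<tau> * sin (K - H))"
    proof -
      have "(- (\<rho> * \<tau>) * sin \<alpha> * cos \<kappa> / (cos H * sin K)) * (\<tau> * sin (K - H)) = (\<tau> * \<tau>) * (\<rho> * (- (sin \<alpha> * cos \<kappa>) * sin (K - H) / (cos H * sin K)))"
        by simp
      thus ?thesis unfolding \<tau> s1[symmetric] by simp
    qed
    have 4: "\<rho> * sin (\<kappa> + \<alpha>) = (- (\<rho> * \<tau>) * sin \<alpha> * cos \<kappa> / (cos H * sin K)) * (- (\<tau> * sin (K + H)))"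
    proof -
      have "(- (\<rho> * \<tau>) * sin \<alpha> * cos \<kappa> / (cos H * sin K)) * (- (\<tau> * sin (K + H))) = (\<tau> * \<tau>) * (\<rho> * ((sin \<alpha> * cos \<kappa>) * sin (K + H) / (cos H * sin K)))"
        by simp
      thus ?thesis unfolding \<tau> s2[symmetric] by simp
    qed
    show ?thesis unfolding iff sgn of_real_mult[symmetric] of_real_eq_iff by (rule conjI[OF 3 4])
  qed
  have a1: "pi / (2 * real p) * of_int (2 * k + 1) * real s + pi * of_int r / 2 = \<kappa>" by (simp add: \<kappa>_def)
  have a2: "pi / (2 * real p) * of_int (2 * k + 1) = K" by (simp add: K_def)
  show ?thesis
    unfolding a1 unfolding a2 unfolding \<alpha>_def[symmetric] \<kappa>_def[symmetric] H_def[symmetric] K_def[symmetric]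
    using F nec suf by blast
qed

text \<open>One sign exponent serves both parities of \<open>j\<close>. For the typical module the
  shift by \<open>alpha0 p / 2\<close> contributes the sign of \<open>k - j\<close>, which cancels
  the sign of \<open>k + j\<close> in the vacuum numerator.\<close>

lemma qdim_multiple:
  fixes p s :: nat and r k :: int and \<mu> :: complex
  assumes p: "p > 0" and \<epsilon>: "\<epsilon> = (\<i> * of_int k) / of_real (sqrt (2 * real p))" and k: "k = int p * j"
  shows "has_qdim p \<epsilon> (ch_M p \<epsilon> r s) (of_real ((- 1) powi (k * (r + 1) + j * (int s + 1)) * real s))
     \<and> has_qdim p \<epsilon> (ch_F p \<epsilon> \<mu>) (exp (2 * of_real pi * \<i> * of_int k * \<mu> / of_real (sqrt (2 * real p))) * of_nat p)"
proof
  let ?D = "(- 1) powi (k + j) * (1 / real p)"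
  have D0: "complex_of_real ?D \<noteq> 0" using p by simp
  have l: "(singlet_num p (\<i> * of_int k) r s \<longlongrightarrow> of_real ((- 1) powi (k * r + j * int s) * (real s / real p))) (at_right 0)"
    by (rule singlet_num_imaginary_multiple[OF p k])
  have l1: "(singlet_num p (\<i> * of_int k) 1 1 \<longlongrightarrow> of_real ?D) (at_right 0)"
    using singlet_num_imaginary_multiple[OF p k, of 1 1] by simp
  have e: "(- 1) powi (k * r + j * int s) * (real s / real p) / ?D = (- 1) powi (k * (r + 1) + j * (int s + 1)) * real s"
    using p by (auto simp: power_int_minus_left)
  from tendsto_divide[OF l l1 D0] show "has_qdim p \<epsilon> (ch_M p \<epsilon> r s) (of_real ((- 1) powi (k * (r + 1) + j * (int s + 1)) * real s))"
    unfolding \<epsilon> has_qdim_M_iff[OF p] of_real_divide[symmetric] e .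
  define S where "S = sqrt (2 * real p)"
  have S: "S > 0" "S * S = 2 * real p" using p by (simp_all add: S_def)
  have a: "alpha0 p / 2 / S = (1 - 1 / real p) / 2"
  proof -
    have "sqrt (2 / real p) = 2 / S"
    proof (rule real_sqrt_unique)
      show "(2 / S)\<^sup>2 = 2 / real p" using S p by (simp add: power2_eq_square)
    qed (use S in simp)
    hence "alpha0 p / 2 / S = (S - 2 / S) / 2 / S" by (simp add: alpha0_def S_def)
    also have "\<dots> = (1 - 2 / (S * S)) / 2" using S(1) by (simp add: field_simps)
    finally show ?thesis unfolding S(2) by simp
  qed
  have "2 * of_real pi * ((\<i> * of_int k) / of_real S) * (\<mu> - of_real (alpha0 p / 2))
     = 2 * of_real pi * \<i> * of_int k * \<mu> / of_real S - 2 * of_real pi * \<i> * of_int k * of_real (alpha0 p / 2 / S)"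
    using S(1) by (simp add: field_simps)
  also have "2 * of_real pi * \<i> * of_int k * of_real (alpha0 p / 2 / S) = of_real pi * \<i> * of_int (k - j)"
    unfolding a using p by (simp add: k field_simps)
  finally have "exp (2 * of_real pi * ((\<i> * of_int k) / of_real S) * (\<mu> - of_real (alpha0 p / 2))) * (1 / of_real ?D)
    = exp (2 * of_real pi * \<i> * of_int k * \<mu> / of_real S) / of_real ((- 1) powi (k - j)) * (1 / of_real ?D)"
    by (simp only: exp_diff exp_pi_i_int)
  also have "\<dots> = exp (2 * of_real pi * \<i> * of_int k * \<mu> / of_real S) * of_nat p"
    by (auto simp: power_int_minus_left)
  finally show "has_qdim p \<epsilon> (ch_F p \<epsilon> \<mu>) (exp (2 * of_real pi * \<i> * of_int k * \<mu> / of_real (sqrt (2 * real p))) * of_nat p)"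
    unfolding \<epsilon> S_def by (intro has_qdim_F[OF p tendsto_divide[OF tendsto_const l1 D0, of 1]]) (rule sym)
qed

theorem theorem1p3:
  fixes p s :: nat and r k :: int and \<mu> \<epsilon> \<epsilon>\<^sub>0 :: complex and u\<^sub>0 v\<^sub>0 :: real
  assumes "p \<ge> 2" and "1 \<le> s" and "s \<le> p - 1"
    and "\<epsilon> = (\<epsilon>\<^sub>0 + \<i> * of_int k) / of_real (sqrt (2 * real p))"
    and "\<epsilon>\<^sub>0 = of_real u\<^sub>0 + \<i> * of_real v\<^sub>0"
    and "- 1 / 2 < v\<^sub>0" and "v\<^sub>0 \<le> 1 / 2"
  shows
    "(Re \<epsilon> < 0
        \<or> (Re \<epsilon> > 0 \<and> \<bar>v\<^sub>0\<bar> > \<bar>u\<^sub>0\<bar>)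
        \<or> (Re \<epsilon> > 0 \<and> int p dvd k \<and> \<bar>u\<^sub>0\<bar> < 1 - \<bar>v\<^sub>0\<bar> \<and> v\<^sub>0 \<noteq> 1 / 2)
        \<or> (u\<^sub>0 = 0 \<and> v\<^sub>0 \<noteq> 0)
      \<longrightarrow> has_qdim p \<epsilon> (ch_M p \<epsilon> r s)
            (exp (of_real pi * \<epsilon> * of_real (sqrt (2 * real p)) * (1 - of_int r))
              * sinh (of_real (sqrt 2 * pi * real s) * \<epsilon> / of_real (sqrt (real p)))
              / sinh (of_real (sqrt 2 * pi) * \<epsilon> / of_real (sqrt (real p))))
        \<and> has_qdim p \<epsilon> (ch_F p \<epsilon> \<mu>)
            (exp (2 * of_real pi * \<epsilon>
                  * (\<mu> - of_real (sqrt (real p / 2)) + of_real (sqrt (1 / (2 * real p)))))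
              * sinh (of_real (sqrt (2 * real p) * pi) * \<epsilon>)
              / sinh (of_real (sqrt 2 * pi) * \<epsilon> / of_real (sqrt (real p)))))
   \<and> (Re \<epsilon> > 0 \<and> \<not> int p dvd k \<and> \<bar>v\<^sub>0\<bar> \<le> \<bar>u\<^sub>0\<bar> \<and> v\<^sub>0 \<noteq> 1 / 2
      \<longrightarrow> has_qdim p \<epsilon> (ch_M p \<epsilon> r s)
            (of_real ((- 1) powi (k * (r + 1))
              * sin (pi * of_int k * real s / real p) / sin (pi * of_int k / real p)))
        \<and> has_qdim p \<epsilon> (ch_F p \<epsilon> \<mu>) 0)
   \<and> (Re \<epsilon> > 0 \<and> int p dvd k \<and> 1 - \<bar>u\<^sub>0\<bar> \<le> \<bar>v\<^sub>0\<bar> \<and> \<bar>v\<^sub>0\<bar> \<le> \<bar>u\<^sub>0\<bar> \<and> v\<^sub>0 \<noteq> 1 / 2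
        \<and> v\<^sub>0 \<noteq> 0
      \<longrightarrow> has_qdim p \<epsilon> (ch_M p \<epsilon> r s)
            (of_real ((- 1) powi ((r + 1) * (k + 1) + (k * (int s + 1)) div int p)
              * sin (pi * real s / real p) / sin (pi / real p)))
        \<and> has_qdim p \<epsilon> (ch_F p \<epsilon> \<mu>) 0)
   \<and> (Re \<epsilon> > 0 \<and> v\<^sub>0 = 1 / 2 \<and> \<bar>u\<^sub>0\<bar> \<ge> 1 / 2 \<and> \<not> int p dvd 2 * k + 1
      \<longrightarrow> has_qdim p \<epsilon> (ch_F p \<epsilon> \<mu>) 0
        \<and> ((\<exists>L. has_qdim p \<epsilon> (ch_M p \<epsilon> r s) L) \<longleftrightarrow>
             tan (pi * real s / (2 * real p) + pi * of_int r / 2) * tan (pi / (2 * real p))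
             = tan (pi * of_int (2 * k + 1) * real s / (2 * real p) + pi * of_int r / 2)
               * tan (pi * of_int (2 * k + 1) / (2 * real p)))
        \<and> (tan (pi * real s / (2 * real p) + pi * of_int r / 2) * tan (pi / (2 * real p))
             = tan (pi * of_int (2 * k + 1) * real s / (2 * real p) + pi * of_int r / 2)
               * tan (pi * of_int (2 * k + 1) / (2 * real p))
           \<longrightarrow> has_qdim p \<epsilon> (ch_M p \<epsilon> r s)
                 (of_real ((- 1) powi ((r + 1) * k + 1)
                   * sin (pi * real s / (2 * real p) + pi * of_int r / 2)
                   * cos (pi / (2 * real p) * of_int (2 * k + 1) * real s + pi * of_int r / 2)
                   / (cos (pi / (2 * real p)) * sin (pi / (2 * real p) * of_int (2 * k + 1)))))))
   \<and> (\<epsilon>\<^sub>0 = 0 \<and> \<not> int p dvd k * int s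
      \<longrightarrow> has_qdim p \<epsilon> (ch_M p \<epsilon> r s)
            (of_real ((- 1) powi (k * (r + 1))
              * sin (pi * of_int k * real s / real p) / sin (pi * of_int k / real p)))
        \<and> has_qdim p \<epsilon> (ch_F p \<epsilon> \<mu>) 0)
   \<and> (\<epsilon>\<^sub>0 = 0 \<and> int p dvd k * int s
      \<longrightarrow> (\<not> int p dvd k
            \<longrightarrow> has_qdim p \<epsilon> (ch_M p \<epsilon> r s) 0 \<and> has_qdim p \<epsilon> (ch_F p \<epsilon> \<mu>) 0)
        \<and> ((\<exists>m::int. k = int p * (2 * m))
            \<longrightarrow> has_qdim p \<epsilon> (ch_M p \<epsilon> r s) (of_nat s)
              \<and> has_qdim p \<epsilon> (ch_F p \<epsilon> \<mu>)
                  (exp (2 * of_real pi * \<i> * of_int k * \<mu> / of_real (sqrt (2 * real p))) * of_nat p))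
        \<and> ((\<exists>m::int. k = int p * (2 * m + 1))
            \<longrightarrow> has_qdim p \<epsilon> (ch_M p \<epsilon> r s)
                  ((- 1) powi ((int s + 1) + int p * (r + 1)) * of_nat s)
              \<and> has_qdim p \<epsilon> (ch_F p \<epsilon> \<mu>)
                  (exp (2 * of_real pi * \<i> * of_int k * \<mu> / of_real (sqrt (2 * real p))) * of_nat p)))"
proof -
  define z where "z = \<epsilon>\<^sub>0 + \<i> * of_int k"
  have p: "p > 0" using assms(1) by simp
  have Rez: "Re z = u\<^sub>0" and Imz: "Im z = v\<^sub>0 + of_int k" by (simp_all add: z_def assms(5))
  have \<epsilon>: "\<epsilon> = z / of_real (sqrt (2 * real p))" by (simp add: z_def assms(4))
  have Re\<epsilon>: "Re \<epsilon> = u\<^sub>0 / sqrt (2 * real p)" unfolding \<epsilon> by (simp add: Rez)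
  have pos: "Re \<epsilon> > 0 \<longleftrightarrow> u\<^sub>0 > 0" and neg: "Re \<epsilon> < 0 \<longleftrightarrow> u\<^sub>0 < 0"
    unfolding Re\<epsilon> using p by (simp_all add: zero_less_divide_iff divide_less_0_iff)
  have v: "\<bar>v\<^sub>0\<bar> \<le> 1 / 2" using assms(6,7) by linarith
  have far: "\<bar>Im z - of_int m\<bar> \<ge> 1 - \<bar>v\<^sub>0\<bar>" if "m \<noteq> k" for m
    unfolding Imz by (rule int_distance[OF that])
  \<comment> \<open>The value 1 would force \<open>u\<^sub>0 = 0\<close> and make
    \<open>v\<^sub>0\<close> an integer of modulus at most 1/2, hence 0.\<close>
  have ne: "exp (2 * of_real pi * z) \<noteq> 1" if "u\<^sub>0 \<noteq> 0 \<or> v\<^sub>0 \<noteq> 0"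
  proof
    assume "exp (2 * of_real pi * z) = 1"
    then obtain n :: int where n: "Re (2 * of_real pi * z) = 0" "Im (2 * of_real pi * z) = of_int (2 * n) * pi"
      unfolding exp_eq_1 by blast
    have u: "u\<^sub>0 = 0" using n(1) Rez by simp
    have "2 * pi * Im z = 2 * pi * of_int n" using n(2) by simp
    hence "v\<^sub>0 = of_int (n - k)" using Imz by simp
    moreover from this have "n - k = 0" using v by linarith
    ultimately show False using that u by simp
  qed
  \<comment> \<open>If \<open>\<bar>v\<^sub>0\<bar> > \<bar>u\<^sub>0\<bar>\<close>, then
    \<open>\<bar>u\<^sub>0\<bar> < 1 / 2 \<le> 1 - \<bar>v\<^sub>0\<bar>\<close>, so integers other
    than \<open>k\<close> are far away in both alternatives; \<open>k\<close> itself is far in the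
    first and a multiple of \<open>p\<close> in the second.\<close>
  have far_all: "\<forall>m. \<not> int p dvd m \<longrightarrow> \<bar>Im z - of_int m\<bar> > Re z"
    if "u\<^sub>0 > 0" "\<bar>v\<^sub>0\<bar> > \<bar>u\<^sub>0\<bar> \<or> int p dvd k \<and> \<bar>u\<^sub>0\<bar> < 1 - \<bar>v\<^sub>0\<bar>"
  proof (intro allI impI)
    fix m assume m: "\<not> int p dvd m"
    show "\<bar>Im z - of_int m\<bar> > Re z"
    proof (cases "m = k")
      case True
      thus ?thesis using that m by (auto simp: Rez Imz)
    next
      case False
      thus ?thesis using far[OF False] that v unfolding Rez by linarith
    qed
  qed
  have cond_i: "exp (2 * of_real pi * z) \<noteq> 1 \<and> (Re z \<le> 0 \<or> Re z > 0 \<and> (\<forall>m. \<not> int p dvd m \<longrightarrow> \<bar>Im z - of_int m\<bar> > Re z))"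
    if "Re \<epsilon> < 0 \<or> (Re \<epsilon> > 0 \<and> \<bar>v\<^sub>0\<bar> > \<bar>u\<^sub>0\<bar>)
        \<or> (Re \<epsilon> > 0 \<and> int p dvd k \<and> \<bar>u\<^sub>0\<bar> < 1 - \<bar>v\<^sub>0\<bar> \<and> v\<^sub>0 \<noteq> 1 / 2) \<or> (u\<^sub>0 = 0 \<and> v\<^sub>0 \<noteq> 0)"
    using that unfolding pos neg
  proof (elim disjE conjE)
    assume "u\<^sub>0 < 0"
    thus ?thesis using ne by (auto simp: Rez)
  next
    assume "u\<^sub>0 > 0" "\<bar>v\<^sub>0\<bar> > \<bar>u\<^sub>0\<bar>"
    thus ?thesis using ne far_all by (simp add: Rez)
  next
    assume "u\<^sub>0 > 0" "int p dvd k" "\<bar>u\<^sub>0\<bar> < 1 - \<bar>v\<^sub>0\<bar>"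
    thus ?thesis using ne far_all by (simp add: Rez)
  next
    assume "u\<^sub>0 = 0" "v\<^sub>0 \<noteq> 0"
    thus ?thesis using ne by (simp add: Rez)
  qed
  have case_i: "has_qdim p \<epsilon> (ch_M p \<epsilon> r s)
            (exp (of_real pi * \<epsilon> * of_real (sqrt (2 * real p)) * (1 - of_int r))
              * sinh (of_real (sqrt 2 * pi * real s) * \<epsilon> / of_real (sqrt (real p)))
              / sinh (of_real (sqrt 2 * pi) * \<epsilon> / of_real (sqrt (real p))))
        \<and> has_qdim p \<epsilon> (ch_F p \<epsilon> \<mu>)
            (exp (2 * of_real pi * \<epsilon>
                  * (\<mu> - of_real (sqrt (real p / 2)) + of_real (sqrt (1 / (2 * real p)))))
              * sinh (of_real (sqrt (2 * real p) * pi) * \<epsilon>)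
              / sinh (of_real (sqrt 2 * pi) * \<epsilon> / of_real (sqrt (real p))))"
    if "Re \<epsilon> < 0 \<or> (Re \<epsilon> > 0 \<and> \<bar>v\<^sub>0\<bar> > \<bar>u\<^sub>0\<bar>)
        \<or> (Re \<epsilon> > 0 \<and> int p dvd k \<and> \<bar>u\<^sub>0\<bar> < 1 - \<bar>v\<^sub>0\<bar> \<and> v\<^sub>0 \<noteq> 1 / 2) \<or> (u\<^sub>0 = 0 \<and> v\<^sub>0 \<noteq> 0)"
    using cond_i[OF that] by (intro qdim_generic[OF p _ _ \<epsilon>]) blast+
  have case_ii: "has_qdim p \<epsilon> (ch_M p \<epsilon> r s)
            (of_real ((- 1) powi (k * (r + 1)) * sin (pi * of_int k * real s / real p) / sin (pi * of_int k / real p)))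
        \<and> has_qdim p \<epsilon> (ch_F p \<epsilon> \<mu>) 0"
    if "Re \<epsilon> > 0 \<and> \<not> int p dvd k \<and> \<bar>v\<^sub>0\<bar> \<le> \<bar>u\<^sub>0\<bar> \<and> v\<^sub>0 \<noteq> 1 / 2"
    by (rule qdim_nearest[OF p \<epsilon> _ Imz]) (use that v assms(6) in \<open>auto simp: pos Rez abs_if split: if_splits\<close>)
  have case_iii: "has_qdim p \<epsilon> (ch_M p \<epsilon> r s)
            (of_real ((- 1) powi ((r + 1) * (k + 1) + (k * (int s + 1)) div int p)
              * sin (pi * real s / real p) / sin (pi / real p)))
        \<and> has_qdim p \<epsilon> (ch_F p \<epsilon> \<mu>) 0"
    if "Re \<epsilon> > 0 \<and> int p dvd k \<and> 1 - \<bar>u\<^sub>0\<bar> \<le> \<bar>v\<^sub>0\<bar> \<and> \<bar>v\<^sub>0\<bar> \<le> \<bar>u\<^sub>0\<bar> \<and> v\<^sub>0 \<noteq> 1 / 2 \<and> v\<^sub>0 \<noteq> 0"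
    by (rule qdim_second_nearest[OF assms(1) \<epsilon> _ Imz]) (use that v assms(6) in \<open>auto simp: pos Rez abs_if split: if_splits\<close>)
  have cond_iv: "Re z \<ge> 1 / 2" "Im z = of_int k + 1 / 2" "\<not> int p dvd 2 * k + 1"
    if "Re \<epsilon> > 0 \<and> v\<^sub>0 = 1 / 2 \<and> \<bar>u\<^sub>0\<bar> \<ge> 1 / 2 \<and> \<not> int p dvd 2 * k + 1"
    using that by (auto simp: pos Rez Imz)
  note case_iv = qdim_half_integer[OF assms(1-3) \<epsilon> cond_iv]
  have \<epsilon>k: "\<epsilon> = (\<i> * of_int k) / of_real (sqrt (2 * real p))" if "\<epsilon>\<^sub>0 = 0"
    using that assms(4) by simp
  \<comment> \<open>The condition is on \<open>k\<close> rather than \<open>k * s\<close>, so that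
    this also covers the case where \<open>p\<close> divides \<open>k * s\<close> but not
    \<open>k\<close>; the sine in the numerator is then 0.\<close>
  have case_v: "has_qdim p \<epsilon> (ch_M p \<epsilon> r s)
            (of_real ((- 1) powi (k * (r + 1)) * sin (pi * of_int k * real s / real p) / sin (pi * of_int k / real p)))
        \<and> has_qdim p \<epsilon> (ch_F p \<epsilon> \<mu>) 0"
    if "\<epsilon>\<^sub>0 = 0" "\<not> int p dvd k"
    using qdim_from_ratio[OF p \<epsilon>k[OF that(1)] singlet_ratio_imaginary_integer[OF p that(2)]]
    unfolding singlet_coeff_ratio[OF p] .
  have case_vi: "has_qdim p \<epsilon> (ch_M p \<epsilon> r s) (of_real ((- 1) powi (k * (r + 1) + j * (int s + 1)) * real s))
     \<and> has_qdim p \<epsilon> (ch_F p \<epsilon> \<mu>) (exp (2 * of_real pi * \<i> * of_int k * \<mu> / of_real (sqrt (2 * real p))) * of_nat p)"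
    if "\<epsilon>\<^sub>0 = 0" "k = int p * j" for j
    by (rule qdim_multiple[OF p \<epsilon>k[OF that(1)] that(2)])
  show ?thesis
  proof (intro conjI impI, goal_cases)
    case 1 thus ?case by (rule case_i[THEN conjunct1])
  next
    case 2 thus ?case by (rule case_i[THEN conjunct2])
  next
    case 3 thus ?case by (rule case_ii[THEN conjunct1])
  next
    case 4 thus ?case by (rule case_ii[THEN conjunct2])
  next
    case 5 thus ?case by (rule case_iii[THEN conjunct1])
  next
    case 6 thus ?case by (rule case_iii[THEN conjunct2])
  next
    case 7 from case_iv[OF 7 7 7, THEN conjunct1] show ?case .
  next
    case 8 from case_iv[OF 8 8 8, THEN conjunct2, THEN conjunct1] show ?case .
  next
    case 9 from case_iv[OF 9(1) 9(1) 9(1), THEN conjunct2, THEN conjunct2, THEN mp, OF 9(2)] show ?case .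
  next
    case 10 thus ?case using case_v[THEN conjunct1] dvd_mult2 by blast
  next
    case 11 thus ?case using case_v[THEN conjunct2] dvd_mult2 by blast
  next
    case 12
    hence "sin (pi * of_int k * real s / real p) = 0" by (simp only: sin_pi_rational_eq_0_iff[OF p])
    thus ?case using case_v[THEN conjunct1] 12 by simp
  next
    case 13 thus ?case using case_v[THEN conjunct2] by blast
  next
    case 14
    then obtain m where m: "k = int p * (2 * m)" by blast
    have "(- 1) powi (k * (r + 1) + 2 * m * (int s + 1)) = (1::real)" unfolding m by simp
    thus ?case using case_vi[OF _ m, THEN conjunct1] 14 by simp
  next
    case 15 thus ?case using case_vi[THEN conjunct2] by blast
  next
    case 16
    then obtain m where m: "k = int p * (2 * m + 1)" by blast
    \<comment> \<open>\<open>k\<close> is an odd multiple of \<open>p\<close>, so \<open>p\<close>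
      may stand in for it in any parity.\<close>
    have "even (k * (r + 1) + (2 * m + 1) * (int s + 1)) = even ((int s + 1) + int p * (r + 1))"
      unfolding m by auto
    hence "(- 1) powi (k * (r + 1) + (2 * m + 1) * (int s + 1)) = ((- 1) powi ((int s + 1) + int p * (r + 1)) :: complex)"
      by (simp only: power_int_minus_left power_int_1_left)
    hence "of_real ((- 1) powi (k * (r + 1) + (2 * m + 1) * (int s + 1)) * real s) = ((- 1) powi ((int s + 1) + int p * (r + 1)) * of_nat s :: complex)"
      by (simp only: of_real_mult of_real_power_int of_real_minus of_real_1 of_real_of_nat_eq)
    thus ?case using case_vi[OF _ m, THEN conjunct1] 16 by (simp only:)
  next
    case 17 thus ?case using case_vi[THEN conjunct2] by blast
  qed
qed

end
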